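(* Let $G$ be a finite directed acyclic graph, let $\mathcal{X}$ be a Borel space, let $\mathcal{C}$ be a sequence of distinct closed subsets of $G$, and let $(\mathbf{X}_C : C\in\mathcal{C})$, with $\mathbf{X}_C=(X_{C,\alpha}:\alpha\in\mathbb{N}^C)$, be a $\mathcal{C}$-type random array collection in $\mathcal{X}$. If $(\mathbf{X}_C:C\in\mathcal{C})$ is DAG-exchangeable, then $$\Big(\big(X_{C,\alpha} : \alpha\in\mathbb{N}^C\big) : C\in\mathcal{C}\Big)\stackrel{d}{=}\Bigg(\Big(f_C\big(U_\beta : \beta\in\mathit{Restr}(\alpha)\big) : \alpha\in\mathbb{N}^C\Big) : C\in\mathcal{C}\Bigg)$$ for some family of measurable functions $(f_C:C\in\mathcal{C})$ with $f_C:[0,1]^{\mathcal{A}_C}\to\mathcal{X}$ and some independent $[0,1]$-uniform random variables $(U_\alpha:\alpha\in I_G)$.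
   Context: The vertex set of a finite directed acyclic graph (DAG) $G$ is also denoted $G$. For vertices, $v\preceq w$ means that there is a directed path (possibly of length zero) from $v$ to $w$. A subset $C\subseteq G$ is closed (downward-closed) if $w'\in C$ and $w\preceq w'$ imply $w\in C$. For closed $C$, $\mathcal{A}_C$ is the collection of all closed subsets $D\subseteq C$ (including $\emptyset$ and $C$). $\mathbb{N}^C$ is the set of functions $\alpha:C\to\mathbb{N}$, $\alpha|_D$ denotes restriction, and $I_C=\bigcup_{D\in\mathcal{A}_C}\mathbb{N}^D$. For $\alpha\in\mathbb{N}^C\subseteq I_G$: $\mathit{Dom}(\alpha)=C$ and $\mathit{Restr}(\alpha)=\{\alpha|_D : D\in\mathcal{A}_C\}$. In $f_C(U_\beta:\beta\in\mathit{Restr}(\alpha))$ with $\alpha\in\mathbb{N}^C$, $U_\beta$ is placed in the $\mathit{Dom}(\beta)$-coordinate of $[0,1]^{\mathcal{A}_C}$. A $\mathcal{C}$-type random array collection in $\mathcal{X}$ is a family $(\mathbf{X}_C:C\in\mathcal{C})$, on a common probability space, where each $\mathbf{X}_C=(X_{C,\alpha}:\alpha\in\mathbb{N}^C)$ is a family of $\mathcal{X}$-valued random variables. A Borel space is a measurable space isomorphic to a Borel subset of $[0,1]$. A $G$-automorphism is a bijection $\tau:\mathbb{N}^G\to\mathbb{N}^G$ such that for all $C\in\mathcal{A}_G$ and all $\alpha,\beta\in\mathbb{N}^G$: $\alpha|_C=\beta|_C\iff\tau(\alpha)|_C=\tau(\beta)|_C$. It induces a bijection of each $\mathbb{N}^C$,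 $C\in\mathcal{A}_G$, also denoted $\tau$, by $\tau(\beta)=\tau(\alpha)|_C$ for any $\alpha\in\mathbb{N}^G$ with $\alpha|_C=\beta$; put $\tau(\mathbf{X}_C)=(X_{C,\tau(\alpha)}:\alpha\in\mathbb{N}^C)$. The collection is DAG-exchangeable if $(\mathbf{X}_C:C\in\mathcal{C})\stackrel{d}{=}(\tau(\mathbf{X}_C):C\in\mathcal{C})$ (equality of joint distributions) for every $G$-automorphism $\tau$. *)

theory Defs
  imports "HOL-Probability.Probability"
begin

text \<open>
  A finite DAG is a finite vertex set \<open>G\<close> with an acyclic edge relation \<open>E\<close>, an edge
  \<open>(v, w)\<close> pointing from \<open>v\<close> to \<open>w\<close>; thus \<open>v \<preceq> w\<close> is \<open>(v, w) \<in> E\<^sup>*\<close>.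
\<close>

definition finite_dag :: "'v set \<Rightarrow> ('v \<times> 'v) set \<Rightarrow> bool" where
  "finite_dag G E \<longleftrightarrow> finite G \<and> E \<subseteq> G \<times> G \<and> acyclic E"

text \<open>\<open>\<A>\<^sub>C\<close>; in particular \<open>closed_subsets E G\<close> is the collection of all closed sets.\<close>

definition closed_subsets :: "('v \<times> 'v) set \<Rightarrow> 'v set \<Rightarrow> 'v set set" where
  "closed_subsets E C = {D. D \<subseteq> C \<and> (\<forall>w'\<in>D. \<forall>w. (w, w') \<in> E\<^sup>* \<longrightarrow> w \<in> D)}"

text \<open>
  Elements of \<open>\<nat>\<^sup>C\<close> are partial maps with domain exactly \<open>C\<close>, so that the sets \<open>\<nat>\<^sup>D\<close> for
  different \<open>D\<close> are disjoint. (Total functions that are undefined outside \<open>C\<close> would not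
  do: \<open>undefined\<close> is a natural number, so such a function does not determine its domain.)
  Then \<open>Dom(\<alpha>)\<close> is \<open>dom \<alpha>\<close> and the restriction of \<open>\<alpha>\<close> to \<open>D\<close> is \<open>\<alpha> |` D\<close>.
\<close>

definition nat_pow :: "'v set \<Rightarrow> ('v \<rightharpoonup> nat) set" where
  "nat_pow C = {\<alpha>. dom \<alpha> = C}"

definition all_indices :: "('v \<times> 'v) set \<Rightarrow> 'v set \<Rightarrow> ('v \<rightharpoonup> nat) set" where
  "all_indices E C = (\<Union>D\<in>closed_subsets E C. nat_pow D)"

definition borel_space :: "'x measure \<Rightarrow> bool" where
  "borel_space S \<longleftrightarrow>
     (\<exists>B\<in>sets (borel :: real measure). B \<subseteq> {0..1} \<and>
       (\<exists>f\<in>S \<rightarrow>\<^sub>M restrict_space borel B. \<exists>g\<in>restrict_space borel B \<rightarrow>\<^sub>M S.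
          (\<forall>x\<in>space S. g (f x) = x) \<and> (\<forall>y\<in>B. f (g y) = y)))"

definition random_array_collection ::
    "'w measure \<Rightarrow> 'x measure \<Rightarrow> 'v set list \<Rightarrow> ('v set \<Rightarrow> ('v \<rightharpoonup> nat) \<Rightarrow> 'w \<Rightarrow> 'x) \<Rightarrow> bool" where
  "random_array_collection M S Cs X \<longleftrightarrow>
     prob_space M \<and> (\<forall>C\<in>set Cs. \<forall>\<alpha>\<in>nat_pow C. X C \<alpha> \<in> M \<rightarrow>\<^sub>M S)"

text \<open>
  The joint distribution of the whole collection, as a measure on the product of copies
  of \<open>S\<close> indexed by all pairs \<open>(C, \<alpha>)\<close> with \<open>C\<close> in the sequence and \<open>\<alpha> \<in> \<nat>\<^sup>C\<close>.
\<close>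

definition joint_law ::
    "'w measure \<Rightarrow> 'x measure \<Rightarrow> 'v set list \<Rightarrow> ('v set \<Rightarrow> ('v \<rightharpoonup> nat) \<Rightarrow> 'w \<Rightarrow> 'x)
      \<Rightarrow> ('v set \<times> ('v \<rightharpoonup> nat) \<Rightarrow> 'x) measure" where
  "joint_law M S Cs X =
     distr M (PiM (SIGMA C:set Cs. nat_pow C) (\<lambda>_. S))
       (\<lambda>\<omega>. \<lambda>(C, \<alpha>)\<in>(SIGMA C:set Cs. nat_pow C). X C \<alpha> \<omega>)"

definition dag_automorphism ::
    "'v set \<Rightarrow> ('v \<times> 'v) set \<Rightarrow> (('v \<rightharpoonup> nat) \<Rightarrow> ('v \<rightharpoonup> nat)) \<Rightarrow> bool" where
  "dag_automorphism G E \<tau> \<longleftrightarrow>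
     bij_betw \<tau> (nat_pow G) (nat_pow G) \<and>
     (\<forall>C\<in>closed_subsets E G. \<forall>\<alpha>\<in>nat_pow G. \<forall>\<beta>\<in>nat_pow G.
        \<alpha> |` C = \<beta> |` C \<longleftrightarrow> \<tau> \<alpha> |` C = \<tau> \<beta> |` C)"

text \<open>
  The action of \<open>\<tau>\<close> on \<open>\<beta> \<in> \<nat>\<^sup>C\<close>, via an arbitrary extension of \<open>\<beta>\<close> to \<open>G\<close>.
\<close>

definition induced ::
    "'v set \<Rightarrow> (('v \<rightharpoonup> nat) \<Rightarrow> ('v \<rightharpoonup> nat)) \<Rightarrow> ('v \<rightharpoonup> nat) \<Rightarrow> ('v \<rightharpoonup> nat)" where
  "induced G \<tau> \<beta> = \<tau> (SOME \<alpha>. \<alpha> \<in> nat_pow G \<and> \<alpha> |` dom \<beta> = \<beta>) |` dom \<beta>"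

lemma induced_restrict:
  assumes "dag_automorphism G E \<tau>" "C \<in> closed_subsets E G" "\<alpha> \<in> nat_pow G"
  shows "induced G \<tau> (\<alpha> |` C) = \<tau> \<alpha> |` C"
proof -
  have d: "dom (\<alpha> |` C) = C"
    using assms(2,3) by (auto simp: closed_subsets_def nat_pow_def)
  define \<gamma> where "\<gamma> = (SOME \<gamma>. \<gamma> \<in> nat_pow G \<and> \<gamma> |` C = \<alpha> |` C)"
  have "\<gamma> \<in> nat_pow G \<and> \<gamma> |` C = \<alpha> |` C"
    unfolding \<gamma>_def by (rule someI[of _ \<alpha>]) (use assms(3) in simp)
  then have "\<tau> \<gamma> |` C = \<tau> \<alpha> |` C"
    using assms unfolding dag_automorphism_def by blast
  then show ?thesis
    unfolding induced_def d \<gamma>_def .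
qed

definition dag_exchangeable ::
    "'v set \<Rightarrow> ('v \<times> 'v) set \<Rightarrow> 'w measure \<Rightarrow> 'x measure \<Rightarrow> 'v set list
      \<Rightarrow> ('v set \<Rightarrow> ('v \<rightharpoonup> nat) \<Rightarrow> 'w \<Rightarrow> 'x) \<Rightarrow> bool" where
  "dag_exchangeable G E M S Cs X \<longleftrightarrow>
     (\<forall>\<tau>. dag_automorphism G E \<tau> \<longrightarrow>
        joint_law M S Cs X = joint_law M S Cs (\<lambda>C \<alpha>. X C (induced G \<tau> \<alpha>)))"

abbreviation unit_interval :: "real measure" where
  "unit_interval \<equiv> restrict_space borel {0..1}"

text \<open>
  Independent random variables, each with values in \<open>[0,1]\<close> and uniformly distributed;
  measurability is part of \<open>indep_vars\<close>.
\<close>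

definition iid_uniform :: "'w measure \<Rightarrow> 'i set \<Rightarrow> ('i \<Rightarrow> 'w \<Rightarrow> real) \<Rightarrow> bool" where
  "iid_uniform N I U \<longleftrightarrow>
     prob_space N \<and> prob_space.indep_vars N (\<lambda>_. unit_interval) U I \<and>
     (\<forall>i\<in>I. distr N lborel (U i) = uniform_measure lborel {0..1})"

text \<open>
  The array \<open>f\<^sub>C(U\<^sub>\<beta> : \<beta> \<in> Restr(\<alpha>))\<close>: the members of \<open>Restr(\<alpha>)\<close> are the
  restrictions \<open>\<alpha> |` D\<close> for \<open>D \<in> \<A>\<^sub>C\<close>, and \<open>Dom(\<alpha> |` D) = D\<close>, so coordinate \<open>D\<close>
  receives \<open>U (\<alpha> |` D)\<close>.
\<close>

definition functional_array ::
    "('v \<times> 'v) set \<Rightarrow> ('v set \<Rightarrow> ('v set \<Rightarrow> real) \<Rightarrow> 'x) \<Rightarrow> (('v \<rightharpoonup> nat) \<Rightarrow> 'w \<Rightarrow> real)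
      \<Rightarrow> 'v set \<Rightarrow> ('v \<rightharpoonup> nat) \<Rightarrow> 'w \<Rightarrow> 'x" where
  "functional_array E f U C \<alpha> \<omega> = f C (\<lambda>D\<in>closed_subsets E C. U (\<alpha> |` D) \<omega>)"

end

theory Submission imports Defs begin

text \<open>
  The theorem is an Aldous-Hoover representation, and the proof follows the same two ideas: extra
  indices supply the information on which to condition, and a uniform variable codes a conditional
  law.

  \<^emph>\<open>Extra indices.\<close> Exchangeability extends from automorphisms to injective relabelings of the
  indices, because a cylinder event sees only finitely many coordinates and a finite injection of
  natural numbers extends to a permutation (\<open>law_act\<close>). In particular doubling all coordinates does
  not change the law of the array, so it suffices to represent the entries at doubled indices. The
  entries that have odd coordinates are then spare copies. Every index \<open>\<alpha>\<close> has a largest closed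
  set \<open>evens \<alpha>\<close> of vertices on which it and all its predecessors are even; the values there, halved,
  form an index \<open>half \<alpha>\<close>. The entries are thus grouped into one countable family per
  \<open>\<delta> \<in> I\<^sub>G\<close>, called the layer of \<open>\<delta>\<close>: those with \<open>half \<alpha> = \<delta>\<close>.

  \<^emph>\<open>Conditional independence.\<close> Given the layers of the proper restrictions of \<open>\<delta>\<close>, the layer of
  \<open>\<delta>\<close> is independent of all entries that do not extend \<open>2\<delta>\<close>. For a finite set \<open>F\<close> of
  entries in the layer there is an injective relabeling that fixes \<open>F\<close> and moves every entry not
  extending \<open>2\<delta>\<close> into the layers of proper restrictions: where the values so
  far agree with \<open>2\<delta>\<close>, it sends every value that differs from the one prescribed by \<open>2\<delta>\<close> to an
  odd number (\<open>exists_push_below\<close>). So the large family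
  \<open>Z\<close> and a function \<open>Z'\<close> of the small family \<open>V\<close> have the same joint law with an event about \<open>F\<close>.
  The conditional probabilities of this event given \<open>Z\<close> and given \<open>Z'\<close> have the same second
  moment, and the latter is the projection of the former, so they are equal almost surely
  (\<open>conditional_independence_of_law_eq\<close>).

  \<^emph>\<open>Coding.\<close> A layer takes values in a countable power of a Borel space, which embeds measurably into
  \<open>[0,1]\<close> with a measurable left inverse. A conditional quantile function therefore produces its
  conditional law from one uniform variable (\<open>coding\<close>). By exchangeability the function that does
  this depends on the domain of \<open>\<delta>\<close> only (\<open>conditional_law_of_layer\<close>).

  \<^emph>\<open>Assembly.\<close> Feeding an independent uniform variable \<open>U\<^sub>\<delta>\<close> into each of these functions, by
  recursion on the domain, yields an array whose layer at \<open>\<delta>\<close> is a function of the \<open>U\<^sub>\<beta>\<close> for the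
  restrictions \<open>\<beta>\<close> of \<open>\<delta>\<close>. Adding the indices of a finite restriction-closed set one at a time, in
  order of the size of their domains, shows that it has the law of the given array (\<open>law_extend\<close>,
  \<open>law_over\<close>).
\<close>

section \<open>Conditional independence from an equality of laws\<close>

text \<open>
  Otherwise the set where \<open>g < f\<close> would give a larger integral to \<open>f\<close> than to \<open>g\<close>; finiteness of
  the integral of \<open>g\<close> is what allows the subtraction.
\<close>

lemma AE_le_of_set_nn_integral_le:
  assumes [measurable]: "f \<in> borel_measurable M" "g \<in> borel_measurable M"
    and le: "\<And>B. B \<in> sets M \<Longrightarrow> (\<integral>\<^sup>+x\<in>B. f x \<partial>M) \<le> (\<integral>\<^sup>+x\<in>B. g x \<partial>M)"
    and fin: "(\<integral>\<^sup>+x. g x \<partial>M) < \<infinity>"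
  shows "AE x in M. f x \<le> g x"
proof -
  define B where "B = {x\<in>space M. g x < f x}"
  have B[measurable]: "B \<in> sets M" unfolding B_def by measurable
  have "(\<integral>\<^sup>+x\<in>B. g x \<partial>M) \<le> (\<integral>\<^sup>+x. g x \<partial>M)"
    by (intro nn_integral_mono) (auto simp: indicator_def)
  then have gfin: "(\<integral>\<^sup>+x\<in>B. g x \<partial>M) \<noteq> \<infinity>" using fin by auto
  have "(\<integral>\<^sup>+x. (f x - g x) * indicator B x \<partial>M) = (\<integral>\<^sup>+x. f x * indicator B x - g x * indicator B x \<partial>M)"
    by (intro nn_integral_cong) (auto simp: indicator_def)
  also have "\<dots> = (\<integral>\<^sup>+x\<in>B. f x \<partial>M) - (\<integral>\<^sup>+x\<in>B. g x \<partial>M)"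
    using gfin by (subst nn_integral_diff) (auto simp: indicator_def B_def less_imp_le)
  also have "\<dots> = 0"
    using le[OF B] gfin le_less_trans[OF le[OF B]] by (auto simp: diff_eq_0_iff_ennreal less_top)
  finally have "AE x in M. (f x - g x) * indicator B x = 0"
    by (subst (asm) nn_integral_0_iff_AE) auto
  then show ?thesis
    by (rule AE_mp) (auto intro!: AE_I2 simp: B_def indicator_def diff_eq_0_iff_ennreal not_less split: if_splits)
qed

text \<open>
  A version of the conditional probability of \<open>A\<close> given \<open>Z\<close>, as a function of the value of \<open>Z\<close>: the
  Radon-Nikodym density of \<open>B \<mapsto> P(A, Z \<in> B)\<close> with respect to the law of \<open>Z\<close>. It is truncated so that
  the bounds hold everywhere and square integrability is immediate.
\<close>

lemma exists_density_of_event: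
  assumes "prob_space M" and A: "A \<in> sets M" and Z[measurable]: "Z \<in> M \<rightarrow>\<^sub>M Q"
  shows "\<exists>k\<in>borel_measurable Q. (\<forall>z. 0 \<le> k z \<and> k z \<le> (1::real)) \<and>
     (\<forall>B\<in>sets Q. emeasure M (A \<inter> Z -` B \<inter> space M) = (\<integral>\<^sup>+z\<in>B. ennreal (k z) \<partial>distr M Q Z))"
proof -
  interpret prob_space M by fact
  note A[measurable]
  define \<mu> where "\<mu> = distr M Q Z"
  define \<nu> where "\<nu> = distr (density M (indicator A)) Q Z"
  interpret \<mu>: prob_space \<mu> unfolding \<mu>_def by (rule prob_space_distr) fact
  have sets[simp, measurable_cong]: "sets \<nu> = sets Q" "sets \<mu> = sets Q" "space \<mu> = space Q" by (auto simp: \<mu>_def \<nu>_def)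
  have \<nu>: "emeasure \<nu> B = emeasure M (A \<inter> Z -` B \<inter> space M)" if [measurable]: "B \<in> sets Q" for B
  proof -
    have "emeasure \<nu> B = emeasure (density M (indicator A)) (Z -` B \<inter> space M)"
      unfolding \<nu>_def by (subst emeasure_distr) auto
    also have "\<dots> = (\<integral>\<^sup>+x. indicator A x * indicator (Z -` B \<inter> space M) x \<partial>M)"
      by (subst emeasure_density) auto
    also have "\<dots> = (\<integral>\<^sup>+x. indicator (A \<inter> Z -` B \<inter> space M) x \<partial>M)"
      by (intro nn_integral_cong) (auto simp: indicator_def)
    also have "\<dots> = emeasure M (A \<inter> Z -` B \<inter> space M)"
      by (rule nn_integral_indicator) (simp add: Int_assoc)
    finally show ?thesis .
  qed
  have \<mu>: "emeasure \<mu> B = emeasure M (Z -` B \<inter> space M)" if "B \<in> sets Q" for B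
    unfolding \<mu>_def using that by (subst emeasure_distr) auto
  have le: "emeasure \<nu> B \<le> emeasure \<mu> B" if "B \<in> sets Q" for B
    unfolding \<nu>[OF that] \<mu>[OF that] using measurable_sets[OF Z that] by (intro emeasure_mono) auto
  have "absolutely_continuous \<mu> \<nu>"
    unfolding absolutely_continuous_def
  proof
    fix N assume N: "N \<in> null_sets \<mu>"
    then have "N \<in> sets Q" by auto
    with le[of N] N show "N \<in> null_sets \<nu>" by (auto simp: null_sets_def)
  qed
  from \<mu>.Radon_Nikodym[OF this] obtain f where f[measurable]: "f \<in> borel_measurable \<mu>" and fd: "density \<mu> f = \<nu>" by auto
  have fB: "(\<integral>\<^sup>+z\<in>B. f z \<partial>\<mu>) = emeasure \<nu> B" if "B \<in> sets Q" for B
    using that unfolding fd[symmetric] by (subst emeasure_density) auto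
  have AE1: "AE z in \<mu>. f z \<le> 1"
    using le by (intro AE_le_of_set_nn_integral_le) (auto simp: fB \<mu>.emeasure_space_1[simplified])
  define k where "k z = enn2real (min 1 (f z))" for z
  have ek: "ennreal (k z) = min 1 (f z)" for z
    unfolding k_def by (subst ennreal_enn2real) (auto simp: min_less_iff_disj)
  show ?thesis
  proof (intro bexI[of _ k] conjI allI ballI)
    show "k \<in> borel_measurable Q" unfolding k_def using f by measurable
    show "0 \<le> k z" for z unfolding k_def by simp
    show "k z \<le> 1" for z
      using ek[of z] by (metis ennreal_le_1 min.cobounded1)
    fix B assume B: "B \<in> sets Q"
    have "(\<integral>\<^sup>+z\<in>B. ennreal (k z) \<partial>\<mu>) = (\<integral>\<^sup>+z\<in>B. f z \<partial>\<mu>)"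
      unfolding ek by (rule nn_integral_cong_AE, rule AE_mp[OF AE1]) (auto intro!: AE_I2 simp: min_def)
    then show "emeasure M (A \<inter> Z -` B \<inter> space M) = (\<integral>\<^sup>+z\<in>B. ennreal (k z) \<partial>distr M Q Z)"
      using fB[OF B] \<nu>[OF B] unfolding \<mu>_def by simp
  qed
qed

text \<open>
  Let \<open>V = r(Z)\<close> and \<open>Z' = s(V)\<close>, and suppose that \<open>(A, Z)\<close> and \<open>(A, Z')\<close> have the same law. Then one
  function \<open>k\<close> serves as conditional probability for both, so \<open>a = k(Z)\<close> and \<open>c = k(Z')\<close> have the same
  second moment. As \<open>c\<close> is a function of \<open>Z\<close>, \<open>E[a c] = E[1\<^sub>A c] = E[c\<^sup>2]\<close>, hence
  \<open>E[(a - c)\<^sup>2] = 0\<close>. So the conditional probability of \<open>A\<close> given \<open>Z\<close> is a function of \<open>V\<close>, which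
  means that \<open>A\<close> and \<open>Z\<close> are conditionally independent given \<open>V\<close>.
\<close>

lemma conditional_independence_of_law_eq:
  assumes "prob_space M" and A[measurable]: "A \<in> sets M"
    and Z[measurable]: "Z \<in> M \<rightarrow>\<^sub>M Q"
    and r[measurable]: "r \<in> Q \<rightarrow>\<^sub>M P" and s[measurable]: "s \<in> P \<rightarrow>\<^sub>M Q"
    and lawA: "\<And>B. B \<in> sets Q \<Longrightarrow> emeasure M (A \<inter> Z -` B \<inter> space M) = emeasure M (A \<inter> (\<lambda>\<omega>. s (r (Z \<omega>))) -` B \<inter> space M)"
    and law: "distr M Q Z = distr M Q (\<lambda>\<omega>. s (r (Z \<omega>)))"
  shows "\<exists>k\<in>borel_measurable P. \<forall>B\<in>sets Q.
     emeasure M (A \<inter> Z -` B \<inter> space M) = (\<integral>\<^sup>+\<omega>\<in>Z -` B. ennreal (k (r (Z \<omega>))) \<partial>M)"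
proof -
  interpret prob_space M by fact
  from exists_density_of_event[OF assms(1) A Z] obtain k where k[measurable]: "k \<in> borel_measurable Q"
    and k0: "\<And>z. 0 \<le> k z" and k1: "\<And>z. k z \<le> 1"
    and kB: "\<And>B. B \<in> sets Q \<Longrightarrow> emeasure M (A \<inter> Z -` B \<inter> space M) = (\<integral>\<^sup>+z\<in>B. ennreal (k z) \<partial>distr M Q Z)" by blast
  define Z' where "Z' \<omega> = s (r (Z \<omega>))" for \<omega>
  have Z'[measurable]: "Z' \<in> M \<rightarrow>\<^sub>M Q" unfolding Z'_def by measurable
  \<comment> \<open>For every \<open>Y\<close> such that \<open>(A, Y)\<close> has the law of \<open>(A, Z)\<close>, \<open>k (Y \<omega>)\<close> is a conditional
    probability of \<open>A\<close> given \<open>Y\<close>. This is used for \<open>Y = Z\<close> and \<open>Y = Z'\<close>.\<close>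
  have proj: "(\<integral>\<omega>. indicator A \<omega> * h (Y \<omega>) \<partial>M) = (\<integral>\<omega>. k (Y \<omega>) * h (Y \<omega>) \<partial>M)"
    if Y[measurable]: "Y \<in> M \<rightarrow>\<^sub>M Q" and Yd: "distr M Q Y = distr M Q Z"
      and Ye: "\<And>B. B \<in> sets Q \<Longrightarrow> emeasure M (A \<inter> Y -` B \<inter> space M) = emeasure M (A \<inter> Z -` B \<inter> space M)"
      and h[measurable]: "h \<in> borel_measurable Q" and h0: "\<And>z. 0 \<le> h z"  for Y and h :: "_ \<Rightarrow> real"
  proof -
    have "distr (density M (indicator A)) Q Y = density (distr M Q Z) k"
    proof (rule measure_eqI)
      fix B assume "B \<in> sets (distr (density M (indicator A)) Q Y)"
      then have B[measurable]: "B \<in> sets Q" by simp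
      have "emeasure (distr (density M (indicator A)) Q Y) B = emeasure (density M (indicator A)) (Y -` B \<inter> space M)"
        by (subst emeasure_distr) auto
      also have "\<dots> = (\<integral>\<^sup>+x. indicator A x * indicator (Y -` B \<inter> space M) x \<partial>M)"
        by (subst emeasure_density) auto
      also have "\<dots> = (\<integral>\<^sup>+x. indicator (A \<inter> Y -` B \<inter> space M) x \<partial>M)"
        by (intro nn_integral_cong) (auto simp: indicator_def)
      also have "\<dots> = emeasure M (A \<inter> Y -` B \<inter> space M)"
        by (rule nn_integral_indicator) (simp add: Int_assoc)
      also have "\<dots> = emeasure (density (distr M Q Z) k) B"
        unfolding Ye[OF B] kB[OF B] by (subst emeasure_density) auto
      finally show "emeasure (distr (density M (indicator A)) Q Y) B = emeasure (density (distr M Q Z) k) B" .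
    qed simp
    then have "(\<integral>\<^sup>+z. h z \<partial>distr (density M (indicator A)) Q Y) = (\<integral>\<^sup>+z. h z \<partial>density (distr M Q Z) k)" by simp
    also have "(\<integral>\<^sup>+z. h z \<partial>density (distr M Q Z) k) = (\<integral>\<^sup>+z. ennreal (k z * h z) \<partial>distr M Q Y)"
      unfolding Yd by (subst nn_integral_density) (auto simp: ennreal_mult' k0)
    also have "\<dots> = (\<integral>\<^sup>+\<omega>. ennreal (k (Y \<omega>) * h (Y \<omega>)) \<partial>M)" by (subst nn_integral_distr) auto
    also have "(\<integral>\<^sup>+z. h z \<partial>distr (density M (indicator A)) Q Y) = (\<integral>\<^sup>+\<omega>. ennreal (indicator A \<omega> * h (Y \<omega>)) \<partial>M)"
      by (subst nn_integral_distr, simp, simp, subst nn_integral_density)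
         (auto intro!: nn_integral_cong simp: indicator_def)
    finally show ?thesis
      by (simp add: integral_eq_nn_integral k0 h0)
  qed
  have Z'eq: "distr M Q Z' = distr M Q Z" using law unfolding Z'_def by simp
  have int[simp]: "integrable M (\<lambda>\<omega>. f \<omega> * g \<omega>)"
    if "f \<in> {\<lambda>\<omega>. k (Z \<omega>), \<lambda>\<omega>. k (Z' \<omega>)}" "g \<in> {\<lambda>\<omega>. k (Z \<omega>), \<lambda>\<omega>. k (Z' \<omega>)}" for f g
    using that by (intro integrable_const_bound[where B=1]) (auto intro!: AE_I2 mult_le_one simp: k0 k1)
  have e1: "(\<integral>\<omega>. indicator A \<omega> * k (Z' \<omega>) \<partial>M) = (\<integral>\<omega>. k (Z' \<omega>) * k (Z' \<omega>) \<partial>M)"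
    by (rule proj[OF Z' Z'eq _ k k0]) (use lawA[folded Z'_def] in simp_all)
  have e2: "(\<integral>\<omega>. indicator A \<omega> * k (Z' \<omega>) \<partial>M) = (\<integral>\<omega>. k (Z \<omega>) * k (Z' \<omega>) \<partial>M)"
    using proj[OF Z refl refl, of "\<lambda>z. k (s (r z))"] by (simp add: k0 Z'_def)
  have e3: "(\<integral>\<omega>. k (Z \<omega>) * k (Z \<omega>) \<partial>M) = (\<integral>\<omega>. k (Z' \<omega>) * k (Z' \<omega>) \<partial>M)"
  proof -
    have "(\<integral>\<omega>. k (Z \<omega>) * k (Z \<omega>) \<partial>M) = (\<integral>z. k z * k z \<partial>distr M Q Z)" by (subst integral_distr) auto
    also have "\<dots> = (\<integral>\<omega>. k (Z' \<omega>) * k (Z' \<omega>) \<partial>M)" unfolding Z'eq[symmetric] by (subst integral_distr) auto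
    finally show ?thesis .
  qed
  have i2: "integrable M (\<lambda>\<omega>. (k (Z \<omega>) - k (Z' \<omega>))^2)"
    by (simp add: power2_eq_square algebra_simps)
  have "(\<integral>\<omega>. (k (Z \<omega>) - k (Z' \<omega>))^2 \<partial>M) = 
    (\<integral>\<omega>. k (Z \<omega>) * k (Z \<omega>) - 2 * (k (Z \<omega>) * k (Z' \<omega>)) + k (Z' \<omega>) * k (Z' \<omega>) \<partial>M)"
    by (intro Bochner_Integration.integral_cong) (auto simp: power2_eq_square algebra_simps)
  also have "\<dots> = (\<integral>\<omega>. k (Z \<omega>) * k (Z \<omega>) \<partial>M) - 2 * (\<integral>\<omega>. k (Z \<omega>) * k (Z' \<omega>) \<partial>M) + (\<integral>\<omega>. k (Z' \<omega>) * k (Z' \<omega>) \<partial>M)"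
    by simp
  also have "\<dots> = 0" using e1 e2 e3 by simp
  finally have "(\<integral>\<omega>. (k (Z \<omega>) - k (Z' \<omega>))^2 \<partial>M) = 0" .
  then have ae: "AE \<omega> in M. k (Z \<omega>) = k (Z' \<omega>)"
    by (subst (asm) integral_nonneg_eq_0_iff_AE[OF i2]) auto
  show ?thesis
  proof (intro bexI[of _ "\<lambda>p. k (s p)"] ballI)
    fix B assume B[measurable]: "B \<in> sets Q"
    have "(\<integral>\<^sup>+z\<in>B. ennreal (k z) \<partial>distr M Q Z) = (\<integral>\<^sup>+\<omega>. ennreal (k (Z \<omega>)) * indicator B (Z \<omega>) \<partial>M)"
      by (subst nn_integral_distr) auto
    also have "\<dots> = (\<integral>\<^sup>+\<omega>\<in>Z -` B. ennreal (k (s (r (Z \<omega>)))) \<partial>M)"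
      by (rule nn_integral_cong_AE, rule AE_mp[OF ae]) (auto intro!: AE_I2 simp: Z'_def indicator_def)
    finally show "emeasure M (A \<inter> Z -` B \<inter> space M) = (\<integral>\<^sup>+\<omega>\<in>Z -` B. ennreal (k (s (r (Z \<omega>)))) \<partial>M)"
      unfolding kB[OF B] .
  qed measurable
qed

section \<open>Conditional laws as functions of a uniform variable\<close>

definition uniform01 :: "real measure" where
  "uniform01 = restrict_space lborel {0..1}"

lemma sets_uniform01[measurable_cong]: "sets uniform01 = sets (restrict_space borel {0..1})"
  unfolding uniform01_def by (intro sets_restrict_space_cong) simp

lemma space_uniform01[simp]: "space uniform01 = {0..1}"
  by (simp add: uniform01_def space_restrict_space)

lemma prob_space_uniform01: "prob_space uniform01"
  by (rule prob_spaceI) (simp add: uniform01_def emeasure_restrict_space space_restrict_space)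

lemma emeasure_uniform01_less:
  assumes "0 \<le> c" "c \<le> 1"
  shows "emeasure uniform01 {u\<in>{0..1}. u < c} = ennreal c"
proof -
  have eq: "{u\<in>{0..1}. u < c} = {0..<c}" using assms by auto
  have "emeasure uniform01 {0..<c} = emeasure lborel {0..<c}"
    unfolding uniform01_def by (rule emeasure_restrict_space) (use assms in auto)
  then show ?thesis unfolding eq using assms by simp
qed

lemma distr_uniform01: "distr uniform01 lborel (\<lambda>u. u) = uniform_measure lborel {0..1}"
proof (rule measure_eqI)
  fix A assume "A \<in> sets (distr uniform01 lborel (\<lambda>u. u))"
  then have A: "A \<in> sets lborel" by simp
  have m: "(\<lambda>u. u) \<in> uniform01 \<rightarrow>\<^sub>M lborel"
    unfolding uniform01_def by (intro measurable_restrict_space1) simp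
  have "emeasure (distr uniform01 lborel (\<lambda>u. u)) A = emeasure uniform01 (A \<inter> {0..1})"
    by (subst emeasure_distr[OF m A]) simp
  also have "\<dots> = emeasure lborel (A \<inter> {0..1})"
    unfolding uniform01_def using A by (subst emeasure_restrict_space) auto
  finally show "emeasure (distr uniform01 lborel (\<lambda>u. u)) A = emeasure (uniform_measure lborel {0..1}) A"
    using A by (simp add: Int_commute divide_ennreal_def)
qed simp

text \<open>
  The function \<open>g(v, u)\<close> is a conditional quantile function. With \<open>F q v = P(W > q | V = v)\<close>, it is
  the supremum of the rational \<open>q\<close> with \<open>u < F q v\<close>. Taking only rational \<open>q\<close> makes \<open>g\<close> measurable,
  and it reduces \<open>g(v, u) > r\<close> to a countable union of the events \<open>u < F q v\<close> with \<open>q > r\<close>, which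
  have total probability \<open>F r v\<close> for almost every \<open>v\<close>.
\<close>

lemma quantile_coding:
  fixes W :: "'w \<Rightarrow> real"
  assumes "prob_space M" and V[measurable]: "V \<in> M \<rightarrow>\<^sub>M P" and W[measurable]: "W \<in> borel_measurable M"
    and W01: "\<And>\<omega>. \<omega> \<in> space M \<Longrightarrow> 0 \<le> W \<omega> \<and> W \<omega> \<le> 1"
  shows "\<exists>g\<in>P \<Otimes>\<^sub>M uniform01 \<rightarrow>\<^sub>M borel. \<forall>B\<in>sets P. \<forall>A\<in>sets borel.
    emeasure M (V -` B \<inter> W -` A \<inter> space M) =
    (\<integral>\<^sup>+v\<in>B. emeasure uniform01 {u\<in>{0..1}. g (v, u) \<in> A} \<partial>distr M P V)"
proof -
  interpret prob_space M by fact
  interpret U: prob_space uniform01 by (rule prob_space_uniform01)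
  define \<mu> where "\<mu> = distr M P V"
  interpret \<mu>: prob_space \<mu> unfolding \<mu>_def by (rule prob_space_distr) fact
  have s\<mu>[simp, measurable_cong]: "sets \<mu> = sets P" and sp\<mu>[simp]: "space \<mu> = space P" by (auto simp: \<mu>_def)
  let ?F = "\<lambda>r k. k \<in> borel_measurable P \<and> (\<forall>z. 0 \<le> k z \<and> k z \<le> (1::real)) \<and>
     (\<forall>B\<in>sets P. emeasure M ({\<omega>\<in>space M. r < W \<omega>} \<inter> V -` B \<inter> space M) = (\<integral>\<^sup>+z\<in>B. ennreal (k z) \<partial>\<mu>))"
  have "\<exists>k. ?F r k" for r
  proof -
    have "{\<omega>\<in>space M. r < W \<omega>} \<in> sets M" by measurable
    from exists_density_of_event[OF assms(1) this V] show ?thesis unfolding \<mu>_def by blast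
  qed
  then have "?F r (SOME k. ?F r k)" for r by (rule someI_ex)
  moreover define F where "F r = (SOME k. ?F r k)" for r
  ultimately have F: "?F r (F r)" for r unfolding F_def by blast
  then have F[measurable]: "\<And>r. F r \<in> borel_measurable P"
    and F01: "\<And>r z. 0 \<le> F r z" "\<And>r z. F r z \<le> (1::real)"
    and FB: "\<And>r B. B \<in> sets P \<Longrightarrow> emeasure M ({\<omega>\<in>space M. r < W \<omega>} \<inter> V -` B \<inter> space M) = (\<integral>\<^sup>+z\<in>B. ennreal (F r z) \<partial>\<mu>)"
    by blast+
  define Q where "Q = {q::real. q \<in> \<rat> \<and> 0 \<le> q \<and> q \<le> 1}"
  have cQ: "countable Q" unfolding Q_def by (rule countable_subset[OF _ countable_rat]) auto
  \<comment> \<open>The element 0 and the restriction to \<open>[0,1]\<close> make the set nonempty and bounded for every \<open>v\<close>, also where \<open>F\<close> is not monotone in \<open>q\<close>.\<close>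
  define g where "g p = Sup (insert 0 {q\<in>Q. snd p < F q (fst p)})" for p
  have g_gr: "r < g p \<longleftrightarrow> r < 0 \<or> (\<exists>q\<in>Q. r < q \<and> snd p < F q (fst p))" for r p
  proof -
    have "bdd_above (insert 0 {q\<in>Q. snd p < F q (fst p)})"
      by (rule bdd_aboveI[of _ 1]) (auto simp: Q_def)
    then show ?thesis unfolding g_def by (subst less_cSup_iff) auto
  qed
  have g[measurable]: "g \<in> P \<Otimes>\<^sub>M uniform01 \<rightarrow>\<^sub>M borel"
  proof (subst borel_measurable_iff_greater, safe)
    fix r :: real
    have [measurable]: "snd \<in> P \<Otimes>\<^sub>M uniform01 \<rightarrow>\<^sub>M borel"
      unfolding uniform01_def by (rule measurable_compose[OF measurable_snd]) (intro measurable_restrict_space1, simp)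
    have "{p \<in> space (P \<Otimes>\<^sub>M uniform01). r < g p} =
      (if r < 0 then space (P \<Otimes>\<^sub>M uniform01) else (\<Union>q\<in>{q\<in>Q. r < q}. {p \<in> space (P \<Otimes>\<^sub>M uniform01). snd p < F q (fst p)}))"
      unfolding g_gr by auto
    also have "\<dots> \<in> sets (P \<Otimes>\<^sub>M uniform01)"
      using countable_subset[OF _ cQ] by (auto intro!: sets.countable_UN')
    finally show "{p \<in> space (P \<Otimes>\<^sub>M uniform01). r < g p} \<in> sets (P \<Otimes>\<^sub>M uniform01)" .
  qed
  show ?thesis
  proof (intro bexI[OF _ g] ballI)
    fix B and A :: "real set" assume B[measurable]: "B \<in> sets P" and A: "A \<in> sets borel"
    define M1 where "M1 = distr (density M (indicator (V -` B \<inter> space M))) borel W"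
    define M2 where "M2 = distr (density (\<mu> \<Otimes>\<^sub>M uniform01) (\<lambda>p. indicator B (fst p))) borel g"
    have M1: "emeasure M1 A = emeasure M (V -` B \<inter> W -` A \<inter> space M)" if [measurable]: "A \<in> sets borel" for A
    proof -
      have "emeasure M1 A = emeasure (density M (indicator (V -` B \<inter> space M))) (W -` A \<inter> space M)"
        unfolding M1_def by (subst emeasure_distr) auto
      also have "\<dots> = (\<integral>\<^sup>+x. indicator (V -` B \<inter> space M) x * indicator (W -` A \<inter> space M) x \<partial>M)"
        by (subst emeasure_density) auto
      also have "\<dots> = (\<integral>\<^sup>+x. indicator ((V -` B \<inter> space M) \<inter> (W -` A \<inter> space M)) x \<partial>M)"
        by (intro nn_integral_cong) (auto simp: indicator_def)
      also have "\<dots> = emeasure M ((V -` B \<inter> space M) \<inter> (W -` A \<inter> space M))"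
        by (rule nn_integral_indicator) auto
      finally show ?thesis by (simp add: Int_ac)
    qed
    have M2: "emeasure M2 A = (\<integral>\<^sup>+v\<in>B. emeasure uniform01 {u\<in>{0..1}. g (v, u) \<in> A} \<partial>\<mu>)" if [measurable]: "A \<in> sets borel" for A
    proof -
      have [measurable]: "g -` A \<inter> space (\<mu> \<Otimes>\<^sub>M uniform01) \<in> sets (P \<Otimes>\<^sub>M uniform01)"
        using measurable_sets[OF g that] by (simp add: space_pair_measure)
      have "emeasure M2 A = emeasure (density (\<mu> \<Otimes>\<^sub>M uniform01) (\<lambda>p. indicator B (fst p))) (g -` A \<inter> space (\<mu> \<Otimes>\<^sub>M uniform01))"
        unfolding M2_def by (subst emeasure_distr) auto
      also have "\<dots> = (\<integral>\<^sup>+p. indicator B (fst p) * indicator (g -` A \<inter> space (\<mu> \<Otimes>\<^sub>M uniform01)) p \<partial>(\<mu> \<Otimes>\<^sub>M uniform01))"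
        by (subst emeasure_density) auto
      also have "\<dots> = (\<integral>\<^sup>+v. \<integral>\<^sup>+u. indicator B v * indicator (g -` A \<inter> space (\<mu> \<Otimes>\<^sub>M uniform01)) (v, u) \<partial>uniform01 \<partial>\<mu>)"
        by (subst U.nn_integral_fst[symmetric]) auto
      also have "\<dots> = (\<integral>\<^sup>+v\<in>B. emeasure uniform01 {u\<in>{0..1}. g (v, u) \<in> A} \<partial>\<mu>)"
      proof (rule nn_integral_cong)
        fix v assume v: "v \<in> space \<mu>"
        then have [measurable]: "{u\<in>{0..1}. g (v, u) \<in> A} \<in> sets uniform01"
          using measurable_sets[OF measurable_compose[OF measurable_Pair1'[of v \<mu> uniform01] g[unfolded measurable_cong_sets[OF sets_pair_measure_cong[OF s\<mu>[symmetric] refl] refl]]] that]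
          by (auto simp: vimage_def Int_def conj_commute)
        have "(\<integral>\<^sup>+u. indicator B v * indicator (g -` A \<inter> space (\<mu> \<Otimes>\<^sub>M uniform01)) (v, u) \<partial>uniform01) =
           (\<integral>\<^sup>+u. indicator B v * indicator {u\<in>{0..1}. g (v, u) \<in> A} u \<partial>uniform01)"
          using v by (intro nn_integral_cong) (auto simp: indicator_def space_pair_measure)
        also have "\<dots> = indicator B v * emeasure uniform01 {u\<in>{0..1}. g (v, u) \<in> A}"
          by (rule nn_integral_cmult_indicator) fact
        finally show "(\<integral>\<^sup>+u. indicator B v * indicator (g -` A \<inter> space (\<mu> \<Otimes>\<^sub>M uniform01)) (v, u) \<partial>uniform01) =
          emeasure uniform01 {u\<in>{0..1}. g (v, u) \<in> A} * indicator B v" by (simp add: mult.commute)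
      qed
      finally show ?thesis .
    qed
    have "M1 = M2"
    proof (rule measure_eqI_lessThan)
      show "sets M1 = sets borel" "sets M2 = sets borel" by (auto simp: M1_def M2_def)
      fix r :: real
      show "emeasure M1 {r<..} < \<infinity>" unfolding M1[of "{r<..}", simplified] by (simp add: less_top[symmetric])
      define E where "E v = {u\<in>{0..1::real}. r < g (v, u)}" for v
      have m1: "emeasure M1 {r<..} = (\<integral>\<^sup>+z\<in>B. ennreal (F r z) \<partial>\<mu>)"
        unfolding FB[OF B, symmetric] M1[of "{r<..}", simplified]
        by (intro arg_cong[where f="emeasure M"]) auto
      have m2: "emeasure M2 {r<..} = (\<integral>\<^sup>+v\<in>B. emeasure uniform01 (E v) \<partial>\<mu>)"
        unfolding M2[of "{r<..}", simplified] E_def by simp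
      show "emeasure M1 {r<..} = emeasure M2 {r<..}"
      proof (cases "r < 0")
        case True
        have "E v = space uniform01" for v using True by (auto simp: E_def g_gr)
        then have "emeasure M2 {r<..} = (\<integral>\<^sup>+v\<in>B. 1 \<partial>\<mu>)" unfolding m2 by (simp add: U.emeasure_space_1 del: space_uniform01)
        also have "\<dots> = emeasure \<mu> B" by simp
        also have "\<dots> = emeasure M (V -` B \<inter> space M)" unfolding \<mu>_def by (subst emeasure_distr) auto
        also have "V -` B \<inter> space M = V -` B \<inter> W -` {r<..} \<inter> space M" using True W01 by fastforce
        finally show ?thesis using M1[of "{r<..}"] by simp
      next
        case False
        have "AE v in \<mu>. \<forall>q\<in>{q\<in>Q. r < q}. ennreal (F q v) \<le> ennreal (F r v)"
        proof (subst AE_ball_countable, rule countable_subset[OF _ cQ], force, intro ballI)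
          fix q assume q: "q \<in> {q\<in>Q. r < q}"
          show "AE v in \<mu>. ennreal (F q v) \<le> ennreal (F r v)"
          proof (rule AE_le_of_set_nn_integral_le)
            fix C assume "C \<in> sets \<mu>"
            then have C[measurable]: "C \<in> sets P" by simp
            show "(\<integral>\<^sup>+ x\<in>C. ennreal (F q x)\<partial>\<mu>) \<le> (\<integral>\<^sup>+ x\<in>C. ennreal (F r x)\<partial>\<mu>)"
              unfolding FB[OF C, symmetric] using q by (intro emeasure_mono) auto
          next
            have "(\<integral>\<^sup>+ x. ennreal (F r x)\<partial>\<mu>) \<le> (\<integral>\<^sup>+ x. 1 \<partial>\<mu>)" using F01 by (intro nn_integral_mono) (auto simp: ennreal_le_1)
            then show "(\<integral>\<^sup>+ x. ennreal (F r x)\<partial>\<mu>) < \<infinity>" by (auto simp: \<mu>.emeasure_space_1[simplified] le_less_trans)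
          qed auto
        qed
        then have up: "AE v in \<mu>. emeasure uniform01 (E v) \<le> ennreal (F r v)"
        proof (rule AE_mp, intro AE_I2 impI)
          fix v assume v: "\<forall>q\<in>{q\<in>Q. r < q}. ennreal (F q v) \<le> ennreal (F r v)"
          have "emeasure uniform01 (E v) \<le> emeasure uniform01 {u\<in>{0..1}. u < F r v}"
          proof (rule emeasure_mono)
            show "E v \<subseteq> {u\<in>{0..1}. u < F r v}"
              using False v by (fastforce simp: E_def g_gr F01 ennreal_le_iff)
            show "{u\<in>{0..1}. u < F r v} \<in> sets uniform01"
              unfolding sets_uniform01 by (auto simp: sets_restrict_space)
          qed
          then show "emeasure uniform01 (E v) \<le> ennreal (F r v)" by (simp only: emeasure_uniform01_less F01)
        qed
        have E[measurable]: "E v \<in> sets uniform01" if "v \<in> space P" for v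
        proof -
          have "E v = (\<lambda>u. g (v, u)) -` {r<..} \<inter> space uniform01" by (auto simp: E_def)
          also have "\<dots> \<in> sets uniform01"
            by (rule measurable_sets[OF measurable_compose[OF measurable_Pair1'[OF that] g]]) simp
          finally show ?thesis .
        qed
        have low: "emeasure M ({\<omega>\<in>space M. r + 1 / Suc n < W \<omega>} \<inter> V -` B \<inter> space M) \<le> (\<integral>\<^sup>+v\<in>B. emeasure uniform01 (E v) \<partial>\<mu>)" for n
        proof (cases "r + 1 / Suc n < 1")
          case True
          from Rats_dense_in_real[of r "r + 1 / Suc n"] obtain q where q: "q \<in> \<rat>" "r < q" "q < r + 1 / Suc n" by auto
          then have qQ: "q \<in> Q" using False True by (auto simp: Q_def)
          have "emeasure M ({\<omega>\<in>space M. r + 1 / Suc n < W \<omega>} \<inter> V -` B \<inter> space M) \<le> emeasure M ({\<omega>\<in>space M. q < W \<omega>} \<inter> V -` B \<inter> space M)"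
            using q by (intro emeasure_mono) auto
          also have "\<dots> = (\<integral>\<^sup>+v\<in>B. ennreal (F q v) \<partial>\<mu>)" by (rule FB[OF B])
          also have "\<dots> \<le> (\<integral>\<^sup>+v\<in>B. emeasure uniform01 (E v) \<partial>\<mu>)"
          proof (intro nn_integral_mono mult_right_mono)
            fix v assume "v \<in> space \<mu>"
            have "ennreal (F q v) = emeasure uniform01 {u\<in>{0..1}. u < F q v}" by (simp only: emeasure_uniform01_less F01)
            also have "\<dots> \<le> emeasure uniform01 (E v)"
              using q qQ \<open>v \<in> space \<mu>\<close> by (intro emeasure_mono E) (auto simp: E_def g_gr)
            finally show "ennreal (F q v) \<le> emeasure uniform01 (E v)" .
          qed simp
          finally show ?thesis .
        next
          case False
          then have "{\<omega>\<in>space M. r + 1 / Suc n < W \<omega>} = {}" using W01 by force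
          then show ?thesis by (simp only: Int_empty_left emeasure_empty zero_le)
        qed
        have "(\<integral>\<^sup>+z\<in>B. ennreal (F r z) \<partial>\<mu>) = emeasure M (\<Union>n. {\<omega>\<in>space M. r + 1 / Suc n < W \<omega>} \<inter> V -` B \<inter> space M)"
          unfolding FB[OF B, symmetric]
        proof (rule arg_cong[where f="emeasure M"], rule set_eqI)
          fix \<omega>
          have "r < W \<omega> \<longleftrightarrow> (\<exists>n. r + 1 / Suc n < W \<omega>)"
          proof
            assume "r < W \<omega>"
            then obtain n where "1 / Suc n < W \<omega> - r" using nat_approx_posE[of "W \<omega> - r"] by auto
            then have "r + 1 / Suc n < W \<omega>" by linarith
            then show "\<exists>n. r + 1 / Suc n < W \<omega>" by blast
          next
            assume "\<exists>n. r + 1 / Suc n < W \<omega>"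
            then obtain n where "r + 1 / Suc n < W \<omega>" by blast
            moreover have "0 < 1 / real (Suc n)" by simp
            ultimately show "r < W \<omega>" by linarith
          qed
          then show "\<omega> \<in> {\<omega>\<in>space M. r < W \<omega>} \<inter> V -` B \<inter> space M \<longleftrightarrow>
            \<omega> \<in> (\<Union>n. {\<omega>\<in>space M. r + 1 / Suc n < W \<omega>} \<inter> V -` B \<inter> space M)" by blast
        qed
        also have "\<dots> = (SUP n. emeasure M ({\<omega>\<in>space M. r + 1 / Suc n < W \<omega>} \<inter> V -` B \<inter> space M))"
        proof (rule SUP_emeasure_incseq[symmetric])
          show "incseq (\<lambda>n. {\<omega>\<in>space M. r + 1 / Suc n < W \<omega>} \<inter> V -` B \<inter> space M)"
          proof (rule incseq_SucI)
            fix n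
            have "1 / real (Suc (Suc n)) \<le> 1 / real (Suc n)" by (intro divide_left_mono) auto
            then have "r + 1 / real (Suc (Suc n)) < W \<omega>" if "r + 1 / real (Suc n) < W \<omega>" for \<omega>
              using that by linarith
            then show "{\<omega>\<in>space M. r + 1 / Suc n < W \<omega>} \<inter> V -` B \<inter> space M \<subseteq>
              {\<omega>\<in>space M. r + 1 / Suc (Suc n) < W \<omega>} \<inter> V -` B \<inter> space M" by blast
          qed
          have "{\<omega>\<in>space M. r + 1 / Suc n < W \<omega>} \<inter> (V -` B \<inter> space M) \<in> sets M" for n
            by (intro sets.Int measurable_sets[OF V B]) measurable
          then show "range (\<lambda>n. {\<omega>\<in>space M. r + 1 / Suc n < W \<omega>} \<inter> V -` B \<inter> space M) \<subseteq> sets M"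
            unfolding Int_assoc by blast
        qed
        also have "\<dots> \<le> (\<integral>\<^sup>+v\<in>B. emeasure uniform01 (E v) \<partial>\<mu>)" by (intro SUP_least low)
        finally have 1: "emeasure M1 {r<..} \<le> emeasure M2 {r<..}" unfolding m1 m2 .
        have 2: "emeasure M2 {r<..} \<le> emeasure M1 {r<..}"
          unfolding m1 m2 by (rule nn_integral_mono_AE, rule AE_mp[OF up], rule AE_I2) (simp add: mult_right_mono)
        from 1 2 show ?thesis by (rule antisym)
      qed
    qed
    then show "emeasure M (V -` B \<inter> W -` A \<inter> space M) =
      (\<integral>\<^sup>+v\<in>B. emeasure uniform01 {u\<in>{0..1}. g (v, u) \<in> A} \<partial>distr M P V)"
      using M1[OF A] M2[OF A] unfolding \<mu>_def by simp
  qed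
qed

text \<open>
  The part of being a standard Borel space that is needed here: a measurable embedding into \<open>[0,1]\<close>
  with a left inverse that is measurable on the whole real line, so that any coded value decodes.
\<close>

definition codable :: "'t measure \<Rightarrow> bool" where
  "codable T \<longleftrightarrow> (\<exists>\<phi>\<in>borel_measurable T. \<exists>\<psi>\<in>borel \<rightarrow>\<^sub>M T.
     \<forall>x\<in>space T. 0 \<le> \<phi> x \<and> \<phi> x \<le> (1::real) \<and> \<psi> (\<phi> x) = x)"

text \<open>
  Noise outsourcing: jointly with \<open>V\<close>, the variable \<open>W\<close> has the law of \<open>g(V, u)\<close> with \<open>u\<close> uniform and
  independent of \<open>V\<close>.
\<close>

lemma coding:
  assumes M: "prob_space M" and V[measurable]: "V \<in> M \<rightarrow>\<^sub>M P" and W[measurable]: "W \<in> M \<rightarrow>\<^sub>M T"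
    and T: "codable T"
  shows "\<exists>g\<in>P \<Otimes>\<^sub>M uniform01 \<rightarrow>\<^sub>M T. \<forall>B\<in>sets P. \<forall>A\<in>sets T.
    emeasure M (V -` B \<inter> W -` A \<inter> space M) =
    (\<integral>\<^sup>+v\<in>B. emeasure uniform01 {u\<in>{0..1}. g (v, u) \<in> A} \<partial>distr M P V)"
proof -
  from T obtain \<phi> \<psi> where [measurable]: "\<phi> \<in> borel_measurable T" and \<psi>[measurable]: "\<psi> \<in> borel \<rightarrow>\<^sub>M T"
    and \<phi>\<psi>: "\<And>x. x \<in> space T \<Longrightarrow> 0 \<le> \<phi> x \<and> \<phi> x \<le> (1::real) \<and> \<psi> (\<phi> x) = x" unfolding codable_def by blast
  have "\<exists>g\<in>P \<Otimes>\<^sub>M uniform01 \<rightarrow>\<^sub>M borel. \<forall>B\<in>sets P. \<forall>A\<in>sets borel.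
    emeasure M (V -` B \<inter> (\<lambda>\<omega>. \<phi> (W \<omega>)) -` A \<inter> space M) =
    (\<integral>\<^sup>+v\<in>B. emeasure uniform01 {u\<in>{0..1}. g (v, u) \<in> A} \<partial>distr M P V)"
    by (rule quantile_coding[OF M V]) (use \<phi>\<psi> measurable_space[OF W] in auto)
  then obtain g where g: "g \<in> P \<Otimes>\<^sub>M uniform01 \<rightarrow>\<^sub>M borel" and
    gB: "\<And>A B. B \<in> sets P \<Longrightarrow> A \<in> sets borel \<Longrightarrow> emeasure M (V -` B \<inter> (\<lambda>\<omega>. \<phi> (W \<omega>)) -` A \<inter> space M) =
    (\<integral>\<^sup>+v\<in>B. emeasure uniform01 {u\<in>{0..1}. g (v, u) \<in> A} \<partial>distr M P V)" by blast
  show ?thesis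
  proof (intro bexI[of _ "\<lambda>p. \<psi> (g p)"] ballI)
    show "(\<lambda>p. \<psi> (g p)) \<in> P \<Otimes>\<^sub>M uniform01 \<rightarrow>\<^sub>M T" using g \<psi> by (rule measurable_compose)
    fix B A assume B: "B \<in> sets P" and A: "A \<in> sets T"
    have 1: "\<psi> -` A \<in> sets borel" using measurable_sets[OF \<psi> A] by simp
    have "V -` B \<inter> W -` A \<inter> space M = V -` B \<inter> (\<lambda>\<omega>. \<phi> (W \<omega>)) -` (\<psi> -` A) \<inter> space M"
      using \<phi>\<psi> measurable_space[OF W] by auto
    with gB[OF B 1] show "emeasure M (V -` B \<inter> W -` A \<inter> space M) =
      (\<integral>\<^sup>+v\<in>B. emeasure uniform01 {u\<in>{0..1}. \<psi> (g (v, u)) \<in> A} \<partial>distr M P V)" by simp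
  qed
qed

section \<open>Coding sequences by real numbers\<close>

text \<open>
  The point of the Cantor set with the given ternary digits (0 or 2). Unlike binary expansions, these
  are unique, so the digits can be read off again.
\<close>

definition cantor_sum :: "(nat \<Rightarrow> bool) \<Rightarrow> real" where
  "cantor_sum b = (\<Sum>n. if b n then 2 / 3 ^ Suc n else 0)"

text \<open>
  On the Cantor set this is the shift that drops the first \<open>n\<close> ternary digits; the first digit of a
  point is 2 exactly if the point is at least \<open>1/2\<close>.
\<close>

fun ternary_tail :: "nat \<Rightarrow> real \<Rightarrow> real" where
  "ternary_tail 0 y = y"
| "ternary_tail (Suc n) y = 3 * ternary_tail n y - (if 1/2 \<le> ternary_tail n y then 2 else 0)"

lemma cantor_series: "(\<lambda>n. 2 / 3 ^ Suc n :: real) sums 1"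
proof -
  have "(\<lambda>n. 2/3 * (1/3) ^ n :: real) sums (2/3 * (1 / (1 - 1/3)))"
    by (intro sums_mult geometric_sums) simp
  then show ?thesis by (simp add: power_divide field_simps)
qed

lemma cantor_summable: "summable (\<lambda>n. if b n then 2 / 3 ^ Suc n else (0::real))"
  by (rule summable_comparison_test_ev[OF _ sums_summable[OF cantor_series]]) (auto intro!: always_eventually)

lemma cantor_sum_bounds: "0 \<le> cantor_sum b" "cantor_sum b \<le> 1"
proof -
  show "0 \<le> cantor_sum b" unfolding cantor_sum_def by (intro suminf_nonneg cantor_summable) auto
  have "cantor_sum b \<le> (\<Sum>n. 2 / 3 ^ Suc n)"
    unfolding cantor_sum_def by (intro suminf_le cantor_summable sums_summable[OF cantor_series]) auto
  then show "cantor_sum b \<le> 1" using sums_unique[OF cantor_series] by simp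
qed

lemma cantor_sum_Suc: "cantor_sum b = ((if b 0 then 2 else 0) + cantor_sum (\<lambda>n. b (Suc n))) / 3"
proof -
  have "cantor_sum b = (if b 0 then 2 / 3 else 0) + (\<Sum>n. if b (Suc n) then 2 / 3 ^ Suc (Suc n) else 0)"
    unfolding cantor_sum_def using suminf_split_head[OF cantor_summable[of b]] by simp
  also have "(\<Sum>n. if b (Suc n) then 2 / 3 ^ Suc (Suc n) else (0::real)) = (\<Sum>n. (if b (Suc n) then 2 / 3 ^ Suc n else 0) / 3)"
    by (intro suminf_cong) simp
  also have "\<dots> = cantor_sum (\<lambda>n. b (Suc n)) / 3"
    unfolding cantor_sum_def by (rule suminf_divide) (rule cantor_summable)
  finally show ?thesis by (simp add: add_divide_distrib)
qed

lemma cantor_sum_digit: "1/2 \<le> cantor_sum b \<longleftrightarrow> b 0"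
  using cantor_sum_Suc[of b] cantor_sum_bounds[of "\<lambda>n. b (Suc n)"] by (cases "b 0") auto

lemma ternary_tail_cantor_sum: "ternary_tail n (cantor_sum b) = cantor_sum (\<lambda>k. b (n + k))"
proof (induction n)
  case (Suc n)
  have "cantor_sum (\<lambda>k. b (n + k)) = ((if b n then 2 else 0) + cantor_sum (\<lambda>k. b (Suc n + k))) / 3"
    using cantor_sum_Suc[of "\<lambda>k. b (n + k)"] by simp
  moreover have "1/2 \<le> cantor_sum (\<lambda>k. b (n + k)) \<longleftrightarrow> b n" using cantor_sum_digit[of "\<lambda>k. b (n + k)"] by simp
  ultimately show ?case unfolding ternary_tail.simps Suc by (cases "b n") (auto simp: field_simps)
qed simp

lemma cantor_digits: "1/2 \<le> ternary_tail n (cantor_sum b) \<longleftrightarrow> b n"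
  unfolding ternary_tail_cantor_sum cantor_sum_digit by simp

lemma measurable_ternary_tail[measurable]: "ternary_tail n \<in> borel_measurable borel"
  by (induction n) (simp_all add: measurable_compose)

text \<open>
  A family of points of \<open>[0,1]\<close> is determined by the countably many bits that compare its members with
  the rationals, and these bits are the digits of one point of the Cantor set. A member is recovered
  as the infimum of the rationals above it.
\<close>

lemma codable_PiM:
  assumes "codable S" and J: "countable J"
  shows "codable (PiM J (\<lambda>_. S))"
proof -
  from assms obtain \<phi> \<psi> where [measurable]: "\<phi> \<in> borel_measurable S" and \<psi>[measurable]: "\<psi> \<in> borel \<rightarrow>\<^sub>M S"
    and \<phi>\<psi>: "\<And>x. x \<in> space S \<Longrightarrow> 0 \<le> \<phi> x \<and> \<phi> x \<le> (1::real) \<and> \<psi> (\<phi> x) = x" unfolding codable_def by blast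
  define q :: "nat \<Rightarrow> real" where "q = from_nat_into \<rat>"
  have q: "range q = \<rat>" unfolding q_def by (rule range_from_nat_into) (auto simp: countable_rat)
  define idx where "idx j m = prod_encode (to_nat_on J j, m)" for j m
  \<comment> \<open>Bit \<open>idx j m\<close> tells whether member \<open>j\<close> is below the rational number \<open>q m\<close>.\<close>
  define b where "b x n = (case prod_decode n of (a, m) \<Rightarrow> a \<in> to_nat_on J ` J \<and> \<phi> (x (from_nat_into J a)) < q m)" for x n
  have b_idx: "b x (idx j m) \<longleftrightarrow> \<phi> (x j) < q m" if "j \<in> J" for x j m
    using that J by (simp add: b_def idx_def)
  define \<Phi> where "\<Phi> x = cantor_sum (b x)" for x
  \<comment> \<open>The value 2 exceeds all members, so it does not affect the infimum; \<open>max 0\<close> bounds the infimum for reals that code nothing.\<close>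
  define dec where "dec y j = (INF m. if 1/2 \<le> ternary_tail (idx j m) y then max 0 (q m) else 2)" for y j
  define \<Psi> where "\<Psi> y = (\<lambda>j\<in>J. \<psi> (dec y j))" for y
  have dec: "dec (\<Phi> x) j = \<phi> (x j)" if j: "j \<in> J" and x: "x j \<in> space S" for x j
  proof -
    note bd = \<phi>\<psi>[OF x]
    have d: "dec (\<Phi> x) j = (INF m. if \<phi> (x j) < q m then max 0 (q m) else 2)"
      unfolding dec_def \<Phi>_def cantor_digits b_idx[OF j] ..
    show ?thesis unfolding d
    proof (rule cInf_eq_non_empty)
      fix y assume "y \<in> range (\<lambda>m. if \<phi> (x j) < q m then max 0 (q m) else 2)"
      then show "\<phi> (x j) \<le> y" using bd by (auto split: if_splits simp: max_def)
    next
      fix y assume y: "\<And>z. z \<in> range (\<lambda>m. if \<phi> (x j) < q m then max 0 (q m) else 2) \<Longrightarrow> y \<le> z"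
      show "y \<le> \<phi> (x j)"
      proof (rule ccontr)
        assume "\<not> y \<le> \<phi> (x j)"
        then obtain r where r: "r \<in> \<rat>" "\<phi> (x j) < r" "r < y" using Rats_dense_in_real[of "\<phi> (x j)" y] by auto
        then obtain m where m: "r = q m" using q by blast
        have "y \<le> max 0 (q m)" using y[of "max 0 (q m)"] r m by (force intro: image_eqI[of _ _ m])
        with r m bd show False by auto
      qed
    qed auto
  qed
  show ?thesis
    unfolding codable_def
  proof (intro bexI[of _ \<Phi>] bexI[of _ \<Psi>] ballI conjI)
    show "0 \<le> \<Phi> x" "\<Phi> x \<le> 1" for x by (simp_all add: \<Phi>_def cantor_sum_bounds)
    show "\<Psi> (\<Phi> x) = x" if "x \<in> space (PiM J (\<lambda>_. S))" for x
    proof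
      fix j show "\<Psi> (\<Phi> x) j = x j"
        using that \<phi>\<psi>[of "x j"] dec[of j x] by (cases "j \<in> J") (auto simp: \<Psi>_def space_PiM PiE_iff extensional_def)
    qed
    have "(\<lambda>x. b x n) \<in> PiM J (\<lambda>_. S) \<rightarrow>\<^sub>M count_space UNIV" for n
    proof (cases "prod_decode n")
      case (Pair a m)
      show ?thesis
      proof (cases "a \<in> to_nat_on J ` J")
        case True
        then have "from_nat_into J a \<in> J" using J by auto
        then have [measurable]: "(\<lambda>x. x (from_nat_into J a)) \<in> PiM J (\<lambda>_. S) \<rightarrow>\<^sub>M S" by simp
        show ?thesis unfolding b_def Pair using True by simp
      qed (simp add: b_def Pair)
    qed
    then show "\<Phi> \<in> borel_measurable (PiM J (\<lambda>_. S))"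
      unfolding \<Phi>_def cantor_sum_def by measurable
    have "(\<lambda>y. dec y j) \<in> borel_measurable borel" for j
      unfolding dec_def by (intro borel_measurable_cINF) (auto intro!: bdd_belowI[of _ 0])
    then show "\<Psi> \<in> borel \<rightarrow>\<^sub>M PiM J (\<lambda>_. S)"
      unfolding \<Psi>_def by (intro measurable_restrict measurable_compose[OF _ \<psi>])
  qed
qed

text \<open>
  The inverse is extended by a constant outside the Borel set.
\<close>

lemma codable_of_borel_space:
  assumes "borel_space S" "space S \<noteq> {}"
  shows "codable S"
proof -
  from assms(1) obtain B f g where B: "B \<in> sets (borel :: real measure)" "B \<subseteq> {0..1}"
    and f: "f \<in> S \<rightarrow>\<^sub>M restrict_space borel B" and g: "g \<in> restrict_space borel B \<rightarrow>\<^sub>M S"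
    and gf: "\<And>y. y \<in> space S \<Longrightarrow> g (f y) = y" unfolding borel_space_def by blast
  from assms(2) obtain x0 where x0: "x0 \<in> space S" by auto
  have f01: "0 \<le> f y \<and> f y \<le> 1" and fB: "f y \<in> B" if "y \<in> space S" for y
    using measurable_space[OF f that] B(2) by (auto simp: space_restrict_space)
  have f': "f \<in> borel_measurable S" using f by (simp add: measurable_restrict_space2_iff)
  have g': "(\<lambda>r. if r \<in> B then g r else x0) \<in> borel \<rightarrow>\<^sub>M S"
    using B g x0 by (subst measurable_If_restrict_space_iff) auto
  show ?thesis unfolding codable_def
    using f' g' f01 fB gf by (intro bexI[of _ f] bexI[of _ "\<lambda>r. if r \<in> B then g r else x0"]) auto
qed

section \<open>Laws on product spaces\<close>

lemma emeasure_vimage_eq_of_distr_eq: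
  assumes "distr M T f = distr N T g" "f \<in> M \<rightarrow>\<^sub>M T" "g \<in> N \<rightarrow>\<^sub>M T" "A \<in> sets T"
  shows "emeasure M (f -` A \<inter> space M) = emeasure N (g -` A \<inter> space N)"
  using assms by (metis emeasure_distr)

lemma sets_Collect_preimage: "f \<in> M \<rightarrow>\<^sub>M N \<Longrightarrow> A \<in> sets N \<Longrightarrow> {x\<in>space M. f x \<in> A} \<in> sets M"
  using measurable_sets[of f M N A] by (simp add: vimage_def Int_def conj_commute)

lemma distr_PiM_eqI:
  assumes M: "prob_space M" and X: "\<And>i. i \<in> I \<Longrightarrow> X i \<in> M \<rightarrow>\<^sub>M S" and Y: "\<And>i. i \<in> I \<Longrightarrow> Y i \<in> N \<rightarrow>\<^sub>M S"
    and eq: "\<And>J A. finite J \<Longrightarrow> J \<subseteq> I \<Longrightarrow> (\<And>j. j \<in> J \<Longrightarrow> A j \<in> sets S) \<Longrightarrow>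
      emeasure M {\<omega>\<in>space M. \<forall>j\<in>J. X j \<omega> \<in> A j} = emeasure N {\<omega>\<in>space N. \<forall>j\<in>J. Y j \<omega> \<in> A j}"
  shows "distr M (PiM I (\<lambda>_. S)) (\<lambda>\<omega>. \<lambda>i\<in>I. X i \<omega>) = distr N (PiM I (\<lambda>_. S)) (\<lambda>\<omega>. \<lambda>i\<in>I. Y i \<omega>)"
proof (rule measure_eqI_PiM_infinite)
  have mX: "(\<lambda>\<omega>. \<lambda>i\<in>I. X i \<omega>) \<in> M \<rightarrow>\<^sub>M PiM I (\<lambda>_. S)" using X by (rule measurable_restrict)
  have mY: "(\<lambda>\<omega>. \<lambda>i\<in>I. Y i \<omega>) \<in> N \<rightarrow>\<^sub>M PiM I (\<lambda>_. S)" using Y by (rule measurable_restrict)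
  show "finite_measure (distr M (PiM I (\<lambda>_. S)) (\<lambda>\<omega>. \<lambda>i\<in>I. X i \<omega>))"
    using prob_space.prob_space_distr[OF M mX] by (simp add: prob_space_def)
  fix A J assume J: "finite J" "J \<subseteq> I" and A: "\<And>i. i \<in> J \<Longrightarrow> A i \<in> sets S"
  have vim: "(\<lambda>\<omega>. \<lambda>i\<in>I. Z i \<omega>) -` prod_emb I (\<lambda>_. S) J (Pi\<^sub>E J A) \<inter> space L = {\<omega>\<in>space L. \<forall>j\<in>J. Z j \<omega> \<in> A j}"
    if "\<And>i. i \<in> I \<Longrightarrow> Z i \<in> L \<rightarrow>\<^sub>M S" for Z and L :: "'z measure"
    using J that[THEN measurable_space] by (auto simp: prod_emb_def PiE_iff restrict_def extensional_def subset_eq)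
  show "emeasure (distr M (PiM I (\<lambda>_. S)) (\<lambda>\<omega>. \<lambda>i\<in>I. X i \<omega>)) (prod_emb I (\<lambda>_. S) J (Pi\<^sub>E J A)) =
    emeasure (distr N (PiM I (\<lambda>_. S)) (\<lambda>\<omega>. \<lambda>i\<in>I. Y i \<omega>)) (prod_emb I (\<lambda>_. S) J (Pi\<^sub>E J A))"
    using eq[OF J A] J A
    by (simp add: emeasure_distr[OF mX] emeasure_distr[OF mY] sets_PiM_I vim[OF X] vim[OF Y])
qed simp_all

lemma (in prob_space) nn_integral_indep_var:
  assumes ind: "indep_var Q R T U" and h[measurable]: "h \<in> borel_measurable (Q \<Otimes>\<^sub>M T)"
  shows "(\<integral>\<^sup>+\<omega>. h (R \<omega>, U \<omega>) \<partial>M) = (\<integral>\<^sup>+\<omega>. (\<integral>\<^sup>+u. h (R \<omega>, u) \<partial>distr M T U) \<partial>M)"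
proof -
  have [measurable]: "R \<in> M \<rightarrow>\<^sub>M Q" "U \<in> M \<rightarrow>\<^sub>M T" using indep_var_rv1[OF ind] indep_var_rv2[OF ind] by auto
  have eq: "distr M Q R \<Otimes>\<^sub>M distr M T U = distr M (Q \<Otimes>\<^sub>M T) (\<lambda>x. (R x, U x))"
    using ind by (simp add: indep_var_distribution_eq)
  interpret U: prob_space "distr M T U" by (rule prob_space_distr) simp
  have "(\<integral>\<^sup>+\<omega>. h (R \<omega>, U \<omega>) \<partial>M) = (\<integral>\<^sup>+p. h p \<partial>(distr M Q R \<Otimes>\<^sub>M distr M T U))"
    unfolding eq by (subst nn_integral_distr) auto
  also have "\<dots> = (\<integral>\<^sup>+r. (\<integral>\<^sup>+u. h (r, u) \<partial>distr M T U) \<partial>distr M Q R)"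
    by (subst U.nn_integral_fst[symmetric]) auto
  also have "\<dots> = (\<integral>\<^sup>+\<omega>. (\<integral>\<^sup>+u. h (R \<omega>, u) \<partial>distr M T U) \<partial>M)"
    by (subst nn_integral_distr) auto
  finally show ?thesis .
qed

lemma distr_uniform_product_component:
  "i \<in> I \<Longrightarrow> distr (PiM I (\<lambda>_. uniform01)) uniform01 (\<lambda>\<omega>. \<omega> i) = uniform01"
  by (rule distr_PiM_component[OF prob_space_uniform01])

lemma indep_vars_uniform_product:
  assumes "I \<noteq> {}"
  shows "prob_space.indep_vars (PiM I (\<lambda>_. uniform01)) (\<lambda>_. uniform01) (\<lambda>i \<omega>. \<omega> i) I"
proof -
  let ?N = "PiM I (\<lambda>_. uniform01)"
  interpret N: prob_space ?N by (intro prob_space_PiM prob_space_uniform01)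
  have "distr ?N ?N (\<lambda>\<omega>. \<lambda>i\<in>I. \<omega> i) = distr ?N ?N (\<lambda>\<omega>. \<omega>)"
    by (rule distr_cong) (auto simp: space_PiM extensional_restrict PiE_iff)
  also have "\<dots> = ?N" by (rule distr_id)
  also have "\<dots> = PiM I (\<lambda>i. distr ?N uniform01 (\<lambda>\<omega>. \<omega> i))"
    by (rule PiM_cong) (simp_all add: distr_uniform_product_component)
  finally show ?thesis
    using N.indep_vars_iff_distr_eq_PiM'[OF assms, of "\<lambda>i \<omega>. \<omega> i" "\<lambda>_. uniform01"] by simp
qed

text \<open>
  Fubini for a single coordinate of an infinite product, which is independent of the others.
\<close>

lemma nn_integral_uniform_product_component:
  assumes \<delta>: "\<delta> \<in> I"
    and h: "h \<in> borel_measurable (PiM (I - {\<delta>}) (\<lambda>_. uniform01) \<Otimes>\<^sub>M uniform01)"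
  shows "(\<integral>\<^sup>+\<omega>. h (restrict \<omega> (I - {\<delta>}), \<omega> \<delta>) \<partial>PiM I (\<lambda>_. uniform01)) =
    (\<integral>\<^sup>+\<omega>. \<integral>\<^sup>+u. h (restrict \<omega> (I - {\<delta>}), u) \<partial>uniform01 \<partial>PiM I (\<lambda>_. uniform01))"
proof -
  let ?N = "PiM I (\<lambda>_. uniform01)"
  interpret N: prob_space ?N by (intro prob_space_PiM prob_space_uniform01)
  let ?P = "PiM (I - {\<delta>}) (\<lambda>_. uniform01)" and ?Q = "PiM {\<delta>} (\<lambda>_. uniform01)"
  let ?R = "\<lambda>\<omega>. restrict (\<lambda>i. \<omega> i) (I - {\<delta>})" and ?U = "\<lambda>\<omega>. restrict (\<lambda>i. \<omega> i) {\<delta>}"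
  have ind: "N.indep_var ?P ?R ?Q ?U"
    using \<delta> by (intro N.indep_var_restrict[OF indep_vars_uniform_product]) auto
  have c: "(\<lambda>f. f \<delta>) \<in> ?Q \<rightarrow>\<^sub>M uniform01" by (rule measurable_component_singleton) simp
  have c': "(\<lambda>\<omega>. \<omega> \<delta>) \<in> ?N \<rightarrow>\<^sub>M uniform01" using \<delta> by (rule measurable_component_singleton)
  have U: "?U \<in> ?N \<rightarrow>\<^sub>M ?Q" using N.indep_var_rv2[OF ind] .
  have R: "?R \<in> ?N \<rightarrow>\<^sub>M ?P" using N.indep_var_rv1[OF ind] .
  have h': "(\<lambda>p. h (fst p, snd p \<delta>)) \<in> borel_measurable (?P \<Otimes>\<^sub>M ?Q)"
    by (rule measurable_compose[OF _ h]) (intro measurable_Pair measurable_fst measurable_compose[OF measurable_snd c])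
  have "(\<integral>\<^sup>+\<omega>. h (restrict \<omega> (I - {\<delta>}), \<omega> \<delta>) \<partial>?N) = (\<integral>\<^sup>+\<omega>. \<integral>\<^sup>+f. h (?R \<omega>, f \<delta>) \<partial>distr ?N ?Q ?U \<partial>?N)"
    using N.nn_integral_indep_var[OF ind h'] by simp
  also have "\<dots> = (\<integral>\<^sup>+\<omega>. \<integral>\<^sup>+u. h (restrict \<omega> (I - {\<delta>}), u) \<partial>uniform01 \<partial>?N)"
  proof (rule nn_integral_cong)
    fix \<omega> assume "\<omega> \<in> space ?N"
    then have hR: "(\<lambda>u. h (?R \<omega>, u)) \<in> borel_measurable uniform01"
      by (intro measurable_compose[OF measurable_Pair1' h] measurable_space[OF R])
    have "(\<integral>\<^sup>+f. h (?R \<omega>, f \<delta>) \<partial>distr ?N ?Q ?U) = (\<integral>\<^sup>+\<omega>'. h (?R \<omega>, ?U \<omega>' \<delta>) \<partial>?N)"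
      by (rule nn_integral_distr[OF U]) (use measurable_compose[OF c hR] in simp)
    also have "\<dots> = (\<integral>\<^sup>+u. h (?R \<omega>, u) \<partial>distr ?N uniform01 (\<lambda>\<omega>. \<omega> \<delta>))"
      using nn_integral_distr[OF c', of "\<lambda>u. h (?R \<omega>, u)"] hR by simp
    finally show "(\<integral>\<^sup>+f. h (?R \<omega>, f \<delta>) \<partial>distr ?N ?Q ?U) = (\<integral>\<^sup>+u. h (restrict \<omega> (I - {\<delta>}), u) \<partial>uniform01)"
      unfolding distr_uniform_product_component[OF \<delta>] by simp
  qed
  finally show ?thesis .
qed

lemma iid_uniform_product:
  assumes "I \<noteq> {}"
  shows "iid_uniform (PiM I (\<lambda>_. uniform01)) I (\<lambda>i \<omega>. \<omega> i)"
proof -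
  let ?N = "PiM I (\<lambda>_. uniform01)"
  interpret N: prob_space ?N by (intro prob_space_PiM prob_space_uniform01)
  have "N.indep_vars (\<lambda>_. unit_interval) (\<lambda>i \<omega>. \<omega> i) I"
    by (rule N.indep_vars_compose2[OF indep_vars_uniform_product[OF assms], of "\<lambda>_ u. u"])
      (rule measurable_ident_sets[OF sets_uniform01])
  moreover have "distr ?N lborel (\<lambda>\<omega>. \<omega> i) = uniform_measure lborel {0..1}" if i: "i \<in> I" for i
  proof -
    have m: "(\<lambda>u. u) \<in> uniform01 \<rightarrow>\<^sub>M lborel"
      unfolding uniform01_def by (intro measurable_restrict_space1) simp
    have "distr ?N lborel (\<lambda>\<omega>. \<omega> i) = distr (distr ?N uniform01 (\<lambda>\<omega>. \<omega> i)) lborel (\<lambda>u. u)"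
      by (subst distr_distr[OF m measurable_component_singleton[OF i]]) (simp add: comp_def)
    then show ?thesis unfolding distr_uniform_product_component[OF i] distr_uniform01 .
  qed
  ultimately show ?thesis unfolding iid_uniform_def using N.prob_space_axioms by blast
qed

section \<open>Relabelings of the indices of a DAG\<close>

text \<open>
  The finite sets \<open>A\<close> and \<open>f ` A\<close> have equally large complements in their union, so \<open>f\<close> on \<open>A\<close> can
  be completed to a permutation of that union.
\<close>

lemma extend_injection_to_bij:
  fixes f :: "nat \<Rightarrow> nat"
  assumes "inj f" "finite A"
  shows "\<exists>p. bij p \<and> (\<forall>a\<in>A. p a = f a)"
proof -
  define B where "B = A \<union> f ` A"
  have fin: "finite B" unfolding B_def using assms by auto
  have "card (B - A) = card (B - f ` A)"
    using assms by (subst (1 2) card_Diff_subset) (auto simp: B_def card_image inj_on_subset)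
  then obtain h where h: "bij_betw h (B - A) (B - f ` A)"
    using fin by (metis finite_Diff finite_same_card_bij)
  have fA: "bij_betw f A (f ` A)" using assms by (meson inj_on_imp_bij_betw inj_on_subset subset_UNIV)
  define p where "p n = (if n \<in> B then if n \<in> A then f n else h n else n)" for n
  have "bij_betw p A (f ` A)"
    by (subst bij_betw_cong[where g=f, OF _]) (auto simp: p_def B_def fA)
  moreover have "bij_betw p (B - A) (B - f ` A)"
    by (subst bij_betw_cong[where g=h, OF _]) (auto simp: p_def h)
  ultimately have "bij_betw p (A \<union> (B - A)) (f ` A \<union> (B - f ` A))"
    by (rule bij_betw_combine) auto
  moreover have "bij_betw p (- B) (- B)"
    by (subst bij_betw_cong[where g=id, OF _]) (auto simp: p_def)
  ultimately have "bij_betw p ((A \<union> (B - A)) \<union> - B) ((f ` A \<union> (B - f ` A)) \<union> - B)"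
    by (rule bij_betw_combine) (auto simp: B_def)
  moreover have "(A \<union> (B - A)) \<union> - B = UNIV" "(f ` A \<union> (B - f ` A)) \<union> - B = UNIV" by (auto simp: B_def)
  ultimately have "bij p" by simp
  then show ?thesis by (intro exI[of _ p]) (auto simp: p_def B_def)
qed

lemma exists_injection_to_odds:
  assumes "finite (Q :: nat set)"
  shows "\<exists>\<theta>. inj \<theta> \<and> (\<forall>n\<in>Q. \<theta> n = n) \<and> (\<forall>n. n \<notin> Q \<longrightarrow> odd (\<theta> n))"
proof -
  define m where "m = Max (insert 0 Q)"
  have m: "n \<le> m" if "n \<in> Q" for n unfolding m_def using that assms by auto
  define \<theta> where "\<theta> n = (if n \<in> Q then n else 2 * (n + m) + 1)" for n
  have "inj \<theta>"
  proof (rule injI)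
    fix a b assume "\<theta> a = \<theta> b" then show "a = b"
      using m[of a] m[of b] unfolding \<theta>_def by (auto split: if_splits)
  qed
  then show ?thesis by (intro exI[of _ \<theta>]) (auto simp: \<theta>_def)
qed

locale dag =
  fixes G :: "'v set" and E :: "('v \<times> 'v) set"
  assumes dag: "finite_dag G E"
begin

lemma finite_G: "finite G" and E_subset: "E \<subseteq> G \<times> G" and acyclic_E: "acyclic E"
  using dag by (auto simp: finite_dag_def)

lemma wf_E: "wf (E\<^sup>+)"
  using finite_acyclic_wf[OF finite_subset[OF E_subset] acyclic_E] finite_G by (auto intro: wf_trancl)

definition preds :: "'v \<Rightarrow> 'v set" where "preds v = {u. (u, v) \<in> E\<^sup>+}"

definition down_closed :: "'v set \<Rightarrow> bool" where "down_closed C \<longleftrightarrow> (\<forall>v\<in>C. preds v \<subseteq> C)"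

lemma closed_subsets_iff: "D \<in> closed_subsets E C \<longleftrightarrow> D \<subseteq> C \<and> down_closed D"
  unfolding closed_subsets_def down_closed_def preds_def rtrancl_eq_or_trancl by blast

lemma preds_trans: "u \<in> preds v \<Longrightarrow> preds u \<subseteq> preds v"
  unfolding preds_def by auto

lemma preds_induct[case_names step]: "(\<And>v. (\<And>u. u \<in> preds v \<Longrightarrow> Q u) \<Longrightarrow> Q v) \<Longrightarrow> Q v"
  using wf_induct_rule[OF wf_E, of Q v] unfolding preds_def by auto

lemma down_closedD: "down_closed C \<Longrightarrow> v \<in> C \<Longrightarrow> preds v \<subseteq> C"
  by (auto simp: down_closed_def)

text \<open>
  The group of automorphisms is an iterated wreath product: the new value at \<open>v\<close> is obtained from the
  old one by a map \<open>\<sigma> v c\<close> that may depend on the values \<open>c\<close> of the index at the strict predecessors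
  of \<open>v\<close>. Bijective maps give automorphisms; injective ones give embeddings of the index sets.
\<close>

definition act :: "('v \<Rightarrow> ('v \<rightharpoonup> nat) \<Rightarrow> nat \<Rightarrow> nat) \<Rightarrow> ('v \<rightharpoonup> nat) \<Rightarrow> ('v \<rightharpoonup> nat)" where
  "act \<sigma> \<alpha> = (\<lambda>v. map_option (\<sigma> v (\<alpha> |` preds v)) (\<alpha> v))"

lemma dom_act[simp]: "dom (act \<sigma> \<alpha>) = dom \<alpha>"
  by (auto simp: act_def dom_def)

lemma restrict_act:
  assumes "down_closed C"
  shows "act \<sigma> (\<alpha> |` C) = act \<sigma> \<alpha> |` C"
proof
  fix v show "act \<sigma> (\<alpha> |` C) v = (act \<sigma> \<alpha> |` C) v"
    using down_closedD[OF assms, of v] by (cases "v \<in> C") (simp_all add: act_def Int_absorb1 Int_commute)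
qed

text \<open>
  The values can be recovered by recursion along the graph, because the map used at \<open>v\<close> is known once
  the values at the predecessors of \<open>v\<close> are.
\<close>

lemma act_inject:
  assumes inj: "\<And>v c. inj (\<sigma> v c)"
  shows "act \<sigma> \<alpha> = act \<sigma> \<beta> \<longleftrightarrow> \<alpha> = \<beta>"
proof
  assume eq: "act \<sigma> \<alpha> = act \<sigma> \<beta>"
  have "\<alpha> v = \<beta> v" for v
  proof (induction v rule: preds_induct)
    case (step v)
    then have c: "\<alpha> |` preds v = \<beta> |` preds v" by (auto simp: restrict_map_def fun_eq_iff)
    from fun_cong[OF eq, of v] show ?case
      unfolding act_def c by (rule option.inj_map_strong[rotated]) (auto dest: injD[OF inj])
  qed
  then show "\<alpha> = \<beta>" by auto
qed simp

text \<open>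
  The preimage is computed by recursion along the graph.
\<close>

lemma act_surj:
  assumes bij: "\<And>v c. bij (\<sigma> v c)"
  shows "\<exists>\<alpha>. act \<sigma> \<alpha> = \<beta>"
proof -
  define \<alpha> where "\<alpha> = wfrec (E\<^sup>+) (\<lambda>\<alpha> v. map_option (inv (\<sigma> v (\<alpha> |` preds v))) (\<beta> v))"
  have \<alpha>: "\<alpha> v = map_option (inv (\<sigma> v (\<alpha> |` preds v))) (\<beta> v)" for v
  proof -
    have "cut \<alpha> (E\<^sup>+) v |` preds v = \<alpha> |` preds v"
      by (auto simp: restrict_map_def fun_eq_iff cut_def preds_def)
    then show ?thesis unfolding \<alpha>_def by (subst wfrec[OF wf_E]) simp
  qed
  have "act \<sigma> \<alpha> v = \<beta> v" for v
  proof -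
    have "act \<sigma> \<alpha> v = map_option (\<sigma> v (\<alpha> |` preds v)) (map_option (inv (\<sigma> v (\<alpha> |` preds v))) (\<beta> v))"
      unfolding act_def by (rule arg_cong[OF \<alpha>])
    then show ?thesis by (simp add: option.map_comp comp_def surj_f_inv_f[OF bij_is_surj[OF bij]] option.map_ident)
  qed
  then show ?thesis by auto
qed

lemma dag_automorphism_act:
  assumes bij: "\<And>v c. bij (\<sigma> v c)"
  shows "dag_automorphism G E (act \<sigma>)"
  unfolding dag_automorphism_def
proof (intro conjI ballI)
  have inj: "inj (\<sigma> v c)" for v c using bij by (rule bij_is_inj)
  show "bij_betw (act \<sigma>) (nat_pow G) (nat_pow G)"
    unfolding bij_betw_def
  proof (intro conjI equalityI subsetI)
    show "inj_on (act \<sigma>) (nat_pow G)" by (rule inj_onI) (simp add: act_inject[of \<sigma>, OF inj])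
    fix \<beta> assume \<beta>: "\<beta> \<in> nat_pow G"
    from act_surj[of \<sigma> \<beta>, OF bij] obtain \<alpha> where \<alpha>: "\<beta> = act \<sigma> \<alpha>" by auto
    with \<beta> show "\<beta> \<in> act \<sigma> ` nat_pow G" by (auto simp: nat_pow_def)
  next
    fix \<beta> assume "\<beta> \<in> act \<sigma> ` nat_pow G"
    then obtain \<alpha> where "\<alpha> \<in> nat_pow G" "\<beta> = act \<sigma> \<alpha>" by blast
    then show "\<beta> \<in> nat_pow G" by (simp add: nat_pow_def)
  qed
  fix C \<alpha> \<beta> assume C: "C \<in> closed_subsets E G"
  then have C: "down_closed C" by (simp add: closed_subsets_iff)
  show "\<alpha> |` C = \<beta> |` C \<longleftrightarrow> act \<sigma> \<alpha> |` C = act \<sigma> \<beta> |` C"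
    unfolding restrict_act[OF C, symmetric] act_inject[of \<sigma>, OF inj] ..
qed

lemma induced_act:
  assumes bij: "\<And>v c. bij (\<sigma> v c)" and C: "C \<in> closed_subsets E G" and \<beta>: "dom \<beta> = C"
  shows "induced G (act \<sigma>) \<beta> = act \<sigma> \<beta>"
proof -
  define \<alpha> where "\<alpha> v = (if v \<in> C then \<beta> v else if v \<in> G then Some 0 else None)" for v
  have "C \<subseteq> G" using C by (simp add: closed_subsets_iff)
  then have "dom \<alpha> = G" using \<beta> by (force simp: \<alpha>_def dom_def split: if_splits)
  then have 1: "\<alpha> \<in> nat_pow G" by (simp add: nat_pow_def)
  have 2: "\<alpha> |` C = \<beta>" using \<beta> by (auto simp: \<alpha>_def restrict_map_def fun_eq_iff)
  show ?thesis
    using induced_restrict[OF dag_automorphism_act[of \<sigma>, OF bij] C 1] C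
    unfolding 2[symmetric] by (simp add: restrict_act closed_subsets_iff)
qed

section \<open>Even coordinates and layers\<close>

text \<open>
  Evenness is required at all predecessors too, which makes this set closed: once a value is odd,
  everything above it belongs to a spare copy of the array, whatever its parity.
\<close>

definition evens :: "('v \<rightharpoonup> nat) \<Rightarrow> 'v set" where
  "evens \<alpha> = {v. \<forall>u\<in>insert v (preds v). \<exists>n. \<alpha> u = Some n \<and> even n}"

definition dbl :: "('v \<rightharpoonup> nat) \<Rightarrow> ('v \<rightharpoonup> nat)" where "dbl \<delta> = (\<lambda>v. map_option ((*) 2) (\<delta> v))"

lemma dom_dbl[simp]: "dom (dbl \<delta>) = dom \<delta>" by (auto simp: dbl_def)

lemma dbl_restrict: "dbl (\<delta> |` D) = dbl \<delta> |` D"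
  by (auto simp: dbl_def restrict_map_def fun_eq_iff)

lemma dbl_restrict_dom[simp]: "dbl \<delta> |` dom \<delta> = dbl \<delta>"
  by (auto simp: dbl_def restrict_map_def fun_eq_iff domIff)

lemma dbl_inject[simp]: "dbl \<alpha> = dbl \<beta> \<longleftrightarrow> \<alpha> = \<beta>"
proof
  assume "dbl \<alpha> = dbl \<beta>"
  then have "map_option ((*) 2) (\<alpha> v) = map_option ((*) 2) (\<beta> v)" for v unfolding dbl_def by metis
  then have "\<alpha> v = \<beta> v" for v by (rule option.inj_map_strong[rotated]) auto
  then show "\<alpha> = \<beta>" by auto
qed simp

lemma dbl_even: "dbl \<delta> v = Some n \<Longrightarrow> even n" by (auto simp: dbl_def)

lemma down_closed_evens: "down_closed (evens \<alpha>)"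
  unfolding down_closed_def evens_def using preds_trans by blast

lemma evens_subset_dom: "evens \<alpha> \<subseteq> dom \<alpha>" unfolding evens_def by auto

lemma evens_memI: "v \<in> dom \<alpha> \<Longrightarrow> preds v \<subseteq> evens \<alpha> \<Longrightarrow> even (the (\<alpha> v)) \<Longrightarrow> v \<in> evens \<alpha>"
  unfolding evens_def by auto

lemma evens_evenD: "v \<in> evens \<alpha> \<Longrightarrow> \<exists>n. \<alpha> v = Some n \<and> even n" unfolding evens_def by auto

text \<open>
  For closed \<open>dom \<delta>\<close> the indices fall into three kinds relative to \<open>\<delta>\<close>, according to their even part:
  it is \<open>2\<delta>\<close> itself (\<open>layer\<close>), it is a proper restriction of \<open>2\<delta>\<close> (\<open>below\<close>), or it is something
  else. The indices that do not extend \<open>2\<delta>\<close> (\<open>beside\<close>) include those of the second kind and exclude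
  those of the first.
\<close>

definition layer :: "('v \<rightharpoonup> nat) \<Rightarrow> ('v \<rightharpoonup> nat) set" where
  "layer \<delta> = {\<alpha>. evens \<alpha> = dom \<delta> \<and> \<alpha> |` dom \<delta> = dbl \<delta>}"

definition below :: "('v \<rightharpoonup> nat) \<Rightarrow> ('v \<rightharpoonup> nat) set" where
  "below \<delta> = {\<alpha>. evens \<alpha> \<subset> dom \<delta> \<and> \<alpha> |` evens \<alpha> = dbl \<delta> |` evens \<alpha>}"

definition beside :: "('v \<rightharpoonup> nat) \<Rightarrow> ('v \<rightharpoonup> nat) set" where
  "beside \<delta> = {\<alpha>. \<alpha> |` dom \<delta> \<noteq> dbl \<delta>}"

lemma dbl_restrict_evens:
  assumes "down_closed (dom \<delta>)" "\<alpha> |` dom \<delta> = dbl \<delta>"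
  shows "dom \<delta> \<subseteq> evens \<alpha>"
proof
  fix v assume "v \<in> dom \<delta>"
  have "\<exists>n. \<alpha> u = Some n \<and> even n" if "u \<in> dom \<delta>" for u
  proof -
    from that have "u \<in> dom (dbl \<delta>)" by simp
    then obtain n where n: "dbl \<delta> u = Some n" by blast
    then have "(\<alpha> |` dom \<delta>) u = Some n" unfolding assms(2) .
    then show ?thesis using that dbl_even[OF n] by (simp add: restrict_in)
  qed
  then show "v \<in> evens \<alpha>" using down_closedD[OF assms(1) \<open>v \<in> dom \<delta>\<close>] \<open>v \<in> dom \<delta>\<close> unfolding evens_def by blast
qed

lemma below_subset_beside:
  assumes "down_closed (dom \<delta>)" shows "below \<delta> \<subseteq> beside \<delta>"
  using dbl_restrict_evens[OF assms] by (auto simp: below_def beside_def)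

lemma layer_subset_beside:
  assumes "down_closed (dom \<delta>)" "\<epsilon> |` dom \<delta> \<noteq> \<delta>"
  shows "layer \<epsilon> \<subseteq> beside \<delta>"
proof
  fix \<alpha> assume \<alpha>: "\<alpha> \<in> layer \<epsilon>"
  show "\<alpha> \<in> beside \<delta>"
  proof (rule ccontr)
    assume "\<alpha> \<notin> beside \<delta>"
    then have 1: "\<alpha> |` dom \<delta> = dbl \<delta>" by (simp add: beside_def)
    with dbl_restrict_evens[OF assms(1)] \<alpha> have "dom \<delta> \<subseteq> dom \<epsilon>" by (auto simp: layer_def)
    moreover have "dbl \<epsilon> = \<alpha> |` dom \<epsilon>" using \<alpha> by (simp add: layer_def)
    ultimately have "dbl \<epsilon> |` dom \<delta> = dbl \<delta>" using 1 by (simp add: Int_absorb1)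
    then show False using assms(2) unfolding dbl_restrict[symmetric] by simp
  qed
qed

lemma below_in_layer:
  assumes "\<alpha> \<in> below \<delta>" shows "\<alpha> \<in> layer (\<delta> |` evens \<alpha>)" "evens \<alpha> \<subset> dom \<delta>"
  using assms by (auto simp: below_def layer_def dbl_restrict Int_absorb1)

text \<open>
  If \<open>\<delta>\<close> is defined on \<open>evens \<alpha>\<close>, this moves \<open>\<alpha>\<close> into the layer of the corresponding
  restriction of \<open>\<delta>\<close>, keeping the spare coordinates. This is how the layers of different indices with the same domain are compared.
\<close>

definition overwrite :: "('v \<rightharpoonup> nat) \<Rightarrow> ('v \<rightharpoonup> nat) \<Rightarrow> ('v \<rightharpoonup> nat)" where
  "overwrite \<alpha> \<delta> = (\<lambda>v. if v \<in> evens \<alpha> then dbl \<delta> v else \<alpha> v)"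

lemma dom_overwrite: "evens \<alpha> \<subseteq> dom \<delta> \<Longrightarrow> dom (overwrite \<alpha> \<delta>) = dom \<alpha>"
  using evens_subset_dom[of \<alpha>] dom_dbl[of \<delta>] unfolding overwrite_def by (auto split: if_splits simp: dom_def)

lemma evens_overwrite:
  assumes "evens \<alpha> \<subseteq> dom \<delta>" shows "evens (overwrite \<alpha> \<delta>) = evens \<alpha>"
proof
  show "evens \<alpha> \<subseteq> evens (overwrite \<alpha> \<delta>)"
  proof
    fix v assume v: "v \<in> evens \<alpha>"
    have "\<exists>n. overwrite \<alpha> \<delta> u = Some n \<and> even n" if "u \<in> evens \<alpha>" for u
    proof -
      from that assms have "u \<in> dom (dbl \<delta>)" by auto
      then obtain n where "dbl \<delta> u = Some n" by blast
      with dbl_even[OF this] that show ?thesis by (simp add: overwrite_def)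
    qed
    with v down_closedD[OF down_closed_evens v] show "v \<in> evens (overwrite \<alpha> \<delta>)" unfolding evens_def[of "overwrite \<alpha> \<delta>"] by blast
  qed
  show "evens (overwrite \<alpha> \<delta>) \<subseteq> evens \<alpha>"
  proof
    fix v assume v: "v \<in> evens (overwrite \<alpha> \<delta>)"
    have "\<exists>n. \<alpha> u = Some n \<and> even n" if "u \<in> insert v (preds v)" for u
    proof -
      have "\<exists>n. overwrite \<alpha> \<delta> u = Some n \<and> even n" using v that unfolding evens_def[of "overwrite \<alpha> \<delta>"] by blast
      then show ?thesis using evens_evenD[of u \<alpha>] by (cases "u \<in> evens \<alpha>") (simp_all add: overwrite_def)
    qed
    then show "v \<in> evens \<alpha>" unfolding evens_def by blast
  qed
qed

lemma overwrite_overwrite: "evens \<alpha> \<subseteq> dom \<delta> \<Longrightarrow> overwrite (overwrite \<alpha> \<delta>) \<epsilon> = overwrite \<alpha> \<epsilon>"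
  unfolding overwrite_def[of "overwrite \<alpha> \<delta>"] by (simp add: evens_overwrite) (auto simp: overwrite_def fun_eq_iff)

lemma overwrite_idem: "\<alpha> |` evens \<alpha> = dbl \<delta> |` evens \<alpha> \<Longrightarrow> overwrite \<alpha> \<delta> = \<alpha>"
  by (auto simp: overwrite_def restrict_map_def fun_eq_iff) metis

lemma overwrite_restrict_evens: "overwrite \<alpha> \<delta> |` evens \<alpha> = dbl \<delta> |` evens \<alpha>"
  by (auto simp: overwrite_def restrict_map_def fun_eq_iff)

lemma overwrite_cong: "\<delta> |` evens \<alpha> = \<epsilon> |` evens \<alpha> \<Longrightarrow> overwrite \<alpha> \<delta> = overwrite \<alpha> \<epsilon>"
  unfolding overwrite_def dbl_def fun_eq_iff by (metis restrict_in)

definition zeros :: "'v set \<Rightarrow> ('v \<rightharpoonup> nat)" where "zeros D = (\<lambda>v. if v \<in> D then Some 0 else None)"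

lemma dom_zeros[simp]: "dom (zeros D) = D" by (auto simp: zeros_def split: if_splits)

lemma dbl_zeros[simp]: "dbl (zeros D) = zeros D" by (auto simp: zeros_def dbl_def)

lemma zeros_restrict: "zeros D |` C = zeros (D \<inter> C)"
  by (auto simp: zeros_def restrict_map_def fun_eq_iff)

text \<open>
  Within a layer, an index is described by its part outside \<open>evens\<close>. The representative with zeros on
  \<open>evens\<close> provides a common index set for the layers of all \<open>\<delta>\<close> with the same domain.
\<close>

definition canon :: "('v \<rightharpoonup> nat) \<Rightarrow> ('v \<rightharpoonup> nat)" where "canon \<alpha> = overwrite \<alpha> (zeros (evens \<alpha>))"

text \<open>
  The \<open>\<delta>\<close> to whose layer the index belongs.
\<close>

definition half :: "('v \<rightharpoonup> nat) \<Rightarrow> ('v \<rightharpoonup> nat)" where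
  "half \<alpha> = (\<lambda>v. map_option (\<lambda>n. n div 2) (\<alpha> v)) |` evens \<alpha>"

lemma half_layer: assumes "\<alpha> \<in> layer \<delta>" shows "half \<alpha> = \<delta>"
proof
  fix v show "half \<alpha> v = \<delta> v"
  proof (cases "v \<in> dom \<delta>")
    case True
    then have "(\<alpha> |` dom \<delta>) v = \<alpha> v" by (rule restrict_in)
    moreover have "v \<in> evens \<alpha>" using assms True by (simp add: layer_def)
    ultimately have "\<alpha> v = dbl \<delta> v" using assms by (simp add: layer_def)
    then show ?thesis using assms True by (simp add: layer_def half_def dbl_def option.map_comp comp_def option.map_ident)
  next
    case False
    then show ?thesis using assms by (auto simp: half_def layer_def)
  qed
qed

lemma dom_half: "dom (half \<alpha>) = evens \<alpha>"
  using evens_subset_dom[of \<alpha>] by (auto simp: half_def)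

lemma in_layer_half: "\<alpha> \<in> layer (half \<alpha>)"
  unfolding layer_def dom_half mem_Collect_eq
proof
  show "\<alpha> |` evens \<alpha> = dbl (half \<alpha>)"
  proof
    fix v show "(\<alpha> |` evens \<alpha>) v = dbl (half \<alpha>) v"
      using evens_evenD[of v \<alpha>] by (cases "v \<in> evens \<alpha>") (auto simp: half_def dbl_def)
  qed
qed simp

lemma canon_layer: assumes "\<alpha> \<in> layer \<delta>" shows "canon \<alpha> \<in> layer (zeros (dom \<delta>))" "overwrite (canon \<alpha>) \<delta> = \<alpha>"
proof -
  have e: "evens \<alpha> = dom \<delta>" and r: "\<alpha> |` dom \<delta> = dbl \<delta>" using assms by (auto simp: layer_def)
  have c: "canon \<alpha> = overwrite \<alpha> (zeros (dom \<delta>))" by (simp add: canon_def e)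
  have ec: "evens (canon \<alpha>) = dom \<delta>" unfolding c by (subst evens_overwrite) (auto simp: e)
  show "canon \<alpha> \<in> layer (zeros (dom \<delta>))"
    using overwrite_restrict_evens[of \<alpha> "zeros (dom \<delta>)"] unfolding layer_def by (simp add: ec c[symmetric] e zeros_restrict)
  have "overwrite (canon \<alpha>) \<delta> = overwrite \<alpha> \<delta>" unfolding canon_def by (rule overwrite_overwrite) simp
  also have "\<dots> = \<alpha>" by (rule overwrite_idem) (simp add: e r) 
  finally show "overwrite (canon \<alpha>) \<delta> = \<alpha>" .
qed

lemma layer_evens: "\<alpha> \<in> layer \<delta> \<Longrightarrow> evens \<alpha> = dom \<delta>" by (simp add: layer_def)

lemma below_zerosD:
  assumes "\<gamma> \<in> below (zeros D)"
  shows "evens \<gamma> \<subset> D" "\<gamma> \<in> layer (zeros (evens \<gamma>))" "\<gamma> |` evens \<gamma> = zeros (evens \<gamma>)"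
proof -
  show 1: "evens \<gamma> \<subset> D" using below_in_layer(2)[OF assms] by simp
  show "\<gamma> \<in> layer (zeros (evens \<gamma>))" using below_in_layer(1)[OF assms] 1 by (simp add: zeros_restrict Int_absorb1)
  then show "\<gamma> |` evens \<gamma> = zeros (evens \<gamma>)" by (simp add: layer_def)
qed

lemma overwrite_in_below:
  assumes "\<gamma> \<in> below (zeros (dom \<delta>))"
  shows "overwrite \<gamma> \<delta> \<in> below \<delta>" "dom (overwrite \<gamma> \<delta>) = dom \<gamma>"
    "half (overwrite \<gamma> \<delta>) = \<delta> |` evens \<gamma>" "canon (overwrite \<gamma> \<delta>) = \<gamma>"
proof -
  note e = below_zerosD[OF assms]
  have eo: "evens (overwrite \<gamma> \<delta>) = evens \<gamma>" using e(1) by (intro evens_overwrite) auto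
  show b: "overwrite \<gamma> \<delta> \<in> below \<delta>" using e(1) by (simp add: below_def eo overwrite_restrict_evens)
  show "dom (overwrite \<gamma> \<delta>) = dom \<gamma>" using e(1) by (intro dom_overwrite) auto
  show "half (overwrite \<gamma> \<delta>) = \<delta> |` evens \<gamma>" using half_layer[OF below_in_layer(1)[OF b]] unfolding eo .
  have "canon (overwrite \<gamma> \<delta>) = overwrite \<gamma> (zeros (evens \<gamma>))"
    unfolding canon_def eo using e(1) by (intro overwrite_overwrite) auto
  also have "\<dots> = \<gamma>" using e(3) by (intro overwrite_idem) (simp add: zeros_restrict)
  finally show "canon (overwrite \<gamma> \<delta>) = \<gamma>" .
qed

lemma dom_canon: "dom (canon \<alpha>) = dom \<alpha>"
  unfolding canon_def by (rule dom_overwrite) simp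

lemma canon_below:
  assumes "\<alpha> \<in> below \<delta>"
  shows "canon \<alpha> \<in> below (zeros (dom \<delta>))" "overwrite (canon \<alpha>) \<delta> = \<alpha>"
proof -
  note b = below_in_layer[OF assms]
  have d: "dom (\<delta> |` evens \<alpha>) = evens \<alpha>" using b(2) by auto
  have c: "canon \<alpha> \<in> layer (zeros (evens \<alpha>))" using canon_layer(1)[OF b(1)] unfolding d .
  then have e: "evens (canon \<alpha>) = evens \<alpha>" by (simp add: layer_evens)
  show "canon \<alpha> \<in> below (zeros (dom \<delta>))"
    using c b(2) unfolding below_def by (simp add: e layer_def zeros_restrict Int_absorb1 psubset_imp_subset)
  have "overwrite (canon \<alpha>) \<delta> = overwrite (canon \<alpha>) (\<delta> |` evens \<alpha>)"
    by (rule overwrite_cong) (simp add: e)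
  then show "overwrite (canon \<alpha>) \<delta> = \<alpha>" using canon_layer(2)[OF b(1)] by simp
qed

lemma dbl_in_layer: assumes "down_closed (dom \<alpha>)" shows "dbl \<alpha> \<in> layer \<alpha>"
proof -
  have "evens (dbl \<alpha>) = dom \<alpha>"
    using dbl_restrict_evens[OF assms dbl_restrict_dom] evens_subset_dom[of "dbl \<alpha>"] by simp
  then show ?thesis by (simp add: layer_def)
qed

lemma canon_dbl: assumes "down_closed (dom \<alpha>)" shows "canon (dbl \<alpha>) = zeros (dom \<alpha>)"
  using dbl_in_layer[OF assms] unfolding canon_def
  by (auto simp: layer_def overwrite_def fun_eq_iff zeros_def dbl_def)

lemma act_double: "act (\<lambda>_ _. (*) 2) \<alpha> = dbl \<alpha>"
  by (auto simp: act_def dbl_def)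

text \<open>
  Realises \<open>overwrite\<close> by an automorphism, on indices with zeros on \<open>evens\<close>: along the branch of
  zeros it exchanges 0 with the value prescribed by \<open>2\<delta>\<close>. Both are even, so odd values stay.
\<close>

definition relabel :: "('v \<rightharpoonup> nat) \<Rightarrow> 'v \<Rightarrow> ('v \<rightharpoonup> nat) \<Rightarrow> nat \<Rightarrow> nat" where
  "relabel \<delta> v c = (if v \<in> dom \<delta> \<and> c = zeros (preds v) then Transposition.transpose 0 (2 * the (\<delta> v)) else id)"

lemma bij_relabel: "bij (relabel \<delta> v c)"
  by (simp add: relabel_def)

lemma act_relabel:
  assumes cl: "down_closed (dom \<alpha>)" and sub: "evens \<alpha> \<subseteq> dom \<delta>" and z: "\<alpha> |` evens \<alpha> = zeros (evens \<alpha>)"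
  shows "act (relabel \<delta>) \<alpha> = overwrite \<alpha> \<delta>"
proof
  fix v
  have z0: "\<alpha> u = Some 0" if "u \<in> evens \<alpha>" for u
    using fun_cong[OF z, of u] that by (simp add: zeros_def)
  show "act (relabel \<delta>) \<alpha> v = overwrite \<alpha> \<delta> v"
  proof (cases "v \<in> evens \<alpha>")
    case True
    have "\<alpha> |` preds v = (\<alpha> |` evens \<alpha>) |` preds v"
      using down_closedD[OF down_closed_evens True] by (simp add: Int_absorb1)
    also have "\<dots> = zeros (preds v)"
      unfolding z using down_closedD[OF down_closed_evens True] by (simp add: zeros_restrict Int_absorb1)
    finally have c: "\<alpha> |` preds v = zeros (preds v)" .
    from True sub obtain n where "\<delta> v = Some n" by blast
    then show ?thesis using True z0[OF True] c by (auto simp: act_def relabel_def overwrite_def dbl_def)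
  next
    case False
    show ?thesis
    proof (cases "\<alpha> v")
      case None then show ?thesis using False by (simp add: act_def overwrite_def)
    next
      case (Some n)
      have "relabel \<delta> v (\<alpha> |` preds v) n = n"
      proof (cases "v \<in> dom \<delta> \<and> \<alpha> |` preds v = zeros (preds v)")
        case True
        have "\<alpha> u = Some 0" if "u \<in> preds v" for u
          using fun_cong[OF conjunct2[OF True], of u] that by (simp add: zeros_def)
        then have "odd n" using False Some unfolding evens_def by auto
        then have "n \<noteq> 0" "n \<noteq> 2 * the (\<delta> v)" by (auto intro: ccontr)
        then show ?thesis by (simp add: relabel_def Transposition.transpose_apply_other)
      next
        case False then show ?thesis unfolding relabel_def by auto
      qed
      then show ?thesis using False Some by (simp add: act_def overwrite_def)
    qed
  qed
qed

text \<open>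
  The relabeling acts only at vertices \<open>v\<close> whose predecessors carry the values of \<open>2\<delta>\<close>. There it fixes
  the value of \<open>2\<delta>\<close> if \<open>v\<close> belongs to \<open>dom \<delta>\<close>, fixes the finitely many odd values that occur in \<open>F\<close>
  otherwise, and makes every other value odd. So the even part of the image is a part of \<open>2\<delta>\<close>, and all
  of \<open>2\<delta>\<close> only if the index extended it before. The odd values of \<open>F\<close> can be fixed because \<open>F\<close> is
  finite; no injection fixes all odd numbers and makes the even ones odd.
\<close>

lemma exists_push_below:
  assumes cl: "down_closed (dom \<delta>)" and F: "finite F" "F \<subseteq> layer \<delta>" "\<And>\<alpha>. \<alpha> \<in> F \<Longrightarrow> down_closed (dom \<alpha>)"
  shows "\<exists>\<sigma>. (\<forall>v c. inj (\<sigma> v c)) \<and> (\<forall>\<alpha>\<in>F. act \<sigma> \<alpha> = \<alpha>) \<and>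
    (\<forall>\<alpha>\<in>beside \<delta>. down_closed (dom \<alpha>) \<longrightarrow> act \<sigma> \<alpha> \<in> below \<delta>)"
proof -
  define Q where "Q v = (if v \<in> dom \<delta> then {2 * the (\<delta> v)} else {n. odd n \<and> (\<exists>\<alpha>\<in>F. \<alpha> v = Some n)})" for v
  have finQ: "finite (Q v)" for v
  proof -
    have "{n. odd n \<and> (\<exists>\<alpha>\<in>F. \<alpha> v = Some n)} \<subseteq> (\<lambda>\<alpha>. the (\<alpha> v)) ` F" by force
    then have "finite {n. odd n \<and> (\<exists>\<alpha>\<in>F. \<alpha> v = Some n)}" using F(1) by (rule finite_subset[OF _ finite_imageI])
    then show ?thesis by (simp add: Q_def)
  qed
  define \<theta> where "\<theta> v = (SOME \<theta>. inj \<theta> \<and> (\<forall>n\<in>Q v. \<theta> n = n) \<and> (\<forall>n. n \<notin> Q v \<longrightarrow> odd (\<theta> n)))" for v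
  have \<theta>: "inj (\<theta> v)" "\<And>n. n \<in> Q v \<Longrightarrow> \<theta> v n = n" "\<And>n. n \<notin> Q v \<Longrightarrow> odd (\<theta> v n)" for v
    using someI_ex[OF exists_injection_to_odds[OF finQ[of v]]] unfolding \<theta>_def[symmetric] by auto
  define \<sigma> where "\<sigma> v c = (if c = dbl \<delta> |` preds v then \<theta> v else id)" for v and c :: "'v \<rightharpoonup> nat"
  have "inj (\<sigma> v c)" for v c using \<theta>(1) by (simp add: \<sigma>_def)
  moreover have "act \<sigma> \<alpha> = \<alpha>" if \<alpha>: "\<alpha> \<in> F" for \<alpha>
  proof
    fix v
    have e: "evens \<alpha> = dom \<delta>" and r: "\<alpha> |` dom \<delta> = dbl \<delta>" using \<alpha> F(2) by (auto simp: layer_def)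
    show "act \<sigma> \<alpha> v = \<alpha> v"
    proof (cases "\<alpha> v")
      case None then show ?thesis by (simp add: act_def)
    next
      case (Some n)
      have "\<sigma> v (\<alpha> |` preds v) n = n"
      proof (cases "\<alpha> |` preds v = dbl \<delta> |` preds v")
        case True
        have "n \<in> Q v"
        proof (cases "v \<in> dom \<delta>")
          case True
          then have "\<alpha> v = dbl \<delta> v" using fun_cong[OF r, of v] by (simp only: restrict_in)
          then show ?thesis using True Some by (auto simp: Q_def dbl_def)
        next
          case False
          have "preds v \<subseteq> dom \<alpha>" using down_closedD[OF F(3)[OF \<alpha>]] Some by blast
          then have "dom (\<alpha> |` preds v) = preds v" by auto
          moreover have "dom (dbl \<delta> |` preds v) = dom \<delta> \<inter> preds v" by simp
          ultimately have "preds v \<subseteq> dom \<delta>" using True by auto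
          then have "odd n" using False e Some evens_memI[of v \<alpha>] by auto
          then show ?thesis using False Some \<alpha> by (auto simp: Q_def)
        qed
        then show ?thesis by (simp add: \<sigma>_def True \<theta>(2))
      qed (simp add: \<sigma>_def)
      then show ?thesis using Some by (simp add: act_def)
    qed
  qed
  moreover have "act \<sigma> \<alpha> \<in> below \<delta>" if \<alpha>: "\<alpha> \<in> beside \<delta>" "down_closed (dom \<alpha>)" for \<alpha>
  proof -
    have key: "v \<in> evens (act \<sigma> \<alpha>) \<longrightarrow> v \<in> dom \<delta> \<and> \<alpha> v = dbl \<delta> v \<and> act \<sigma> \<alpha> v = dbl \<delta> v" for v
    proof (induction v rule: preds_induct)
      case (step v)
      show ?case
      proof
        assume v: "v \<in> evens (act \<sigma> \<alpha>)"
        have "\<alpha> u = dbl \<delta> u" if "u \<in> preds v" for u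
          using step[OF that] down_closedD[OF down_closed_evens v] that by blast
        then have c: "\<alpha> |` preds v = dbl \<delta> |` preds v" by (auto simp: restrict_map_def fun_eq_iff)
        from v obtain k where k: "act \<sigma> \<alpha> v = Some k" "even k" using evens_evenD by blast
        then obtain n where n: "\<alpha> v = Some n" "k = \<theta> v n" by (auto simp: act_def c \<sigma>_def)
        with k \<theta>(3)[of n v] have nQ: "n \<in> Q v" by auto
        with \<theta>(2) n k have kn: "k = n" by auto
        have "v \<in> dom \<delta>" using nQ kn k by (auto simp: Q_def split: if_splits)
        moreover from this nQ have "dbl \<delta> v = Some n" by (auto simp: Q_def dbl_def)
        ultimately show "v \<in> dom \<delta> \<and> \<alpha> v = dbl \<delta> v \<and> act \<sigma> \<alpha> v = dbl \<delta> v" using k n kn by simp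
      qed
    qed
    have "evens (act \<sigma> \<alpha>) \<noteq> dom \<delta>"
    proof
      assume eq: "evens (act \<sigma> \<alpha>) = dom \<delta>"
      have "(\<alpha> |` dom \<delta>) v = dbl \<delta> v" for v
        using key[of v] dbl_restrict_dom[of \<delta>] unfolding eq by (cases "v \<in> dom \<delta>") (auto simp: dbl_def domIff)
      then show False using \<alpha>(1) by (auto simp: beside_def)
    qed
    moreover have "act \<sigma> \<alpha> |` evens (act \<sigma> \<alpha>) = dbl \<delta> |` evens (act \<sigma> \<alpha>)"
      using key by (auto simp: restrict_map_def fun_eq_iff)
    ultimately show ?thesis using key by (auto simp: below_def)
  qed
  ultimately show ?thesis by blast
qed

end

section \<open>The conditional law of a layer\<close>

text \<open>
  The arrays for the different closed sets are merged into one family, indexed by the partial maps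
  whose domain is one of these sets; the domain tells the array.
\<close>

locale exchangeable_array = dag G E + prob_space M
  for G :: "'v set" and E and M :: "'w measure" +
  fixes S :: "'x measure" and I :: "('v \<rightharpoonup> nat) set" and x :: "('v \<rightharpoonup> nat) \<Rightarrow> 'w \<Rightarrow> 'x"
  assumes codable_S: "codable S"
    and index_dom: "\<And>\<alpha>. \<alpha> \<in> I \<Longrightarrow> dom \<alpha> \<subseteq> G \<and> down_closed (dom \<alpha>)"
    and index_dom_cong: "\<And>\<alpha> \<beta>. \<alpha> \<in> I \<Longrightarrow> dom \<beta> = dom \<alpha> \<Longrightarrow> \<beta> \<in> I"
    and rv[measurable]: "\<And>\<alpha>. \<alpha> \<in> I \<Longrightarrow> x \<alpha> \<in> M \<rightarrow>\<^sub>M S"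
    and exch: "\<And>\<sigma>. (\<And>v c. bij (\<sigma> v c)) \<Longrightarrow>
      distr M (PiM I (\<lambda>_. S)) (\<lambda>\<omega>. \<lambda>\<alpha>\<in>I. x (act \<sigma> \<alpha>) \<omega>) = distr M (PiM I (\<lambda>_. S)) (\<lambda>\<omega>. \<lambda>\<alpha>\<in>I. x \<alpha> \<omega>)"
begin

lemma act_index: "\<alpha> \<in> I \<Longrightarrow> act \<sigma> \<alpha> \<in> I"
  by (rule index_dom_cong) auto

lemma measurable_family: "J \<subseteq> I \<Longrightarrow> (\<lambda>\<omega>. \<lambda>\<alpha>\<in>J. x \<alpha> \<omega>) \<in> M \<rightarrow>\<^sub>M PiM J (\<lambda>_. S)"
  by (intro measurable_restrict rv) auto

lemma measurable_act_family: "(\<lambda>\<omega>. \<lambda>\<alpha>\<in>I. x (act \<sigma> \<alpha>) \<omega>) \<in> M \<rightarrow>\<^sub>M PiM I (\<lambda>_. S)"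
  by (intro measurable_restrict rv act_index)

text \<open>
  A cylinder event involves finitely many indices, and on these an injective relabeling agrees with an
  automorphism.
\<close>

lemma law_act:
  assumes inj: "\<And>v c. inj (\<sigma> v c)"
  shows "distr M (PiM I (\<lambda>_. S)) (\<lambda>\<omega>. \<lambda>\<alpha>\<in>I. x (act \<sigma> \<alpha>) \<omega>) = distr M (PiM I (\<lambda>_. S)) (\<lambda>\<omega>. \<lambda>\<alpha>\<in>I. x \<alpha> \<omega>)"
proof (rule distr_PiM_eqI[OF prob_space_axioms])
  fix J A assume J: "finite J" "J \<subseteq> I" and A: "\<And>j. j \<in> J \<Longrightarrow> A j \<in> sets S"
  have "\<exists>p. bij p \<and> (\<forall>a\<in>(\<lambda>\<alpha>. the (\<alpha> v)) ` J. p a = \<sigma> v c a)" for v c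
    using inj J by (intro extend_injection_to_bij) auto
  then obtain \<tau> where bij: "\<And>v c. bij (\<tau> v c)" and eq: "\<And>v c \<alpha>. \<alpha> \<in> J \<Longrightarrow> \<tau> v c (the (\<alpha> v)) = \<sigma> v c (the (\<alpha> v))"
    by simp metis
  have act: "act \<tau> \<alpha> = act \<sigma> \<alpha>" if "\<alpha> \<in> J" for \<alpha>
  proof
    fix v show "act \<tau> \<alpha> v = act \<sigma> \<alpha> v"
      using eq[OF that, of v "\<alpha> |` preds v"] by (cases "\<alpha> v") (auto simp: act_def)
  qed
  let ?C = "{f\<in>space (PiM I (\<lambda>_. S)). \<forall>j\<in>J. f j \<in> A j}"
  have C: "?C \<in> sets (PiM I (\<lambda>_. S))" using J A by (intro sets.sets_Collect_finite_All) auto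
  have "{\<omega>\<in>space M. \<forall>j\<in>J. x (act \<sigma> j) \<omega> \<in> A j} = (\<lambda>\<omega>. \<lambda>\<alpha>\<in>I. x (act \<tau> \<alpha>) \<omega>) -` ?C \<inter> space M"
    using J measurable_space[OF measurable_act_family[of \<tau>]] by (auto simp: act subset_eq)
  also have "emeasure M \<dots> = emeasure M ((\<lambda>\<omega>. \<lambda>\<alpha>\<in>I. x \<alpha> \<omega>) -` ?C \<inter> space M)"
    by (rule emeasure_vimage_eq_of_distr_eq[OF exch[of \<tau>, OF bij] measurable_act_family measurable_family[OF subset_refl] C])
  also have "(\<lambda>\<omega>. \<lambda>\<alpha>\<in>I. x \<alpha> \<omega>) -` ?C \<inter> space M = {\<omega>\<in>space M. \<forall>j\<in>J. x j \<omega> \<in> A j}"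
    using J measurable_space[OF measurable_family[OF subset_refl]] by (auto simp: subset_eq)
  finally show "emeasure M {\<omega>\<in>space M. \<forall>j\<in>J. x (act \<sigma> j) \<omega> \<in> A j} = emeasure M {\<omega>\<in>space M. \<forall>j\<in>J. x j \<omega> \<in> A j}" .
qed (auto intro: rv act_index)

lemma event_act:
  assumes inj: "\<And>v c. inj (\<sigma> v c)" and F: "finite F" "F \<subseteq> I" "\<And>j. j \<in> F \<Longrightarrow> A j \<in> sets S"
    and J: "J \<subseteq> I" and B: "B \<in> sets (PiM J (\<lambda>_. S))"
  shows "emeasure M {\<omega>\<in>space M. (\<forall>j\<in>F. x (act \<sigma> j) \<omega> \<in> A j) \<and> (\<lambda>\<alpha>\<in>J. x (act \<sigma> \<alpha>) \<omega>) \<in> B} =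
    emeasure M {\<omega>\<in>space M. (\<forall>j\<in>F. x j \<omega> \<in> A j) \<and> (\<lambda>\<alpha>\<in>J. x \<alpha> \<omega>) \<in> B}"
proof -
  let ?C = "{f\<in>space (PiM I (\<lambda>_. S)). (\<forall>j\<in>F. f j \<in> A j) \<and> restrict f J \<in> B}"
  have "{f\<in>space (PiM I (\<lambda>_. S)). \<forall>j\<in>F. f j \<in> A j} \<in> sets (PiM I (\<lambda>_. S))"
    using F by (intro sets.sets_Collect_finite_All) auto
  moreover have "{f\<in>space (PiM I (\<lambda>_. S)). restrict f J \<in> B} \<in> sets (PiM I (\<lambda>_. S))"
    using measurable_sets[OF measurable_restrict_subset[OF J] B] by (simp add: vimage_def Int_def conj_commute)
  ultimately have C: "?C \<in> sets (PiM I (\<lambda>_. S))" by (intro sets.sets_Collect_conj)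
  have IJ: "I \<inter> J = J" using J by auto
  have "{\<omega>\<in>space M. (\<forall>j\<in>F. x (act \<sigma> j) \<omega> \<in> A j) \<and> (\<lambda>\<alpha>\<in>J. x (act \<sigma> \<alpha>) \<omega>) \<in> B} =
     (\<lambda>\<omega>. \<lambda>\<alpha>\<in>I. x (act \<sigma> \<alpha>) \<omega>) -` ?C \<inter> space M"
    using F(2) measurable_space[OF measurable_act_family[of \<sigma>]] by (auto simp: IJ subset_eq)
  also have "emeasure M \<dots> = emeasure M ((\<lambda>\<omega>. \<lambda>\<alpha>\<in>I. x \<alpha> \<omega>) -` ?C \<inter> space M)"
    by (rule emeasure_vimage_eq_of_distr_eq[OF law_act[of \<sigma>, OF inj] measurable_act_family measurable_family[OF subset_refl] C])
  also have "(\<lambda>\<omega>. \<lambda>\<alpha>\<in>I. x \<alpha> \<omega>) -` ?C \<inter> space M = {\<omega>\<in>space M. (\<forall>j\<in>F. x j \<omega> \<in> A j) \<and> (\<lambda>\<alpha>\<in>J. x \<alpha> \<omega>) \<in> B}"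
    using F(2) measurable_space[OF measurable_family[OF subset_refl]] by (auto simp: IJ subset_eq)
  finally show ?thesis .
qed

lemma countable_I: "countable I"
proof -
  define enc where "enc \<alpha> = (\<lambda>v\<in>G. case \<alpha> v of None \<Rightarrow> 0 | Some n \<Rightarrow> Suc n)" for \<alpha> :: "'v \<rightharpoonup> nat"
  have "inj_on enc I"
  proof (rule inj_onI)
    fix \<alpha> \<beta> assume \<alpha>: "\<alpha> \<in> I" and \<beta>: "\<beta> \<in> I" and eq: "enc \<alpha> = enc \<beta>"
    show "\<alpha> = \<beta>"
    proof
      fix v show "\<alpha> v = \<beta> v"
        using fun_cong[OF eq, of v] index_dom[OF \<alpha>] index_dom[OF \<beta>]
        by (cases "v \<in> G"; cases "\<alpha> v"; cases "\<beta> v") (auto simp: enc_def)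
    qed
  qed
  moreover have "enc ` I \<subseteq> PiE G (\<lambda>_. UNIV)" by (auto simp: enc_def)
  moreover have "countable (PiE G (\<lambda>_. UNIV :: nat set))" using finite_G by (intro countable_PiE) auto
  ultimately show ?thesis by (meson countable_image_inj_on countable_subset)
qed

definition layer0 :: "'v set \<Rightarrow> ('v \<rightharpoonup> nat) set" where "layer0 D = layer (zeros D) \<inter> I"
definition below0 :: "'v set \<Rightarrow> ('v \<rightharpoonup> nat) set" where "below0 D = below (zeros D) \<inter> I"

text \<open>
  The function \<open>g\<close> produces the layer of the zero index on \<open>D\<close> from the layers of its proper
  restrictions and a uniform variable. One such function per \<open>D\<close> is chosen.
\<close>

definition is_kernel :: "'v set \<Rightarrow> ((('v \<rightharpoonup> nat) \<Rightarrow> 'x) \<times> real \<Rightarrow> ('v \<rightharpoonup> nat) \<Rightarrow> 'x) \<Rightarrow> bool" where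
  "is_kernel D g \<longleftrightarrow> g \<in> PiM (below0 D) (\<lambda>_. S) \<Otimes>\<^sub>M uniform01 \<rightarrow>\<^sub>M PiM (layer0 D) (\<lambda>_. S) \<and>
    (\<forall>B\<in>sets (PiM (below0 D) (\<lambda>_. S)). \<forall>A\<in>sets (PiM (layer0 D) (\<lambda>_. S)).
      emeasure M ((\<lambda>\<omega>. \<lambda>l\<in>below0 D. x l \<omega>) -` B \<inter> (\<lambda>\<omega>. \<lambda>k\<in>layer0 D. x k \<omega>) -` A \<inter> space M) =
      (\<integral>\<^sup>+v\<in>B. emeasure uniform01 {u\<in>{0..1}. g (v, u) \<in> A} \<partial>distr M (PiM (below0 D) (\<lambda>_. S)) (\<lambda>\<omega>. \<lambda>l\<in>below0 D. x l \<omega>)))"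

definition kernel :: "'v set \<Rightarrow> (('v \<rightharpoonup> nat) \<Rightarrow> 'x) \<times> real \<Rightarrow> ('v \<rightharpoonup> nat) \<Rightarrow> 'x" where
  "kernel D = (SOME g. is_kernel D g)"

lemma kernel: "is_kernel D (kernel D)"
proof -
  have "codable (PiM (layer0 D) (\<lambda>_. S))"
    by (rule codable_PiM[OF codable_S countable_subset[OF _ countable_I]]) (simp add: layer0_def)
  from coding[OF prob_space_axioms measurable_family[of "below0 D"] measurable_family[of "layer0 D"] this]
  have "\<exists>g. is_kernel D g" unfolding is_kernel_def by (auto simp: below0_def layer0_def)
  then show ?thesis unfolding kernel_def by (rule someI_ex)
qed

lemma measurable_kernel[measurable]: "kernel D \<in> PiM (below0 D) (\<lambda>_. S) \<Otimes>\<^sub>M uniform01 \<rightarrow>\<^sub>M PiM (layer0 D) (\<lambda>_. S)"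
  using kernel[of D] by (simp add: is_kernel_def)

lemmas kernel_law = kernel[unfolded is_kernel_def, THEN conjunct2, rule_format]

lemma canon_index: "\<alpha> \<in> I \<Longrightarrow> canon \<alpha> \<in> I"
  by (rule index_dom_cong) (auto simp: dom_canon)

lemma canon_layer0: "\<alpha> \<in> layer \<delta> \<inter> I \<Longrightarrow> canon \<alpha> \<in> layer0 (dom \<delta>)"
  using canon_layer(1) canon_index by (auto simp: layer0_def)

lemma canon_below0: "\<alpha> \<in> below \<delta> \<inter> I \<Longrightarrow> canon \<alpha> \<in> below0 (dom \<delta>)"
  using canon_below(1) canon_index by (auto simp: below0_def)

lemma overwrite_index: "\<gamma> \<in> below0 (dom \<delta>) \<Longrightarrow> overwrite \<gamma> \<delta> \<in> below \<delta> \<inter> I"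
  using overwrite_in_below index_dom_cong by (auto simp: below0_def)

text \<open>
  The conditional probability, according to the kernel, that the layer of \<open>\<delta>\<close> lies in the cylinder
  given by \<open>F\<close> and \<open>A\<close>. The kernel of the zero index is used for \<open>\<delta>\<close> by means of \<open>canon\<close>.
\<close>

definition cell_prob :: "('v \<rightharpoonup> nat) \<Rightarrow> ('v \<rightharpoonup> nat) set \<Rightarrow> (('v \<rightharpoonup> nat) \<Rightarrow> 'x set) \<Rightarrow> (('v \<rightharpoonup> nat) \<Rightarrow> 'x) \<Rightarrow> ennreal" where
  "cell_prob \<delta> F A v = emeasure uniform01 {u\<in>{0..1}. \<forall>j\<in>F. kernel (dom \<delta>) (v, u) (canon j) \<in> A j}"

lemma cell_event:
  assumes F: "finite F" "F \<subseteq> layer \<delta> \<inter> I" and A: "\<And>j. j \<in> F \<Longrightarrow> A j \<in> sets S"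
  shows "{p\<in>space (PiM (below0 (dom \<delta>)) (\<lambda>_. S) \<Otimes>\<^sub>M uniform01). \<forall>j\<in>F. kernel (dom \<delta>) p (canon j) \<in> A j}
    \<in> sets (PiM (below0 (dom \<delta>)) (\<lambda>_. S) \<Otimes>\<^sub>M uniform01)"
proof (intro sets.sets_Collect_finite_All F)
  fix j assume j: "j \<in> F"
  then have "canon j \<in> layer0 (dom \<delta>)" using canon_layer0 F by auto
  then have "(\<lambda>p. kernel (dom \<delta>) p (canon j)) \<in> PiM (below0 (dom \<delta>)) (\<lambda>_. S) \<Otimes>\<^sub>M uniform01 \<rightarrow>\<^sub>M S"
    by (intro measurable_compose[OF measurable_kernel] measurable_component_singleton)
  from measurable_sets[OF this A[OF j]]
  show "{p\<in>space (PiM (below0 (dom \<delta>)) (\<lambda>_. S) \<Otimes>\<^sub>M uniform01). kernel (dom \<delta>) p (canon j) \<in> A j}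
    \<in> sets (PiM (below0 (dom \<delta>)) (\<lambda>_. S) \<Otimes>\<^sub>M uniform01)" by (simp add: vimage_def Int_def conj_commute)
qed

lemma measurable_cell_prob:
  assumes "finite F" "F \<subseteq> layer \<delta> \<inter> I" "\<And>j. j \<in> F \<Longrightarrow> A j \<in> sets S"
  shows "cell_prob \<delta> F A \<in> borel_measurable (PiM (below0 (dom \<delta>)) (\<lambda>_. S))"
proof -
  interpret U: prob_space uniform01 by (rule prob_space_uniform01)
  let ?P = "PiM (below0 (dom \<delta>)) (\<lambda>_. S)"
  let ?Q = "{p\<in>space (?P \<Otimes>\<^sub>M uniform01). \<forall>j\<in>F. kernel (dom \<delta>) p (canon j) \<in> A j}"
  have "(\<lambda>v. emeasure uniform01 (Pair v -` ?Q)) \<in> borel_measurable ?P"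
    by (rule U.measurable_emeasure_Pair[OF cell_event[OF assms]])
  moreover have "emeasure uniform01 (Pair v -` ?Q) = cell_prob \<delta> F A v" if "v \<in> space ?P" for v
    unfolding cell_prob_def using that by (intro arg_cong[where f="emeasure uniform01"]) (auto simp: space_pair_measure)
  ultimately show ?thesis by (subst measurable_cong[where g="\<lambda>v. emeasure uniform01 (Pair v -` ?Q)"]) auto
qed

text \<open>
  Given all entries that do not extend \<open>2\<delta>\<close>, the conditional law of the layer of \<open>\<delta>\<close> depends only on
  the layers of the proper restrictions of \<open>\<delta>\<close>, by pushing the former entries into the latter layers.
  The dependence is given by the kernel: for \<open>\<delta> = 0\<close> by its choice, and for other \<open>\<delta>\<close> because
  relabeling carries \<open>0\<close> to \<open>\<delta>\<close>.
\<close>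

lemma conditional_law_of_layer:
  assumes cl: "down_closed (dom \<delta>)" and F: "finite F" "F \<subseteq> layer \<delta> \<inter> I" and A: "\<And>j. j \<in> F \<Longrightarrow> A j \<in> sets S"
    and B: "B \<in> sets (PiM (beside \<delta> \<inter> I) (\<lambda>_. S))"
  shows "emeasure M {\<omega>\<in>space M. (\<forall>j\<in>F. x j \<omega> \<in> A j) \<and> (\<lambda>\<alpha>\<in>beside \<delta> \<inter> I. x \<alpha> \<omega>) \<in> B} =
    (\<integral>\<^sup>+\<omega>. cell_prob \<delta> F A (\<lambda>l\<in>below0 (dom \<delta>). x (overwrite l \<delta>) \<omega>) * indicator B (\<lambda>\<alpha>\<in>beside \<delta> \<inter> I. x \<alpha> \<omega>) \<partial>M)"
proof -
  define H where "H = beside \<delta> \<inter> I"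
  define L where "L = below0 (dom \<delta>)"
  define K where "K = layer0 (dom \<delta>)"
  have sub: "H \<subseteq> I" "L \<subseteq> I" "K \<subseteq> I" by (auto simp: H_def L_def K_def below0_def layer0_def)
  define Z where "Z \<omega> = (\<lambda>\<alpha>\<in>H. x \<alpha> \<omega>)" for \<omega>
  define r where "r q = (\<lambda>l\<in>L. q (overwrite l \<delta>))" for q :: "('v \<rightharpoonup> nat) \<Rightarrow> 'x"
  have Z: "Z \<in> M \<rightarrow>\<^sub>M PiM H (\<lambda>_. S)" unfolding Z_def using sub by (intro measurable_family)
  have ovH: "overwrite l \<delta> \<in> H" if "l \<in> L" for l
    using overwrite_index[of l \<delta>] below_subset_beside[OF cl] that by (auto simp: L_def H_def)
  have r: "r \<in> PiM H (\<lambda>_. S) \<rightarrow>\<^sub>M PiM L (\<lambda>_. S)"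
    unfolding r_def by (intro measurable_restrict measurable_component_singleton ovH)
  have rZ: "r (Z \<omega>) = (\<lambda>l\<in>L. x (overwrite l \<delta>) \<omega>)" for \<omega>
    unfolding r_def Z_def by (auto simp: ovH)
  have FI: "F \<subseteq> I" and Fl: "F \<subseteq> layer \<delta>" using F by auto
  define AF where "AF = {\<omega>\<in>space M. \<forall>j\<in>F. x j \<omega> \<in> A j}"
  have AF: "AF \<in> sets M" unfolding AF_def
    using FI A by (intro sets.sets_Collect_finite_All F) (auto intro!: sets_Collect_preimage[OF rv])
  obtain \<sigma> where inj: "\<And>v c. inj (\<sigma> v c)" and fixF: "\<And>\<alpha>. \<alpha> \<in> F \<Longrightarrow> act \<sigma> \<alpha> = \<alpha>"
    and push: "\<And>\<alpha>. \<alpha> \<in> H \<Longrightarrow> act \<sigma> \<alpha> \<in> below \<delta>"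
    using exists_push_below[OF cl F(1) Fl] FI index_dom unfolding H_def by blast
  define s where "s v = (\<lambda>\<alpha>\<in>H. v (canon (act \<sigma> \<alpha>)))" for v :: "('v \<rightharpoonup> nat) \<Rightarrow> 'x"
  have cL: "canon (act \<sigma> \<alpha>) \<in> L" if "\<alpha> \<in> H" for \<alpha>
    unfolding L_def using push[OF that] that by (intro canon_below0) (auto simp: H_def act_index)
  have s: "s \<in> PiM L (\<lambda>_. S) \<rightarrow>\<^sub>M PiM H (\<lambda>_. S)"
    unfolding s_def by (intro measurable_restrict measurable_component_singleton cL)
  have srZ: "s (r (Z \<omega>)) = (\<lambda>\<alpha>\<in>H. x (act \<sigma> \<alpha>) \<omega>)" for \<omega>
    unfolding rZ s_def by (intro restrict_ext) (simp add: cL canon_below(2)[OF push])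
  \<comment> \<open>The relabeling \<open>\<sigma>\<close> fixes \<open>F\<close> and replaces \<open>Z\<close> by \<open>s (r (Z \<omega>))\<close>.\<close>
  have ev: "emeasure M {\<omega>\<in>space M. (\<forall>j\<in>F'. x j \<omega> \<in> A j) \<and> Z \<omega> \<in> C} = emeasure M {\<omega>\<in>space M. (\<forall>j\<in>F'. x j \<omega> \<in> A j) \<and> s (r (Z \<omega>)) \<in> C}"
    if F': "F' \<subseteq> F" and C: "C \<in> sets (PiM H (\<lambda>_. S))" for F' C
  proof -
    have "(\<forall>j\<in>F'. x (act \<sigma> j) \<omega> \<in> A j) = (\<forall>j\<in>F'. x j \<omega> \<in> A j)" for \<omega> using F' fixF by (metis subsetD)
    moreover have "F' \<subseteq> I" "finite F'" "\<And>j. j \<in> F' \<Longrightarrow> A j \<in> sets S" using F' FI F(1) A finite_subset by auto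
    ultimately show ?thesis unfolding srZ unfolding Z_def
      using event_act[of \<sigma> F' A H C, OF inj] sub(1) C by simp
  qed
  have "\<exists>k\<in>borel_measurable (PiM L (\<lambda>_. S)). \<forall>B\<in>sets (PiM H (\<lambda>_. S)).
     emeasure M (AF \<inter> Z -` B \<inter> space M) = (\<integral>\<^sup>+\<omega>\<in>Z -` B. ennreal (k (r (Z \<omega>))) \<partial>M)"
  proof (rule conditional_independence_of_law_eq[OF prob_space_axioms AF Z r s])
    fix C assume C: "C \<in> sets (PiM H (\<lambda>_. S))"
    have "AF \<inter> Z -` C \<inter> space M = {\<omega>\<in>space M. (\<forall>j\<in>F. x j \<omega> \<in> A j) \<and> Z \<omega> \<in> C}"
      "AF \<inter> (\<lambda>\<omega>. s (r (Z \<omega>))) -` C \<inter> space M = {\<omega>\<in>space M. (\<forall>j\<in>F. x j \<omega> \<in> A j) \<and> s (r (Z \<omega>)) \<in> C}"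
      by (auto simp: AF_def)
    then show "emeasure M (AF \<inter> Z -` C \<inter> space M) = emeasure M (AF \<inter> (\<lambda>\<omega>. s (r (Z \<omega>))) -` C \<inter> space M)"
      using ev[OF subset_refl C] by simp
  next
    have m: "(\<lambda>\<omega>. s (r (Z \<omega>))) \<in> M \<rightarrow>\<^sub>M PiM H (\<lambda>_. S)"
      by (rule measurable_compose[OF measurable_compose[OF Z r] s])
    show "distr M (PiM H (\<lambda>_. S)) Z = distr M (PiM H (\<lambda>_. S)) (\<lambda>\<omega>. s (r (Z \<omega>)))"
    proof (rule measure_eqI)
      fix C assume "C \<in> sets (distr M (PiM H (\<lambda>_. S)) Z)"
      then have C: "C \<in> sets (PiM H (\<lambda>_. S))" by simp
      show "emeasure (distr M (PiM H (\<lambda>_. S)) Z) C = emeasure (distr M (PiM H (\<lambda>_. S)) (\<lambda>\<omega>. s (r (Z \<omega>)))) C"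
        using ev[of "{}", OF _ C] by (simp add: emeasure_distr[OF Z C] emeasure_distr[OF m C] vimage_def Int_def conj_commute)
    qed simp
  qed
  then obtain k where k: "k \<in> borel_measurable (PiM L (\<lambda>_. S))"
    and kC: "\<And>C. C \<in> sets (PiM H (\<lambda>_. S)) \<Longrightarrow>
      emeasure M (AF \<inter> Z -` C \<inter> space M) = (\<integral>\<^sup>+\<omega>\<in>Z -` C. ennreal (k (r (Z \<omega>))) \<partial>M)" by blast
  define V where "V = (\<lambda>\<omega>. r (Z \<omega>))"
  have V: "V \<in> M \<rightarrow>\<^sub>M PiM L (\<lambda>_. S)" unfolding V_def by (rule measurable_compose[OF Z r])
  define V0 where "V0 = (\<lambda>\<omega>. \<lambda>l\<in>L. x l \<omega>)"
  define W0 where "W0 = (\<lambda>\<omega>. \<lambda>l\<in>K. x l \<omega>)"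
  have V0: "V0 \<in> M \<rightarrow>\<^sub>M PiM L (\<lambda>_. S)" unfolding V0_def by (intro measurable_family sub)
  \<comment> \<open>Relabeling from the zero index to \<open>\<delta>\<close>.\<close>
  have re: "emeasure M {\<omega>\<in>space M. (\<forall>j\<in>F'. x j \<omega> \<in> A j) \<and> V \<omega> \<in> C} = emeasure M {\<omega>\<in>space M. (\<forall>j\<in>F'. x (canon j) \<omega> \<in> A j) \<and> V0 \<omega> \<in> C}"
    if F': "F' \<subseteq> F" and C: "C \<in> sets (PiM L (\<lambda>_. S))" for F' C
  proof -
    have act_eq: "act (relabel \<delta>) \<gamma> = overwrite \<gamma> \<delta>" if "\<gamma> \<in> L \<union> K" for \<gamma>
    proof (rule act_relabel)
      show "down_closed (dom \<gamma>)" using that sub index_dom by auto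
      show "evens \<gamma> \<subseteq> dom \<delta>"
        using that below_zerosD(1)[of \<gamma> "dom \<delta>"] by (auto simp: L_def K_def below0_def layer0_def layer_def)
      show "\<gamma> |` evens \<gamma> = zeros (evens \<gamma>)"
        using that below_zerosD(3)[of \<gamma> "dom \<delta>"] by (auto simp: L_def K_def below0_def layer0_def layer_def)
    qed
    have cK: "canon j \<in> K" "overwrite (canon j) \<delta> = j" if "j \<in> F" for j
      using canon_layer0[of j \<delta>] canon_layer(2)[of j \<delta>] F(2) that by (auto simp: K_def)
    have injc: "inj_on canon F" by (rule inj_on_inverseI[where g="\<lambda>\<gamma>. overwrite \<gamma> \<delta>"]) (rule cK(2))
    have finF': "finite F'" using F' F(1) finite_subset by auto
    define A' where "A' i = A (overwrite i \<delta>)" for i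
    have e: "emeasure M {\<omega>\<in>space M. (\<forall>j\<in>canon ` F'. x (act (relabel \<delta>) j) \<omega> \<in> A' j) \<and> (\<lambda>\<alpha>\<in>L. x (act (relabel \<delta>) \<alpha>) \<omega>) \<in> C} =
      emeasure M {\<omega>\<in>space M. (\<forall>j\<in>canon ` F'. x j \<omega> \<in> A' j) \<and> (\<lambda>\<alpha>\<in>L. x \<alpha> \<omega>) \<in> C}"
    proof (rule event_act)
      show "inj (relabel \<delta> v c)" for v c using bij_relabel by (rule bij_is_inj)
      show "canon ` F' \<subseteq> I" using cK(1) sub F' by blast
      show "A' j \<in> sets S" if "j \<in> canon ` F'" for j
      proof -
        from that obtain i where "i \<in> F" "j = canon i" using F' by auto
        then show ?thesis using A[of i] cK(2)[of i] by (simp add: A'_def)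
      qed
    qed (use finF' sub C in auto)
    have "(\<forall>j\<in>canon ` F'. x (act (relabel \<delta>) j) \<omega> \<in> A' j) = (\<forall>j\<in>F'. x j \<omega> \<in> A j)" for \<omega>
      unfolding ball_simps A'_def using F' cK by (auto simp: act_eq subset_eq)
    moreover have "(\<forall>j\<in>canon ` F'. x j \<omega> \<in> A' j) = (\<forall>j\<in>F'. x (canon j) \<omega> \<in> A j)" for \<omega>
      unfolding ball_simps A'_def using F' cK by (auto simp: subset_eq)
    moreover have "(\<lambda>\<alpha>\<in>L. x (act (relabel \<delta>) \<alpha>) \<omega>) = V \<omega>" for \<omega>
      unfolding V_def rZ by (auto simp: act_eq)
    ultimately show ?thesis using e unfolding V0_def by simp
  qed
  have law: "distr M (PiM L (\<lambda>_. S)) V = distr M (PiM L (\<lambda>_. S)) V0"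
  proof (rule measure_eqI)
    fix C assume "C \<in> sets (distr M (PiM L (\<lambda>_. S)) V)"
    then have C: "C \<in> sets (PiM L (\<lambda>_. S))" by simp
    show "emeasure (distr M (PiM L (\<lambda>_. S)) V) C = emeasure (distr M (PiM L (\<lambda>_. S)) V0) C"
      using re[of "{}", OF _ C] by (simp add: emeasure_distr[OF V C] emeasure_distr[OF V0 C] vimage_def Int_def conj_commute)
  qed simp
  have cp: "cell_prob \<delta> F A \<in> borel_measurable (PiM L (\<lambda>_. S))"
    unfolding L_def by (rule measurable_cell_prob[OF F A])
  interpret VL: prob_space "distr M (PiM L (\<lambda>_. S)) V" using V by (rule prob_space_distr)
  \<comment> \<open>Both sides are densities of the same measure, because the joint law of the layer of \<open>\<delta>\<close> and the layers below is that for the zero index, where the kernel codes it.\<close>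
  have "AE v in distr M (PiM L (\<lambda>_. S)) V. ennreal (k v) = cell_prob \<delta> F A v"
  proof (rule VL.density_unique2)
    show "(\<lambda>v. ennreal (k v)) \<in> borel_measurable (distr M (PiM L (\<lambda>_. S)) V)" using k by simp
    show "cell_prob \<delta> F A \<in> borel_measurable (distr M (PiM L (\<lambda>_. S)) V)" using cp by simp
    fix C assume "C \<in> sets (distr M (PiM L (\<lambda>_. S)) V)"
    then have C: "C \<in> sets (PiM L (\<lambda>_. S))" by simp
    let ?A = "{w\<in>space (PiM K (\<lambda>_. S)). \<forall>j\<in>F. w (canon j) \<in> A j}"
    have cK: "canon j \<in> K" if "j \<in> F" for j using canon_layer0[of j \<delta>] F(2) that by (auto simp: K_def)
    have mA: "?A \<in> sets (PiM K (\<lambda>_. S))"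
      by (intro sets.sets_Collect_finite_All F) (auto intro!: sets_Collect_preimage[OF measurable_component_singleton] cK A)
    have rC: "r -` C \<inter> space (PiM H (\<lambda>_. S)) \<in> sets (PiM H (\<lambda>_. S))" using r C by (rule measurable_sets)
    have "(\<integral>\<^sup>+v\<in>C. ennreal (k v) \<partial>distr M (PiM L (\<lambda>_. S)) V) = (\<integral>\<^sup>+\<omega>. ennreal (k (V \<omega>)) * indicator C (V \<omega>) \<partial>M)"
      using k C by (subst nn_integral_distr[OF V]) auto
    also have "\<dots> = (\<integral>\<^sup>+\<omega>\<in>Z -` (r -` C \<inter> space (PiM H (\<lambda>_. S))). ennreal (k (r (Z \<omega>))) \<partial>M)"
      using measurable_space[OF Z] by (intro nn_integral_cong) (auto simp: V_def indicator_def)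
    also have "\<dots> = emeasure M (AF \<inter> Z -` (r -` C \<inter> space (PiM H (\<lambda>_. S))) \<inter> space M)"
      by (rule kC[OF rC, symmetric])
    also have "\<dots> = emeasure M {\<omega>\<in>space M. (\<forall>j\<in>F. x j \<omega> \<in> A j) \<and> V \<omega> \<in> C}"
      using measurable_space[OF Z] by (intro arg_cong[where f="emeasure M"]) (auto simp: AF_def V_def)
    also have "\<dots> = emeasure M {\<omega>\<in>space M. (\<forall>j\<in>F. x (canon j) \<omega> \<in> A j) \<and> V0 \<omega> \<in> C}"
      by (rule re[OF subset_refl C])
    also have "\<dots> = emeasure M (V0 -` C \<inter> W0 -` ?A \<inter> space M)"
      using measurable_space[OF measurable_family[OF sub(3)]]
      by (intro arg_cong[where f="emeasure M"]) (auto simp: W0_def cK)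
    also have "\<dots> = (\<integral>\<^sup>+v\<in>C. emeasure uniform01 {u\<in>{0..1}. kernel (dom \<delta>) (v, u) \<in> ?A} \<partial>distr M (PiM L (\<lambda>_. S)) V0)"
      unfolding V0_def W0_def L_def K_def
      by (rule kernel_law) (use C mA in \<open>auto simp: L_def K_def\<close>)
    also have "\<dots> = (\<integral>\<^sup>+v\<in>C. cell_prob \<delta> F A v \<partial>distr M (PiM L (\<lambda>_. S)) V)"
      unfolding law
    proof (rule nn_integral_cong)
      fix v assume "v \<in> space (distr M (PiM L (\<lambda>_. S)) V0)"
      then have "kernel (dom \<delta>) (v, u) \<in> space (PiM K (\<lambda>_. S))" if "u \<in> {0..1}" for u
        using measurable_space[OF measurable_kernel[of "dom \<delta>"], of "(v, u)"] that by (simp add: K_def L_def space_pair_measure)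
      then have "{u\<in>{0..1}. kernel (dom \<delta>) (v, u) \<in> ?A} = {u\<in>{0..1}. \<forall>j\<in>F. kernel (dom \<delta>) (v, u) (canon j) \<in> A j}"
        by auto
      then show "emeasure uniform01 {u\<in>{0..1}. kernel (dom \<delta>) (v, u) \<in> ?A} * indicator C v = cell_prob \<delta> F A v * indicator C v"
        by (simp add: cell_prob_def)
    qed
    finally show "(\<integral>\<^sup>+v\<in>C. ennreal (k v) \<partial>distr M (PiM L (\<lambda>_. S)) V) = (\<integral>\<^sup>+v\<in>C. cell_prob \<delta> F A v \<partial>distr M (PiM L (\<lambda>_. S)) V)" .
  qed
  then have ae: "AE \<omega> in M. ennreal (k (V \<omega>)) = cell_prob \<delta> F A (V \<omega>)"
    using V by (rule AE_distrD[rotated])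
  have B': "B \<in> sets (PiM H (\<lambda>_. S))" using B by (simp add: H_def)
  have "{\<omega>\<in>space M. (\<forall>j\<in>F. x j \<omega> \<in> A j) \<and> Z \<omega> \<in> B} = AF \<inter> Z -` B \<inter> space M" by (auto simp: AF_def)
  also have "emeasure M \<dots> = (\<integral>\<^sup>+\<omega>\<in>Z -` B. ennreal (k (r (Z \<omega>))) \<partial>M)" by (rule kC[OF B'])
  also have "\<dots> = (\<integral>\<^sup>+\<omega>. cell_prob \<delta> F A (V \<omega>) * indicator B (Z \<omega>) \<partial>M)"
    by (rule nn_integral_cong_AE, rule AE_mp[OF ae]) (auto intro!: AE_I2 simp: V_def indicator_def)
  finally show ?thesis unfolding V_def rZ unfolding Z_def L_def H_def .
qed

section \<open>Synthesis of the array from uniform variables\<close>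

text \<open>
  The entry at the representative index \<open>\<gamma>\<close> when the uniform variable attached to the closed set \<open>D\<close> has
  the value \<open>u D\<close>. The recursion is on the size of \<open>evens \<gamma>\<close>.
\<close>

definition synth :: "('v set \<Rightarrow> real) \<Rightarrow> ('v \<rightharpoonup> nat) \<Rightarrow> 'x" where
  "synth u = wfrec {(\<beta>, \<gamma>). evens \<beta> \<subset> evens \<gamma> \<and> finite (evens \<gamma>)}
    (\<lambda>Y \<gamma>. kernel (evens \<gamma>) (\<lambda>l\<in>below0 (evens \<gamma>). Y l, u (evens \<gamma>)) \<gamma>)"

lemma synth_unfold:
  assumes "finite (evens \<gamma>)"
  shows "synth u \<gamma> = kernel (evens \<gamma>) (\<lambda>l\<in>below0 (evens \<gamma>). synth u l, u (evens \<gamma>)) \<gamma>"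
proof -
  let ?R = "{(\<beta>, \<gamma>). evens \<beta> \<subset> evens \<gamma> \<and> finite (evens \<gamma>)}"
  have "wf ?R"
    by (rule wf_subset[OF wf_measure[of "\<lambda>\<gamma>. card (evens \<gamma>)"]]) (simp add: subset_iff psubset_card_mono)
  moreover have "(\<lambda>l\<in>below0 (evens \<gamma>). cut f ?R \<gamma> l) = (\<lambda>l\<in>below0 (evens \<gamma>). f l)" for f :: "_ \<Rightarrow> 'x"
    using assms below_zerosD(1) by (intro restrict_ext) (auto simp: cut_def below0_def)
  ultimately show ?thesis unfolding synth_def by (subst wfrec) simp_all
qed

lemma evens_finite: "\<gamma> \<in> I \<Longrightarrow> finite (evens \<gamma>)"
  using index_dom[of \<gamma>] evens_subset_dom[of \<gamma>] finite_G by (meson finite_subset subset_trans)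

lemma below0_layer0: "l \<in> below0 D \<Longrightarrow> l \<in> layer0 (evens l) \<and> evens l \<subset> D"
  using below_zerosD[of l D] by (auto simp: below0_def layer0_def)

text \<open>
  The entry depends on \<open>u\<close> through the closed subsets of \<open>evens \<gamma>\<close> only, which is what makes it a function
  of the variables of the restrictions of an index.
\<close>

lemma synth_cong:
  assumes "finite (evens \<gamma>)" "\<And>D. D \<in> closed_subsets E (evens \<gamma>) \<Longrightarrow> u D = u' D"
  shows "synth u \<gamma> = synth u' \<gamma>"
  using assms
proof (induction "card (evens \<gamma>)" arbitrary: \<gamma> rule: less_induct)
  case less
  have "synth u l = synth u' l" if "l \<in> below0 (evens \<gamma>)" for l
  proof (rule less.hyps)
    have sub: "evens l \<subset> evens \<gamma>" using below0_layer0[OF that] by blast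
    then show "card (evens l) < card (evens \<gamma>)" using less.prems(1) by (rule psubset_card_mono[rotated])
    show "finite (evens l)" using sub less.prems(1) finite_subset by blast
    show "u D = u' D" if "D \<in> closed_subsets E (evens l)" for D
      using that sub by (intro less.prems(2)) (auto simp: closed_subsets_iff)
  qed
  then have "(\<lambda>l\<in>below0 (evens \<gamma>). synth u l) = (\<lambda>l\<in>below0 (evens \<gamma>). synth u' l)" by (rule restrict_ext)
  moreover have "u (evens \<gamma>) = u' (evens \<gamma>)" by (rule less.prems(2)) (simp add: closed_subsets_iff down_closed_evens)
  ultimately show ?case by (simp add: synth_unfold[OF less.prems(1)])
qed

lemma measurable_synth:
  assumes "\<gamma> \<in> layer0 (evens \<gamma>)" "evens \<gamma> \<subseteq> C"
  shows "(\<lambda>u. synth u \<gamma>) \<in> PiM (closed_subsets E C) (\<lambda>_. uniform01) \<rightarrow>\<^sub>M S"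
  using assms
proof (induction "card (evens \<gamma>)" arbitrary: \<gamma> rule: less_induct)
  case less
  have fin: "finite (evens \<gamma>)" using less.prems evens_finite by (auto simp: layer0_def)
  have "(\<lambda>u. synth u l) \<in> PiM (closed_subsets E C) (\<lambda>_. uniform01) \<rightarrow>\<^sub>M S" if "l \<in> below0 (evens \<gamma>)" for l
  proof (rule less.hyps)
    have sub: "evens l \<subset> evens \<gamma>" using below0_layer0[OF that] by blast
    then show "card (evens l) < card (evens \<gamma>)" using fin by (rule psubset_card_mono[rotated])
    show "l \<in> layer0 (evens l)" using below0_layer0[OF that] by blast
    show "evens l \<subseteq> C" using sub less.prems by blast
  qed
  then have "(\<lambda>u. \<lambda>l\<in>below0 (evens \<gamma>). synth u l) \<in> PiM (closed_subsets E C) (\<lambda>_. uniform01) \<rightarrow>\<^sub>M PiM (below0 (evens \<gamma>)) (\<lambda>_. S)"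
    by (rule measurable_restrict)
  moreover have "(\<lambda>u. u (evens \<gamma>)) \<in> PiM (closed_subsets E C) (\<lambda>_. uniform01) \<rightarrow>\<^sub>M uniform01"
    using less.prems by (intro measurable_component_singleton) (simp add: closed_subsets_iff down_closed_evens)
  ultimately have "(\<lambda>u. kernel (evens \<gamma>) (\<lambda>l\<in>below0 (evens \<gamma>). synth u l, u (evens \<gamma>))) \<in>
    PiM (closed_subsets E C) (\<lambda>_. uniform01) \<rightarrow>\<^sub>M PiM (layer0 (evens \<gamma>)) (\<lambda>_. S)"
    by (intro measurable_compose[OF measurable_Pair measurable_kernel])
  from measurable_compose[OF this measurable_component_singleton[OF less.prems(1)]]
  show ?case unfolding synth_unfold[OF fin] .
qed

text \<open>
  The array built from noise: the restriction of \<open>half \<alpha>\<close> to \<open>D\<close> supplies the variable for \<open>D\<close>.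
\<close>

definition synth_array :: "('v \<rightharpoonup> nat) \<Rightarrow> (('v \<rightharpoonup> nat) \<Rightarrow> real) \<Rightarrow> 'x" where
  "synth_array \<alpha> \<omega> = synth (\<lambda>D. \<omega> (half \<alpha> |` D)) (canon \<alpha>)"

lemma evens_canon: "evens (canon \<alpha>) = evens \<alpha>"
  unfolding canon_def by (rule evens_overwrite) simp

lemma canon_in_layer0: "\<alpha> \<in> I \<Longrightarrow> canon \<alpha> \<in> layer0 (evens \<alpha>)"
  using canon_layer0[of \<alpha> "half \<alpha>"] in_layer_half[of \<alpha>] by (simp add: dom_half)

text \<open>
  All entries of the layer of \<open>\<delta>\<close> arise by one application of the kernel to the layers of the proper
  restrictions of \<open>\<delta>\<close>, with the same fresh variable \<open>\<omega> \<delta>\<close>.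
\<close>

lemma synth_array_layer:
  assumes "\<alpha> \<in> layer \<delta>" "\<alpha> \<in> I"
  shows "synth_array \<alpha> \<omega> = kernel (dom \<delta>) (\<lambda>l\<in>below0 (dom \<delta>). synth_array (overwrite l \<delta>) \<omega>, \<omega> \<delta>) (canon \<alpha>)"
proof -
  have e: "evens \<alpha> = dom \<delta>" using assms by (simp add: layer_evens)
  have h: "half \<alpha> = \<delta>" using assms by (simp add: half_layer)
  have fin: "finite (dom \<delta>)" using evens_finite[OF assms(2)] e by simp
  have "synth (\<lambda>D. \<omega> (\<delta> |` D)) l = synth_array (overwrite l \<delta>) \<omega>" if l: "l \<in> below0 (dom \<delta>)" for l
  proof -
    have l': "l \<in> below (zeros (dom \<delta>))" using l by (simp add: below0_def)
    have sub: "evens l \<subset> dom \<delta>" using below0_layer0[OF l] by blast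
    show ?thesis unfolding synth_array_def overwrite_in_below(3,4)[OF l']
      using sub fin by (intro synth_cong) (auto simp: closed_subsets_iff Int_absorb1 intro: finite_subset)
  qed
  then have "(\<lambda>l\<in>below0 (dom \<delta>). synth (\<lambda>D. \<omega> (\<delta> |` D)) l) = (\<lambda>l\<in>below0 (dom \<delta>). synth_array (overwrite l \<delta>) \<omega>)"
    by (rule restrict_ext)
  moreover have "\<delta> |` dom \<delta> = \<delta>" by (auto simp: restrict_map_def fun_eq_iff domIff)
  ultimately show ?thesis
    unfolding synth_array_def h using fin by (subst synth_unfold) (simp_all add: evens_canon e)
qed

definition restrictions :: "('v \<rightharpoonup> nat) \<Rightarrow> ('v \<rightharpoonup> nat) set" where
  "restrictions \<delta> = (\<lambda>D. \<delta> |` D) ` closed_subsets E (dom \<delta>)"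

lemma synth_array_restrict:
  assumes "\<alpha> \<in> I" "restrictions (half \<alpha>) \<subseteq> \<Psi>"
  shows "synth_array \<alpha> \<omega> = synth (\<lambda>D\<in>closed_subsets E (evens \<alpha>). restrict \<omega> \<Psi> (half \<alpha> |` D)) (canon \<alpha>)"
  unfolding synth_array_def
proof (rule synth_cong)
  show "finite (evens (canon \<alpha>))" using evens_finite[OF assms(1)] by (simp add: evens_canon)
  fix D assume "D \<in> closed_subsets E (evens (canon \<alpha>))"
  then have "D \<in> closed_subsets E (evens \<alpha>)" "half \<alpha> |` D \<in> \<Psi>" using assms(2) by (auto simp: evens_canon restrictions_def dom_half)
  then show "\<omega> (half \<alpha> |` D) = (\<lambda>D\<in>closed_subsets E (evens \<alpha>). restrict \<omega> \<Psi> (half \<alpha> |` D)) D" by simp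
qed

lemma measurable_synth_array:
  assumes "\<alpha> \<in> I" "restrictions (half \<alpha>) \<subseteq> \<Psi>"
  shows "synth_array \<alpha> \<in> PiM \<Psi> (\<lambda>_. uniform01) \<rightarrow>\<^sub>M S"
proof -
  have *: "half \<alpha> |` D \<in> \<Psi>" if "D \<in> closed_subsets E (evens \<alpha>)" for D
    using assms(2) that by (auto simp: restrictions_def dom_half)
  have "(\<lambda>\<omega>. \<lambda>D\<in>closed_subsets E (evens \<alpha>). restrict \<omega> \<Psi> (half \<alpha> |` D)) \<in> PiM \<Psi> (\<lambda>_. uniform01) \<rightarrow>\<^sub>M PiM (closed_subsets E (evens \<alpha>)) (\<lambda>_. uniform01)"
    using * by (intro measurable_restrict) (simp add: measurable_component_singleton)
  moreover have "(\<lambda>u. synth u (canon \<alpha>)) \<in> PiM (closed_subsets E (evens \<alpha>)) (\<lambda>_. uniform01) \<rightarrow>\<^sub>M S"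
    using canon_in_layer0[OF assms(1)] by (intro measurable_synth) (simp_all add: evens_canon)
  ultimately have "(\<lambda>\<omega>. synth (\<lambda>D\<in>closed_subsets E (evens \<alpha>). restrict \<omega> \<Psi> (half \<alpha> |` D)) (canon \<alpha>)) \<in> PiM \<Psi> (\<lambda>_. uniform01) \<rightarrow>\<^sub>M S"
    by (rule measurable_compose)
  moreover have "synth_array \<alpha> = (\<lambda>\<omega>. synth (\<lambda>D\<in>closed_subsets E (evens \<alpha>). restrict \<omega> \<Psi> (half \<alpha> |` D)) (canon \<alpha>))"
    by (rule ext) (rule synth_array_restrict[OF assms])
  ultimately show ?thesis by simp
qed

definition noise :: "(('v \<rightharpoonup> nat) \<Rightarrow> real) measure" where
  "noise = PiM (all_indices E G) (\<lambda>_. uniform01)"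

lemma prob_space_noise: "prob_space noise"
  unfolding noise_def by (intro prob_space_PiM prob_space_uniform01)

lemma all_indices_iff: "\<delta> \<in> all_indices E G \<longleftrightarrow> dom \<delta> \<subseteq> G \<and> down_closed (dom \<delta>)"
  by (auto simp: all_indices_def closed_subsets_iff nat_pow_def)

lemma half_index: "\<alpha> \<in> I \<Longrightarrow> half \<alpha> \<in> all_indices E G"
  using index_dom[of \<alpha>] evens_subset_dom[of \<alpha>] by (auto simp: all_indices_iff dom_half down_closed_evens)

lemma restrictions_all_indices: "\<delta> \<in> all_indices E G \<Longrightarrow> restrictions \<delta> \<subseteq> all_indices E G"
proof
  fix \<epsilon> assume "\<delta> \<in> all_indices E G" "\<epsilon> \<in> restrictions \<delta>"
  then obtain D where D: "\<epsilon> = \<delta> |` D" "D \<subseteq> dom \<delta>" "down_closed D" "dom \<delta> \<subseteq> G"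
    by (auto simp: restrictions_def all_indices_iff closed_subsets_iff)
  then have "dom \<epsilon> = D" by auto
  then show "\<epsilon> \<in> all_indices E G" using D subset_trans[of D "dom \<delta>" G] by (simp add: all_indices_iff)
qed

lemma measurable_synth_array_noise: "\<alpha> \<in> I \<Longrightarrow> synth_array \<alpha> \<in> noise \<rightarrow>\<^sub>M S"
  unfolding noise_def by (intro measurable_synth_array restrictions_all_indices half_index)

lemma restrict_self: "\<delta> |` dom \<delta> = \<delta>"
  by (auto simp: restrict_map_def fun_eq_iff domIff)

lemma self_in_restrictions: "down_closed (dom \<delta>) \<Longrightarrow> \<delta> \<in> restrictions \<delta>"
  unfolding restrictions_def by (rule image_eqI[of _ _ "dom \<delta>"]) (simp_all add: restrict_self closed_subsets_iff)

definition over :: "('v \<rightharpoonup> nat) set \<Rightarrow> ('v \<rightharpoonup> nat) set" where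
  "over \<Phi> = {\<alpha>\<in>I. half \<alpha> \<in> \<Phi>}"

lemma over_subset: "over \<Phi> \<subseteq> I" by (auto simp: over_def)

text \<open>
  Conditionally on the entries over \<open>\<Phi>\<close>, the layer of \<open>\<delta>\<close> has the same law in both arrays. In the given
  array this is the conditional law of a layer, since no \<open>\<epsilon> \<in> \<Phi>\<close> extends \<open>\<delta>\<close>. In the synthetic array
  the entries over \<open>\<Phi>\<close> do not involve the coordinate \<open>\<omega> \<delta>\<close>, so integrating it out gives the same
  function of the lower layers.
\<close>

lemma law_extend:
  assumes \<delta>: "\<delta> \<in> all_indices E G" and \<Phi>: "\<Phi> \<subseteq> all_indices E G" "\<And>\<epsilon>. \<epsilon> \<in> \<Phi> \<Longrightarrow> restrictions \<epsilon> \<subseteq> \<Phi>"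
    and new: "\<delta> \<notin> \<Phi>" and old: "restrictions \<delta> \<subseteq> insert \<delta> \<Phi>"
    and IH: "distr noise (PiM (over \<Phi>) (\<lambda>_. S)) (\<lambda>\<omega>. \<lambda>\<alpha>\<in>over \<Phi>. synth_array \<alpha> \<omega>) =
      distr M (PiM (over \<Phi>) (\<lambda>_. S)) (\<lambda>\<omega>. \<lambda>\<alpha>\<in>over \<Phi>. x \<alpha> \<omega>)"
  shows "distr noise (PiM (over (insert \<delta> \<Phi>)) (\<lambda>_. S)) (\<lambda>\<omega>. \<lambda>\<alpha>\<in>over (insert \<delta> \<Phi>). synth_array \<alpha> \<omega>) =
      distr M (PiM (over (insert \<delta> \<Phi>)) (\<lambda>_. S)) (\<lambda>\<omega>. \<lambda>\<alpha>\<in>over (insert \<delta> \<Phi>). x \<alpha> \<omega>)"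
proof (rule distr_PiM_eqI[OF prob_space_noise])
  interpret N: prob_space noise by (rule prob_space_noise)
  interpret U: prob_space uniform01 by (rule prob_space_uniform01)
  have cl: "down_closed (dom \<delta>)" using \<delta> by (simp add: all_indices_iff)
  define K where "K = over \<Phi>"
  define L where "L = below0 (dom \<delta>)"
  \<comment> \<open>The coordinates of the noise other than the fresh one.\<close>
  define \<Delta> where "\<Delta> = all_indices E G - {\<delta>}"
  have KI: "K \<subseteq> I" unfolding K_def by (rule over_subset)
  have KH: "K \<subseteq> beside \<delta> \<inter> I"
  proof
    fix \<alpha> assume \<alpha>: "\<alpha> \<in> K"
    have "half \<alpha> |` dom \<delta> \<noteq> \<delta>"
    proof
      assume eq: "half \<alpha> |` dom \<delta> = \<delta>"
      then have "dom (half \<alpha>) \<inter> dom \<delta> = dom \<delta>" by (metis dom_restrict)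
      then have "dom \<delta> \<in> closed_subsets E (dom (half \<alpha>))" using cl by (auto simp: closed_subsets_iff)
      then have "\<delta> \<in> restrictions (half \<alpha>)" unfolding restrictions_def using eq by (metis image_eqI)
      then show False using \<Phi>(2)[of "half \<alpha>"] \<alpha> new by (auto simp: K_def over_def)
    qed
    then show "\<alpha> \<in> beside \<delta> \<inter> I" using layer_subset_beside[OF cl] in_layer_half[of \<alpha>] \<alpha> KI by blast
  qed
  have LK: "overwrite l \<delta> \<in> K" if l: "l \<in> L" for l
  proof -
    have l': "l \<in> below (zeros (dom \<delta>))" using l by (simp add: L_def below0_def)
    have sub: "evens l \<subset> dom \<delta>" using below0_layer0[of l "dom \<delta>"] l by (simp add: L_def)
    have "\<delta> |` evens l \<in> restrictions \<delta>" unfolding restrictions_def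
      using sub by (intro imageI) (auto simp: closed_subsets_iff down_closed_evens)
    moreover have "\<delta> |` evens l \<noteq> \<delta>" using sub by (metis dom_restrict inf.absorb2 order_less_irrefl order.strict_implies_order)
    ultimately have "\<delta> |` evens l \<in> \<Phi>" using old by blast
    then show ?thesis using overwrite_index[of l \<delta>] l overwrite_in_below(3)[OF l'] by (simp add: K_def over_def L_def)
  qed
  have local: "synth_array \<alpha> (restrict \<omega> \<Delta>) = synth_array \<alpha> \<omega>" "synth_array \<alpha> \<in> PiM \<Delta> (\<lambda>_. uniform01) \<rightarrow>\<^sub>M S" if \<alpha>: "\<alpha> \<in> K" for \<alpha> \<omega>
  proof -
    have "\<alpha> \<in> I" "half \<alpha> \<in> \<Phi>" using \<alpha> by (auto simp: K_def over_def)
    moreover from this have r: "restrictions (half \<alpha>) \<subseteq> \<Delta>" using \<Phi> new by (auto simp: \<Delta>_def)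
    ultimately show "synth_array \<alpha> (restrict \<omega> \<Delta>) = synth_array \<alpha> \<omega>" "synth_array \<alpha> \<in> PiM \<Delta> (\<lambda>_. uniform01) \<rightarrow>\<^sub>M S"
      by (simp_all add: synth_array_restrict[OF _ r] measurable_synth_array)
  qed
  fix J A assume J: "finite J" "J \<subseteq> over (insert \<delta> \<Phi>)" and A: "\<And>j. j \<in> J \<Longrightarrow> A j \<in> sets S"
  define F where "F = {\<alpha>\<in>J. half \<alpha> = \<delta>}"
  define C where "C = J - F"
  have F: "finite F" "F \<subseteq> layer \<delta> \<inter> I" using J in_layer_half by (auto simp: F_def over_def)
  have C: "finite C" "C \<subseteq> K" using J by (auto simp: C_def F_def K_def over_def)
  have JFC: "J = F \<union> C" by (auto simp: C_def F_def)
  have AF: "A j \<in> sets S" if "j \<in> F" for j using A that by (simp add: F_def)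
  define B where "B = {f\<in>space (PiM (beside \<delta> \<inter> I) (\<lambda>_. S)). \<forall>j\<in>C. f j \<in> A j}"
  have B: "B \<in> sets (PiM (beside \<delta> \<inter> I) (\<lambda>_. S))"
    unfolding B_def using C KH A JFC by (intro sets.sets_Collect_finite_All C)
      (auto intro!: sets_Collect_preimage[OF measurable_component_singleton])
  define B0 where "B0 = {f\<in>space (PiM K (\<lambda>_. S)). \<forall>j\<in>C. f j \<in> A j}"
  have B0[measurable]: "B0 \<in> sets (PiM K (\<lambda>_. S))"
    unfolding B0_def using C A JFC by (intro sets.sets_Collect_finite_All C)
      (auto intro!: sets_Collect_preimage[OF measurable_component_singleton])
  define v where "v q = (\<lambda>l\<in>L. q (overwrite l \<delta>))" for q :: "('v \<rightharpoonup> nat) \<Rightarrow> 'x"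
  have v[measurable]: "v \<in> PiM K (\<lambda>_. S) \<rightarrow>\<^sub>M PiM L (\<lambda>_. S)"
    unfolding v_def by (intro measurable_restrict measurable_component_singleton LK)
  have cp[measurable]: "cell_prob \<delta> F A \<in> borel_measurable (PiM L (\<lambda>_. S))"
    unfolding L_def by (rule measurable_cell_prob[OF F AF])
  define h where "h q = cell_prob \<delta> F A (v q) * indicator B0 q" for q
  have h: "h \<in> borel_measurable (PiM K (\<lambda>_. S))" unfolding h_def by measurable
  have mx: "(\<lambda>\<omega>. \<lambda>\<alpha>\<in>K. x \<alpha> \<omega>) \<in> M \<rightarrow>\<^sub>M PiM K (\<lambda>_. S)" by (rule measurable_family[OF KI])
  have ms: "(\<lambda>\<omega>. \<lambda>\<alpha>\<in>K. synth_array \<alpha> \<omega>) \<in> noise \<rightarrow>\<^sub>M PiM K (\<lambda>_. S)"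
    using KI by (intro measurable_restrict measurable_synth_array_noise) auto
  have "emeasure M {\<omega>\<in>space M. \<forall>j\<in>J. x j \<omega> \<in> A j} =
    emeasure M {\<omega>\<in>space M. (\<forall>j\<in>F. x j \<omega> \<in> A j) \<and> (\<lambda>\<alpha>\<in>beside \<delta> \<inter> I. x \<alpha> \<omega>) \<in> B}"
    using C KH measurable_space[OF measurable_family[of "beside \<delta> \<inter> I"]]
    by (intro arg_cong[where f="emeasure M"]) (auto simp: JFC B_def subset_eq)
  also have "\<dots> = (\<integral>\<^sup>+\<omega>. cell_prob \<delta> F A (\<lambda>l\<in>below0 (dom \<delta>). x (overwrite l \<delta>) \<omega>) * indicator B (\<lambda>\<alpha>\<in>beside \<delta> \<inter> I. x \<alpha> \<omega>) \<partial>M)"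
    by (rule conditional_law_of_layer[OF cl F AF B])
  also have "\<dots> = (\<integral>\<^sup>+\<omega>. h (\<lambda>\<alpha>\<in>K. x \<alpha> \<omega>) \<partial>M)"
  proof (rule nn_integral_cong)
    fix \<omega> assume \<omega>: "\<omega> \<in> space M"
    have "v (\<lambda>\<alpha>\<in>K. x \<alpha> \<omega>) = (\<lambda>l\<in>below0 (dom \<delta>). x (overwrite l \<delta>) \<omega>)"
      unfolding v_def L_def[symmetric] by (intro restrict_ext) (simp add: LK)
    moreover have "(\<lambda>\<alpha>\<in>beside \<delta> \<inter> I. x \<alpha> \<omega>) \<in> B \<longleftrightarrow> (\<lambda>\<alpha>\<in>K. x \<alpha> \<omega>) \<in> B0"
      using C KH measurable_space[OF mx \<omega>] measurable_space[OF measurable_family[of "beside \<delta> \<inter> I"] \<omega>]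
      by (auto simp: B_def B0_def subset_eq)
    ultimately show "cell_prob \<delta> F A (\<lambda>l\<in>below0 (dom \<delta>). x (overwrite l \<delta>) \<omega>) * indicator B (\<lambda>\<alpha>\<in>beside \<delta> \<inter> I. x \<alpha> \<omega>) = h (\<lambda>\<alpha>\<in>K. x \<alpha> \<omega>)"
      by (simp add: h_def indicator_def)
  qed
  also have "\<dots> = (\<integral>\<^sup>+q. h q \<partial>distr M (PiM K (\<lambda>_. S)) (\<lambda>\<omega>. \<lambda>\<alpha>\<in>K. x \<alpha> \<omega>))"
    by (rule nn_integral_distr[OF mx, symmetric]) (simp add: h)
  also have "\<dots> = (\<integral>\<^sup>+q. h q \<partial>distr noise (PiM K (\<lambda>_. S)) (\<lambda>\<omega>. \<lambda>\<alpha>\<in>K. synth_array \<alpha> \<omega>))"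
    using IH unfolding K_def by simp
  also have "\<dots> = (\<integral>\<^sup>+\<omega>. h (\<lambda>\<alpha>\<in>K. synth_array \<alpha> \<omega>) \<partial>noise)"
    by (rule nn_integral_distr[OF ms]) (simp add: h)
  finally have Mside: "emeasure M {\<omega>\<in>space M. \<forall>j\<in>J. x j \<omega> \<in> A j} = (\<integral>\<^sup>+\<omega>. h (\<lambda>\<alpha>\<in>K. synth_array \<alpha> \<omega>) \<partial>noise)" .
  define Ev where "Ev = {p\<in>space (PiM L (\<lambda>_. S) \<Otimes>\<^sub>M uniform01). \<forall>j\<in>F. kernel (dom \<delta>) p (canon j) \<in> A j}"
  have Ev[measurable]: "Ev \<in> sets (PiM L (\<lambda>_. S) \<Otimes>\<^sub>M uniform01)"
    unfolding Ev_def L_def by (rule cell_event[OF F AF])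
  define q where "q \<rho> = (\<lambda>\<alpha>\<in>K. synth_array \<alpha> \<rho>)" for \<rho>
  have q[measurable]: "q \<in> PiM \<Delta> (\<lambda>_. uniform01) \<rightarrow>\<^sub>M PiM K (\<lambda>_. S)"
    unfolding q_def by (intro measurable_restrict local)
  have qR: "q (restrict \<omega> \<Delta>) = q \<omega>" for \<omega>
    unfolding q_def by (intro restrict_ext local)
  define hh where "hh p = (indicator Ev (v (q (fst p)), snd p) * indicator B0 (q (fst p)) :: ennreal)" for p
  have hh: "hh \<in> borel_measurable (PiM \<Delta> (\<lambda>_. uniform01) \<Otimes>\<^sub>M uniform01)"
    unfolding hh_def by measurable
  have vq: "v (q \<omega>) = (\<lambda>l\<in>below0 (dom \<delta>). synth_array (overwrite l \<delta>) \<omega>)" for \<omega>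
    unfolding v_def q_def L_def[symmetric] by (intro restrict_ext) (simp add: LK)
  have qsp: "q \<omega> \<in> space (PiM K (\<lambda>_. S))" if "\<omega> \<in> space noise" for \<omega>
    using measurable_space[OF ms that] by (simp add: q_def)
  have \<omega>\<delta>: "\<omega> \<delta> \<in> {0..1}" if "\<omega> \<in> space noise" for \<omega>
    using that \<delta> by (auto simp: noise_def space_PiM)
  have "{\<omega>\<in>space noise. \<forall>j\<in>J. synth_array j \<omega> \<in> A j} \<in> sets noise"
    using J A over_subset by (intro sets.sets_Collect_finite_All J)
      (auto intro!: sets_Collect_preimage[OF measurable_synth_array_noise])
  then have "emeasure noise {\<omega>\<in>space noise. \<forall>j\<in>J. synth_array j \<omega> \<in> A j} =
    (\<integral>\<^sup>+\<omega>. indicator {\<omega>\<in>space noise. \<forall>j\<in>J. synth_array j \<omega> \<in> A j} \<omega> \<partial>noise)" by simp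
  also have "\<dots> = (\<integral>\<^sup>+\<omega>. hh (restrict \<omega> \<Delta>, \<omega> \<delta>) \<partial>noise)"
  proof (rule nn_integral_cong)
    fix \<omega> assume \<omega>: "\<omega> \<in> space noise"
    have "(v (q \<omega>), \<omega> \<delta>) \<in> Ev \<longleftrightarrow> (\<forall>j\<in>F. synth_array j \<omega> \<in> A j)"
    proof -
      have "synth_array j \<omega> = kernel (dom \<delta>) (v (q \<omega>), \<omega> \<delta>) (canon j)" if "j \<in> F" for j
        unfolding vq using F(2) that by (intro synth_array_layer) auto
      then show ?thesis using measurable_space[OF v qsp[OF \<omega>]] \<omega>\<delta>[OF \<omega>] by (auto simp: Ev_def space_pair_measure)
    qed
    moreover have "q \<omega> \<in> B0 \<longleftrightarrow> (\<forall>j\<in>C. synth_array j \<omega> \<in> A j)"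
      using C(2) qsp[OF \<omega>] by (auto simp: B0_def q_def subset_eq)
    ultimately show "indicator {\<omega>\<in>space noise. \<forall>j\<in>J. synth_array j \<omega> \<in> A j} \<omega> = hh (restrict \<omega> \<Delta>, \<omega> \<delta>)"
      using \<omega> by (auto simp: hh_def qR JFC indicator_def)
  qed
  also have "\<dots> = (\<integral>\<^sup>+\<omega>. \<integral>\<^sup>+u. hh (restrict \<omega> \<Delta>, u) \<partial>uniform01 \<partial>noise)"
    by (rule nn_integral_uniform_product_component[OF \<delta>, folded \<Delta>_def noise_def, OF hh])
  also have "\<dots> = (\<integral>\<^sup>+\<omega>. h (\<lambda>\<alpha>\<in>K. synth_array \<alpha> \<omega>) \<partial>noise)"
  proof (rule nn_integral_cong)
    fix \<omega> assume \<omega>: "\<omega> \<in> space noise"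
    have vs: "v (q \<omega>) \<in> space (PiM L (\<lambda>_. S))" by (rule measurable_space[OF v qsp[OF \<omega>]])
    have "(\<integral>\<^sup>+u. hh (restrict \<omega> \<Delta>, u) \<partial>uniform01) = (\<integral>\<^sup>+u. indicator B0 (q \<omega>) * indicator (Pair (v (q \<omega>)) -` Ev) u \<partial>uniform01)"
      unfolding hh_def by (intro nn_integral_cong) (simp add: qR indicator_def)
    also have "\<dots> = indicator B0 (q \<omega>) * emeasure uniform01 (Pair (v (q \<omega>)) -` Ev)"
      by (rule nn_integral_cmult_indicator) (rule sets_Pair1[OF Ev])
    also have "Pair (v (q \<omega>)) -` Ev = {u\<in>{0..1}. \<forall>j\<in>F. kernel (dom \<delta>) (v (q \<omega>), u) (canon j) \<in> A j}"
      using vs by (auto simp: Ev_def space_pair_measure)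
    also have "indicator B0 (q \<omega>) * emeasure uniform01 \<dots> = h (q \<omega>)"
      by (simp add: h_def cell_prob_def mult.commute)
    finally show "(\<integral>\<^sup>+u. hh (restrict \<omega> \<Delta>, u) \<partial>uniform01) = h (\<lambda>\<alpha>\<in>K. synth_array \<alpha> \<omega>)"
      unfolding q_def .
  qed
  finally show "emeasure noise {\<omega>\<in>space noise. \<forall>j\<in>J. synth_array j \<omega> \<in> A j} = emeasure M {\<omega>\<in>space M. \<forall>j\<in>J. x j \<omega> \<in> A j}"
    unfolding Mside .
qed (use over_subset in \<open>auto intro: measurable_synth_array_noise rv\<close>)

text \<open>
  An element of \<open>\<Phi>\<close> with a largest domain is a restriction of no other element, so it can be added last.
\<close>

lemma law_over:
  assumes "finite \<Phi>" "\<Phi> \<subseteq> all_indices E G" "\<And>\<epsilon>. \<epsilon> \<in> \<Phi> \<Longrightarrow> restrictions \<epsilon> \<subseteq> \<Phi>"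
  shows "distr noise (PiM (over \<Phi>) (\<lambda>_. S)) (\<lambda>\<omega>. \<lambda>\<alpha>\<in>over \<Phi>. synth_array \<alpha> \<omega>) =
      distr M (PiM (over \<Phi>) (\<lambda>_. S)) (\<lambda>\<omega>. \<lambda>\<alpha>\<in>over \<Phi>. x \<alpha> \<omega>)"
  using assms
proof (induction "card \<Phi>" arbitrary: \<Phi>)
  case 0
  then have "over \<Phi> = {}" by (simp add: over_def)
  moreover have "emeasure noise (space noise) = 1" by (rule prob_space.emeasure_space_1[OF prob_space_noise])
  ultimately show ?case by (intro distr_PiM_eqI[OF prob_space_noise]) (auto simp: emeasure_space_1)
next
  case (Suc n)
  define m where "m = Max ((\<lambda>\<epsilon>. card (dom \<epsilon>)) ` \<Phi>)"
  have "\<Phi> \<noteq> {}" using Suc.hyps(2) by auto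
  then have "m \<in> (\<lambda>\<epsilon>. card (dom \<epsilon>)) ` \<Phi>" unfolding m_def using Suc.prems(1) by (intro Max_in) auto
  then obtain \<delta> where \<delta>: "\<delta> \<in> \<Phi>" "m = card (dom \<delta>)" by auto
  have max: "card (dom \<epsilon>) \<le> card (dom \<delta>)" if "\<epsilon> \<in> \<Phi>" for \<epsilon>
    unfolding \<delta>(2)[symmetric] m_def using that Suc.prems(1) by (intro Max_ge) auto
  define \<Phi>' where "\<Phi>' = \<Phi> - {\<delta>}"
  have ins: "\<Phi> = insert \<delta> \<Phi>'" using \<delta> by (auto simp: \<Phi>'_def)
  have closed': "restrictions \<epsilon> \<subseteq> \<Phi>'" if \<epsilon>: "\<epsilon> \<in> \<Phi>'" for \<epsilon>
  proof -
    have "\<delta> \<notin> restrictions \<epsilon>"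
    proof
      assume "\<delta> \<in> restrictions \<epsilon>"
      then obtain D where D: "\<delta> = \<epsilon> |` D" "D \<subseteq> dom \<epsilon>" by (auto simp: restrictions_def closed_subsets_iff)
      then have d: "dom \<delta> = D" by auto
      have "finite (dom \<epsilon>)" using \<epsilon> Suc.prems(2) finite_subset[OF _ finite_G] by (auto simp: \<Phi>'_def all_indices_iff)
      then have "D = dom \<epsilon>" using max[of \<epsilon>] \<epsilon> D d by (intro card_seteq) (auto simp: \<Phi>'_def)
      then have "\<delta> = \<epsilon>" using D by (simp add: restrict_self)
      then show False using \<epsilon> by (simp add: \<Phi>'_def)
    qed
    then show ?thesis using Suc.prems(3)[of \<epsilon>] \<epsilon> by (auto simp: \<Phi>'_def)
  qed
  have "distr noise (PiM (over \<Phi>') (\<lambda>_. S)) (\<lambda>\<omega>. \<lambda>\<alpha>\<in>over \<Phi>'. synth_array \<alpha> \<omega>) =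
      distr M (PiM (over \<Phi>') (\<lambda>_. S)) (\<lambda>\<omega>. \<lambda>\<alpha>\<in>over \<Phi>'. x \<alpha> \<omega>)"
    using Suc.prems Suc.hyps(2) \<delta> closed' by (intro Suc.hyps(1)) (auto simp: \<Phi>'_def)
  then show ?case
    unfolding ins using Suc.prems \<delta> closed'
    by (intro law_extend) (auto simp: ins[symmetric] \<Phi>'_def)
qed

lemma synth_array_dbl:
  assumes "dom \<alpha> = C" "down_closed C" "C \<subseteq> G"
  shows "synth_array (dbl \<alpha>) \<omega> = synth (\<lambda>D\<in>closed_subsets E C. \<omega> (\<alpha> |` D)) (zeros C)"
proof -
  have e: "evens (zeros C) = C"
    using dbl_in_layer[of "zeros C"] assms by (simp add: layer_def)
  show ?thesis
    unfolding synth_array_def half_layer[OF dbl_in_layer[of \<alpha>, unfolded assms(1), OF assms(2)]]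
      canon_dbl[of \<alpha>, unfolded assms(1), OF assms(2)]
    using assms finite_subset[OF _ finite_G] by (intro synth_cong) (simp_all add: e)
qed

text \<open>
  Doubling the indices does not change the law of the given array, and the doubled index \<open>2j\<close> lies in
  the layer of \<open>j\<close>. The restrictions of finitely many indices form a finite restriction-closed set.
\<close>

lemma law_eq_synth_array:
  assumes J: "finite J" "J \<subseteq> I" and A: "\<And>j. j \<in> J \<Longrightarrow> A j \<in> sets S"
  shows "emeasure M {\<omega>\<in>space M. \<forall>j\<in>J. x j \<omega> \<in> A j} = emeasure noise {\<omega>\<in>space noise. \<forall>j\<in>J. synth_array (dbl j) \<omega> \<in> A j}"
proof -
  have cl: "down_closed (dom j)" "dom j \<subseteq> G" if "j \<in> J" for j using index_dom that J by auto
  have dI: "dbl j \<in> I" if "j \<in> J" for j using index_dom_cong[of j "dbl j"] that J by auto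
  define \<Phi> where "\<Phi> = (\<Union>j\<in>J. restrictions j)"
  have sub: "\<Phi> \<subseteq> all_indices E G"
    unfolding \<Phi>_def by (intro UN_least restrictions_all_indices) (simp add: all_indices_iff cl)
  have "finite (restrictions j)" if "j \<in> J" for j
    unfolding restrictions_def
  proof (rule finite_imageI, rule finite_subset)
    show "closed_subsets E (dom j) \<subseteq> Pow (dom j)" by (auto simp: closed_subsets_iff)
    show "finite (Pow (dom j))" using finite_subset[OF cl(2)[OF that] finite_G] by simp
  qed
  then have fin: "finite \<Phi>" unfolding \<Phi>_def using J by auto
  have clo: "restrictions \<epsilon> \<subseteq> \<Phi>" if "\<epsilon> \<in> \<Phi>" for \<epsilon>
  proof -
    from that obtain j where j: "j \<in> J" "\<epsilon> \<in> restrictions j" by (auto simp: \<Phi>_def)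
    then obtain D where D: "\<epsilon> = j |` D" "D \<subseteq> dom j" by (auto simp: restrictions_def closed_subsets_iff)
    then have "dom \<epsilon> = D" by auto
    have "restrictions \<epsilon> \<subseteq> restrictions j"
    proof
      fix \<eta> assume "\<eta> \<in> restrictions \<epsilon>"
      then obtain D' where D': "\<eta> = \<epsilon> |` D'" "D' \<subseteq> D" "down_closed D'"
        using \<open>dom \<epsilon> = D\<close> by (auto simp: restrictions_def closed_subsets_iff)
      then have "\<eta> = j |` D'" using D by (simp add: Int_absorb1)
      then show "\<eta> \<in> restrictions j" using D D' by (auto simp: restrictions_def closed_subsets_iff)
    qed
    then show ?thesis using j by (auto simp: \<Phi>_def)
  qed
  have dO: "dbl j \<in> over \<Phi>" if "j \<in> J" for j
    using dI[OF that] half_layer[OF dbl_in_layer[OF cl(1)[OF that]]] self_in_restrictions[OF cl(1)[OF that]] that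
    by (auto simp: over_def \<Phi>_def)
  let ?C = "{f\<in>space (PiM (over \<Phi>) (\<lambda>_. S)). \<forall>j\<in>J. f (dbl j) \<in> A j}"
  have C: "?C \<in> sets (PiM (over \<Phi>) (\<lambda>_. S))"
    by (intro sets.sets_Collect_finite_All J) (auto intro!: sets_Collect_preimage[OF measurable_component_singleton] dO A)
  have mx: "(\<lambda>\<omega>. \<lambda>\<alpha>\<in>over \<Phi>. x \<alpha> \<omega>) \<in> M \<rightarrow>\<^sub>M PiM (over \<Phi>) (\<lambda>_. S)" by (rule measurable_family[OF over_subset])
  have ms: "(\<lambda>\<omega>. \<lambda>\<alpha>\<in>over \<Phi>. synth_array \<alpha> \<omega>) \<in> noise \<rightarrow>\<^sub>M PiM (over \<Phi>) (\<lambda>_. S)"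
    using over_subset by (intro measurable_restrict measurable_synth_array_noise) auto
  \<comment> \<open>The empty family stands for the absent second condition of \<open>event_act\<close>.\<close>
  have "emeasure M {\<omega>\<in>space M. (\<forall>j\<in>J. x (act (\<lambda>_ _. (*) 2) j) \<omega> \<in> A j) \<and> (\<lambda>\<alpha>\<in>{}. x (act (\<lambda>_ _. (*) 2) \<alpha>) \<omega>) \<in> {\<lambda>_. undefined}} =
    emeasure M {\<omega>\<in>space M. (\<forall>j\<in>J. x j \<omega> \<in> A j) \<and> (\<lambda>\<alpha>\<in>{}. x \<alpha> \<omega>) \<in> {\<lambda>_. undefined}}"
    by (rule event_act) (use J A in \<open>auto simp: PiM_empty inj_def\<close>)
  then have "emeasure M {\<omega>\<in>space M. \<forall>j\<in>J. x j \<omega> \<in> A j} = emeasure M {\<omega>\<in>space M. \<forall>j\<in>J. x (dbl j) \<omega> \<in> A j}"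
    by (simp add: act_double restrict_def)
  also have "\<dots> = emeasure M ((\<lambda>\<omega>. \<lambda>\<alpha>\<in>over \<Phi>. x \<alpha> \<omega>) -` ?C \<inter> space M)"
    using measurable_space[OF mx] dO by (intro arg_cong[where f="emeasure M"]) auto
  also have "\<dots> = emeasure noise ((\<lambda>\<omega>. \<lambda>\<alpha>\<in>over \<Phi>. synth_array \<alpha> \<omega>) -` ?C \<inter> space noise)"
    by (rule emeasure_vimage_eq_of_distr_eq[OF law_over[OF fin sub clo, symmetric] mx ms C])
  also have "\<dots> = emeasure noise {\<omega>\<in>space noise. \<forall>j\<in>J. synth_array (dbl j) \<omega> \<in> A j}"
    using measurable_space[OF ms] dO by (intro arg_cong[where f="emeasure noise"]) auto
  finally show ?thesis .
qed

end

lemma joint_law_eq: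
  "joint_law M S Cs X = distr M (PiM (SIGMA C:set Cs. nat_pow C) (\<lambda>_. S))
     (\<lambda>\<omega>. \<lambda>i\<in>(SIGMA C:set Cs. nat_pow C). X (fst i) (snd i) \<omega>)"
  unfolding joint_law_def by (simp add: case_prod_beta' restrict_def)

lemma exchangeable_array_of_dag_exchangeable:
  fixes X :: "'v set \<Rightarrow> ('v \<rightharpoonup> nat) \<Rightarrow> 'w \<Rightarrow> 'x"
  assumes G: "finite_dag G E" and S: "borel_space S" "space S \<noteq> {}" and Cs: "set Cs \<subseteq> closed_subsets E G"
    and X: "random_array_collection M S Cs X" and exch: "dag_exchangeable G E M S Cs X"
  shows "exchangeable_array G E M S (\<Union>C\<in>set Cs. nat_pow C) (\<lambda>\<alpha>. X (dom \<alpha>) \<alpha>)"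
proof -
  interpret dag G E by standard fact
  interpret prob_space M using X by (simp add: random_array_collection_def)
  let ?I = "\<Union>C\<in>set Cs. nat_pow C" and ?J = "SIGMA C:set Cs. nat_pow C"
  have Xm: "X C \<alpha> \<in> M \<rightarrow>\<^sub>M S" if "C \<in> set Cs" "dom \<alpha> = C" for C \<alpha>
    using X that by (auto simp: random_array_collection_def nat_pow_def)
  show ?thesis
  proof unfold_locales
    show "codable S" using S by (rule codable_of_borel_space)
    show "dom \<alpha> \<subseteq> G \<and> down_closed (dom \<alpha>)" if "\<alpha> \<in> ?I" for \<alpha>
      using that Cs closed_subsets_iff[of "dom \<alpha>" G] by (auto simp: nat_pow_def simp del: domIff)
    show "\<beta> \<in> ?I" if "\<alpha> \<in> ?I" "dom \<beta> = dom \<alpha>" for \<alpha> \<beta> using that by (auto simp: nat_pow_def)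
    show "X (dom \<alpha>) \<alpha> \<in> M \<rightarrow>\<^sub>M S" if "\<alpha> \<in> ?I" for \<alpha> using that Xm by (auto simp: nat_pow_def)
    fix \<sigma> :: "'v \<Rightarrow> ('v \<Rightarrow> nat option) \<Rightarrow> nat \<Rightarrow> nat" assume bij: "\<And>v c. bij (\<sigma> v c)"
    define flat where "flat f = (\<lambda>\<alpha>\<in>?I. f (dom \<alpha>, \<alpha>))" for f :: "'v set \<times> ('v \<rightharpoonup> nat) \<Rightarrow> 'x"
    have flat: "flat \<in> PiM ?J (\<lambda>_. S) \<rightarrow>\<^sub>M PiM ?I (\<lambda>_. S)"
      unfolding flat_def by (intro measurable_restrict measurable_component_singleton) (auto simp: nat_pow_def)
    have X': "X (fst i) (act \<sigma> (snd i)) \<in> M \<rightarrow>\<^sub>M S" "X (fst i) (snd i) \<in> M \<rightarrow>\<^sub>M S" if "i \<in> ?J" for i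
    proof -
      have "fst i \<in> set Cs" "dom (snd i) = fst i" using that by (auto simp: nat_pow_def)
      then show "X (fst i) (act \<sigma> (snd i)) \<in> M \<rightarrow>\<^sub>M S" "X (fst i) (snd i) \<in> M \<rightarrow>\<^sub>M S" by (simp_all add: Xm)
    qed
    have ind: "joint_law M S Cs (\<lambda>C \<alpha>. X C (induced G (act \<sigma>) \<alpha>)) =
      distr M (PiM ?J (\<lambda>_. S)) (\<lambda>\<omega>. \<lambda>i\<in>?J. X (fst i) (act \<sigma> (snd i)) \<omega>)"
      unfolding joint_law_eq
    proof (intro distr_cong refl restrict_ext)
      fix i \<omega> assume "i \<in> ?J"
      then have "fst i \<in> closed_subsets E G" "dom (snd i) = fst i" using Cs by (auto simp: nat_pow_def)
      from induced_act[of \<sigma>, OF bij this]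
      show "X (fst i) (induced G (act \<sigma>) (snd i)) \<omega> = X (fst i) (act \<sigma> (snd i)) \<omega>" by simp
    qed
    have eq: "distr M (PiM ?J (\<lambda>_. S)) (\<lambda>\<omega>. \<lambda>i\<in>?J. X (fst i) (snd i) \<omega>) =
      distr M (PiM ?J (\<lambda>_. S)) (\<lambda>\<omega>. \<lambda>i\<in>?J. X (fst i) (act \<sigma> (snd i)) \<omega>)"
      using exch dag_automorphism_act[of \<sigma>, OF bij] unfolding dag_exchangeable_def ind[symmetric] joint_law_eq[symmetric] by blast
    have 1: "distr M (PiM ?I (\<lambda>_. S)) (\<lambda>\<omega>. \<lambda>\<alpha>\<in>?I. X (dom (act \<sigma> \<alpha>)) (act \<sigma> \<alpha>) \<omega>) =
      distr (distr M (PiM ?J (\<lambda>_. S)) (\<lambda>\<omega>. \<lambda>i\<in>?J. X (fst i) (act \<sigma> (snd i)) \<omega>)) (PiM ?I (\<lambda>_. S)) flat"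
      using X' by (subst distr_distr[OF flat measurable_restrict])
        (auto intro!: distr_cong restrict_ext simp: comp_def flat_def nat_pow_def)
    have 2: "distr M (PiM ?I (\<lambda>_. S)) (\<lambda>\<omega>. \<lambda>\<alpha>\<in>?I. X (dom \<alpha>) \<alpha> \<omega>) =
      distr (distr M (PiM ?J (\<lambda>_. S)) (\<lambda>\<omega>. \<lambda>i\<in>?J. X (fst i) (snd i) \<omega>)) (PiM ?I (\<lambda>_. S)) flat"
      using X' by (subst distr_distr[OF flat measurable_restrict])
        (auto intro!: distr_cong restrict_ext simp: comp_def flat_def nat_pow_def)
    show "distr M (PiM ?I (\<lambda>_. S)) (\<lambda>\<omega>. \<lambda>\<alpha>\<in>?I. X (dom (act \<sigma> \<alpha>)) (act \<sigma> \<alpha>) \<omega>) =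
      distr M (PiM ?I (\<lambda>_. S)) (\<lambda>\<omega>. \<lambda>\<alpha>\<in>?I. X (dom \<alpha>) \<alpha> \<omega>)"
      unfolding 1 2 eq ..
  qed
qed

theorem theorem3p2:
  fixes G :: "'v set" and E :: "('v \<times> 'v) set"
    and M :: "'w measure" and S :: "'x measure"
    and Cs :: "'v set list"
    and X :: "'v set \<Rightarrow> ('v \<rightharpoonup> nat) \<Rightarrow> 'w \<Rightarrow> 'x"
  assumes "finite_dag G E"
    and "borel_space S"
    and "distinct Cs" and "set Cs \<subseteq> closed_subsets E G"
    and "random_array_collection M S Cs X"
    and "dag_exchangeable G E M S Cs X"
  shows "\<exists>(f :: 'v set \<Rightarrow> ('v set \<Rightarrow> real) \<Rightarrow> 'x)
          (N :: (('v \<rightharpoonup> nat) \<Rightarrow> real) measure) (U :: ('v \<rightharpoonup> nat) \<Rightarrow> (('v \<rightharpoonup> nat) \<Rightarrow> real) \<Rightarrow> real).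
      (\<forall>C\<in>set Cs. f C \<in> PiM (closed_subsets E C) (\<lambda>_. unit_interval) \<rightarrow>\<^sub>M S) \<and>
      iid_uniform N (all_indices E G) U \<and>
      joint_law M S Cs X = joint_law N S Cs (functional_array E f U)"
proof -
  interpret dag G E by standard fact
  interpret M: prob_space M using assms(5) by (simp add: random_array_collection_def)
  define N where "N = PiM (all_indices E G) (\<lambda>_. uniform01)"
  define U where "U i \<omega> = \<omega> i" for i :: "'v \<rightharpoonup> nat" and \<omega> :: "('v \<rightharpoonup> nat) \<Rightarrow> real"
  interpret N: prob_space N unfolding N_def by (intro prob_space_PiM prob_space_uniform01)
  let ?J = "SIGMA C:set Cs. nat_pow C"
  have "zeros {} \<in> all_indices E G"
    by (auto simp: all_indices_def nat_pow_def closed_subsets_iff down_closed_def)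
  then have iid: "iid_uniform N (all_indices E G) U"
    unfolding N_def U_def by (intro iid_uniform_product) auto
  have Xm: "X (fst i) (snd i) \<in> M \<rightarrow>\<^sub>M S" if "i \<in> ?J" for i
    using assms(5) that by (auto simp: random_array_collection_def)
  show ?thesis
  proof (cases "Cs = []")
    case True
    have "joint_law M S Cs X = joint_law N S Cs (functional_array E f U)" for f :: "'v set \<Rightarrow> ('v set \<Rightarrow> real) \<Rightarrow> 'x"
      unfolding joint_law_eq using True
      by (intro distr_PiM_eqI[OF M.prob_space_axioms]) (auto simp: M.emeasure_space_1 N.emeasure_space_1)
    then show ?thesis using iid True by auto
  next
    case False
    then obtain C where C: "C \<in> set Cs" by (cases Cs) auto
    have "X C (zeros C) \<in> M \<rightarrow>\<^sub>M S" using Xm[of "(C, zeros C)"] C by (simp add: nat_pow_def)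
    then have "space S \<noteq> {}" using measurable_space[of "X C (zeros C)" M S] M.not_empty by blast
    then interpret A: exchangeable_array G E M S "\<Union>C\<in>set Cs. nat_pow C" "\<lambda>\<alpha>. X (dom \<alpha>) \<alpha>"
      using assms by (intro exchangeable_array_of_dag_exchangeable)
    define f where "f C u = A.synth u (zeros C)" for C u
    have f: "f C \<in> PiM (closed_subsets E C) (\<lambda>_. unit_interval) \<rightarrow>\<^sub>M S" if C: "C \<in> set Cs" for C
    proof -
      have cl: "down_closed C" using C assms(4) closed_subsets_iff[of C G] by auto
      have z: "zeros C \<in> layer (zeros C)" using dbl_in_layer[of "zeros C"] cl by simp
      then have e: "evens (zeros C) = C" by (simp add: layer_evens)
      have "f C \<in> PiM (closed_subsets E C) (\<lambda>_. uniform01) \<rightarrow>\<^sub>M S"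
        unfolding f_def
      proof (rule A.measurable_synth)
        have "zeros C \<in> (\<Union>C\<in>set Cs. nat_pow C)" using C by (auto simp: nat_pow_def)
        then show "zeros C \<in> A.layer0 (evens (zeros C))" unfolding A.layer0_def e using z by blast
      qed (simp add: e)
      then show ?thesis
        by (simp add: measurable_cong_sets[OF sets_PiM_cong[OF refl sets_uniform01] refl])
    qed
    have fa: "functional_array E f U (fst i) (snd i) = A.synth_array (dbl (snd i))" if i: "i \<in> ?J" for i
    proof
      fix \<omega>
      have "dom (snd i) = fst i" "down_closed (fst i)" "fst i \<subseteq> G"
        using i assms(4) closed_subsets_iff[of "fst i" G] by (auto simp: nat_pow_def)
      from A.synth_array_dbl[OF this, of \<omega>]
      show "functional_array E f U (fst i) (snd i) \<omega> = A.synth_array (dbl (snd i)) \<omega>"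
        by (simp add: functional_array_def f_def U_def)
    qed
    have "joint_law M S Cs X = joint_law N S Cs (functional_array E f U)"
      unfolding joint_law_eq
    proof (rule distr_PiM_eqI[OF M.prob_space_axioms])
      show "functional_array E f U (fst i) (snd i) \<in> N \<rightarrow>\<^sub>M S" if "i \<in> ?J" for i
        unfolding fa[OF that] N_def A.noise_def[symmetric]
        by (rule A.measurable_synth_array_noise) (use that in \<open>auto simp: nat_pow_def\<close>)
      fix J A assume J: "finite J" "J \<subseteq> ?J" and A: "\<And>j. j \<in> J \<Longrightarrow> A j \<in> sets S"
      have pair: "j = (dom (snd j), snd j)" if "j \<in> J" for j using that J by (auto simp: nat_pow_def)
      have "emeasure M {\<omega>\<in>space M. \<forall>j\<in>snd ` J. X (dom j) j \<omega> \<in> A (dom j, j)} =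
        emeasure A.noise {\<omega>\<in>space A.noise. \<forall>j\<in>snd ` J. A.synth_array (dbl j) \<omega> \<in> A (dom j, j)}"
      proof (rule A.law_eq_synth_array)
        show "A (dom j, j) \<in> sets S" if "j \<in> snd ` J" for j using that A pair by force
      qed (use J in \<open>auto simp: nat_pow_def\<close>)
      moreover have "(\<forall>j\<in>snd ` J. X (dom j) j \<omega> \<in> A (dom j, j)) = (\<forall>j\<in>J. X (fst j) (snd j) \<omega> \<in> A j)" for \<omega>
        using pair by simp (metis fst_conv)
      moreover have "(\<forall>j\<in>snd ` J. A.synth_array (dbl j) \<omega> \<in> A (dom j, j)) = (\<forall>j\<in>J. functional_array E f U (fst j) (snd j) \<omega> \<in> A j)" for \<omega>
        using pair J(2) fa by (simp add: subset_eq)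
      ultimately show "emeasure M {\<omega>\<in>space M. \<forall>j\<in>J. X (fst j) (snd j) \<omega> \<in> A j} =
        emeasure N {\<omega>\<in>space N. \<forall>j\<in>J. functional_array E f U (fst j) (snd j) \<omega> \<in> A j}"
        by (simp add: N_def A.noise_def)
    qed (use Xm in auto)
    then show ?thesis using f iid by blast
  qed
qed

end
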